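(* There exists an algorithm that, given a positive integer $n$, outputs a Bose--Einstein condensate of size $n$ uniformly at random among all Bose--Einstein condensates of size $n$, runs in expected $O(n^{1.625})$ time, and uses $O(n)$ space.
   Context: A Bose--Einstein condensate of size (total energy) $n$ is a weighted partition of $n$ in which there are $b_k=\binom{k+2}{2}$ distinct types of summands of size $k\ge 1$; equivalently, it is a finite multiset of nonempty multisets over the three-letter alphabet $\{1,2,3\}$ (each inner multiset of cardinality $k$ is a summand of size $k$), whose total size (sum of cardinalities of the inner multisets) is $n$. So the number $c_n$ of such objects of size $n$ satisfies $\sum_{n\ge0} c_n z^n=\prod_{k\ge1}(1-z^k)^{-\binom{k+2}{2}}$. Model of computation: the real-arithmetic model, with an oracle that evaluates a generating function at any point within its radius of convergence in constant time and a root-finding oracle (returning exact roots, e.g. of a monotone equation in one real variable, in constant time); random variables such as geometric, Poisson, or negative binomial variables can be sampled in time proportional to the value output. *)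

theory Defs
  imports "HOL-Probability.Probability" "HOL-Library.Landau_Symbols"
begin

section \<open>Bose--Einstein condensates\<close>

definition condensates :: "nat \<Rightarrow> nat multiset multiset set" where
  "condensates n =
     {M. (\<forall>m \<in># M. m \<noteq> {#} \<and> set_mset m \<subseteq> {1, 2, 3}) \<and> (\<Sum>m \<in># M. size m) = n}"

lemma finite_condensates: "finite (condensates n)"
proof -
  define L where "L = {xs :: nat list. set xs \<subseteq> {1, 2, 3} \<and> length xs \<le> n}"
  have "finite L"
    unfolding L_def by (rule finite_lists_length_le) simp
  then have fin: "finite {xss. set xss \<subseteq> L \<and> length xss \<le> n}"
    by (rule finite_lists_length_le)
  have "condensates n \<subseteq> (\<lambda>xss. mset (map mset xss)) ` {xss. set xss \<subseteq> L \<and> length xss \<le> n}"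
  proof
    fix M assume M: "M \<in> condensates n"
    obtain ms where ms: "mset ms = M" using ex_mset by blast
    define xss where "xss = map (\<lambda>m. SOME xs. mset xs = m) ms"
    have inv: "mset (SOME xs. mset xs = m) = m" for m :: "nat multiset"
      using ex_mset[of m] by (rule someI_ex)
    have map: "map mset xss = ms" by (simp add: xss_def inv comp_def)
    have sum: "(\<Sum>m\<leftarrow>ms. size m) = n"
      using M ms by (auto simp: condensates_def simp flip: sum_mset_sum_list)
    have ne: "m \<noteq> {#}" "set_mset m \<subseteq> {1, 2, 3}" if "m \<in> set ms" for m
      using M ms that by (auto simp: condensates_def)
    have "sum_list (map (\<lambda>_. 1) ms) \<le> (\<Sum>m\<leftarrow>ms. size m)"
      using ne(1) by (intro sum_list_mono) (simp add: Suc_le_eq nonempty_has_size)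
    then have len: "length xss \<le> n" using sum by (simp add: xss_def sum_list_triv)
    have "xs \<in> L" if "xs \<in> set xss" for xs
    proof -
      have m: "mset xs \<in> set ms" using that map by (metis image_eqI set_map)
      then have "size (mset xs) \<in> set (map size ms)"
        unfolding set_map by (rule imageI)
      then have "size (mset xs) \<le> n"
        unfolding sum[symmetric] by (rule member_le_sum_list) simp
      then show ?thesis using ne(2)[OF m] by (simp add: L_def)
    qed
    then show "M \<in> (\<lambda>xss. mset (map mset xss)) ` {xss. set xss \<subseteq> L \<and> length xss \<le> n}"
      using len map ms by (intro image_eqI[of _ _ xss]) auto
  qed
  with fin show ?thesis by (meson finite_surj)
qed

lemma condensates_nonempty: "condensates n \<noteq> {}"
proof -
  have "replicate_mset n {#1#} \<in> condensates n"
    by (auto simp: condensates_def)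
  then show ?thesis by blast
qed

definition condensate_gf :: "real \<Rightarrow> real" where
  "condensate_gf z = (\<Sum>n. real (card (condensates n)) * z ^ n)"

text \<open>The formal derivative of the previous series; \<open>z * condensate_gf' z\<close> is the generating
  function of condensates with a marked unit of energy.\<close>

definition condensate_gf' :: "real \<Rightarrow> real" where
  "condensate_gf' z = (\<Sum>n. real (Suc n) * real (card (condensates (Suc n))) * z ^ n)"


section \<open>A randomised real RAM with oracles\<close>

text \<open>
  A program is a finite piece of syntax. It works on one memory \<open>nat \<Rightarrow> real\<close> whose cells hold
  exact reals. The only literals are integers, so that no information can be hidden in a real
  constant, and there is no rounding operation.

  An illegal operation (division by zero, an oracle call outside its domain, a sampling
  parameter out of range, indirect addressing through a cell that does not hold a natural number)
  aborts the run. Aborted runs, like diverging ones, are the missing mass of the resulting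
  subprobability distribution.
\<close>

datatype expr =
    Lit int
  | Cell nat
  | Add expr expr
  | Sub expr expr
  | Mul expr expr
  | Div expr expr
  | GF expr
  | GF' expr

datatype test = Less expr expr | Equal expr expr

datatype dist =
    Bernoulli expr
  | Uniform expr
  | Geometric expr
  | Poisson expr
  | NegBinomial expr expr

text \<open>
  \<open>Load d a\<close> and \<open>Store a v\<close> are the indirect accesses \<open>mem[d] := mem[mem[a]]\<close> and
  \<open>mem[mem[a]] := mem[v]\<close>. \<open>Root d e lo hi\<close> solves the equation \<open>e = 0\<close> for the content of cell
  \<open>d\<close> in the open interval from \<open>lo\<close> to \<open>hi\<close>, and stores the solution in that cell.
\<close>

datatype program =
    Skip
  | Assign nat expr
  | Load nat nat
  | Store nat nat
  | Root nat expr expr expr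
  | Sample nat dist
  | Seq program program
  | Cond test program program
  | While test program

type_synonym memory = "nat \<Rightarrow> real"

text \<open>\<open>extent\<close> is one more than the largest address accessed so far.\<close>

record state =
  mem :: memory
  steps :: nat
  extent :: nat

definition lift2 :: "('a \<Rightarrow> 'b \<Rightarrow> 'c) \<Rightarrow> 'a option \<Rightarrow> 'b option \<Rightarrow> 'c option" where
  "lift2 f x y = Option.bind x (\<lambda>a. map_option (f a) y)"

primrec eval :: "expr \<Rightarrow> memory \<Rightarrow> real option" where
  "eval (Lit k) m = Some (of_int k)"
| "eval (Cell i) m = Some (m i)"
| "eval (Add a b) m = lift2 (+) (eval a m) (eval b m)"
| "eval (Sub a b) m = lift2 (-) (eval a m) (eval b m)"
| "eval (Mul a b) m = lift2 (*) (eval a m) (eval b m)"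
| "eval (Div a b) m = (if eval b m = Some 0 then None else lift2 (/) (eval a m) (eval b m))"
| "eval (GF a) m = Option.bind (eval a m)
     (\<lambda>z. if \<bar>z\<bar> < 1 then Some (condensate_gf z) else None)"
| "eval (GF' a) m = Option.bind (eval a m)
     (\<lambda>z. if \<bar>z\<bar> < 1 then Some (condensate_gf' z) else None)"

primrec expr_cost :: "expr \<Rightarrow> nat" where
  "expr_cost (Lit k) = 1"
| "expr_cost (Cell i) = 1"
| "expr_cost (Add a b) = expr_cost a + expr_cost b + 1"
| "expr_cost (Sub a b) = expr_cost a + expr_cost b + 1"
| "expr_cost (Mul a b) = expr_cost a + expr_cost b + 1"
| "expr_cost (Div a b) = expr_cost a + expr_cost b + 1"
| "expr_cost (GF a) = expr_cost a + 1"
| "expr_cost (GF' a) = expr_cost a + 1"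

primrec expr_extent :: "expr \<Rightarrow> nat" where
  "expr_extent (Lit k) = 0"
| "expr_extent (Cell i) = Suc i"
| "expr_extent (Add a b) = max (expr_extent a) (expr_extent b)"
| "expr_extent (Sub a b) = max (expr_extent a) (expr_extent b)"
| "expr_extent (Mul a b) = max (expr_extent a) (expr_extent b)"
| "expr_extent (Div a b) = max (expr_extent a) (expr_extent b)"
| "expr_extent (GF a) = expr_extent a"
| "expr_extent (GF' a) = expr_extent a"

primrec test_eval :: "test \<Rightarrow> memory \<Rightarrow> bool option" where
  "test_eval (Less a b) m = lift2 (<) (eval a m) (eval b m)"
| "test_eval (Equal a b) m = lift2 (=) (eval a m) (eval b m)"

primrec test_cost :: "test \<Rightarrow> nat" where
  "test_cost (Less a b) = expr_cost a + expr_cost b + 1"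
| "test_cost (Equal a b) = expr_cost a + expr_cost b + 1"

primrec test_extent :: "test \<Rightarrow> nat" where
  "test_extent (Less a b) = max (expr_extent a) (expr_extent b)"
| "test_extent (Equal a b) = max (expr_extent a) (expr_extent b)"

definition nat_of_real :: "real \<Rightarrow> nat option" where
  "nat_of_real x = (if x \<in> \<nat> then Some (nat \<lfloor>x\<rfloor>) else None)"

text \<open>\<open>Geometric p\<close> and \<open>NegBinomial r p\<close> count the failures before the first, respectively the
  \<open>r\<close>-th, success of independent trials with success probability \<open>p\<close>; \<open>Uniform N\<close> ranges over
  \<open>{0..<N}\<close>.\<close>

primrec sampler :: "dist \<Rightarrow> memory \<Rightarrow> nat pmf option" where
  "sampler (Bernoulli e) m = Option.bind (eval e m)
     (\<lambda>p. if 0 \<le> p \<and> p \<le> 1 then Some (map_pmf of_bool (bernoulli_pmf p)) else None)"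
| "sampler (Uniform e) m = Option.bind (Option.bind (eval e m) nat_of_real)
     (\<lambda>N. if 0 < N then Some (pmf_of_set {0..<N}) else None)"
| "sampler (Geometric e) m = Option.bind (eval e m)
     (\<lambda>p. if 0 < p \<and> p \<le> 1 then Some (geometric_pmf p) else None)"
| "sampler (Poisson e) m = Option.bind (eval e m)
     (\<lambda>l. if 0 < l then Some (poisson_pmf l) else None)"
| "sampler (NegBinomial a e) m = Option.bind (Option.bind (eval a m) nat_of_real)
     (\<lambda>r. Option.bind (eval e m)
       (\<lambda>p. if 0 < p \<and> p \<le> 1 then Some (neg_binomial_pmf r p) else None))"

primrec dist_cost :: "dist \<Rightarrow> nat" where
  "dist_cost (Bernoulli e) = expr_cost e"
| "dist_cost (Uniform e) = expr_cost e"
| "dist_cost (Geometric e) = expr_cost e"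
| "dist_cost (Poisson e) = expr_cost e"
| "dist_cost (NegBinomial a e) = expr_cost a + expr_cost e"

primrec dist_extent :: "dist \<Rightarrow> nat" where
  "dist_extent (Bernoulli e) = expr_extent e"
| "dist_extent (Uniform e) = expr_extent e"
| "dist_extent (Geometric e) = expr_extent e"
| "dist_extent (Poisson e) = expr_extent e"
| "dist_extent (NegBinomial a e) = max (expr_extent a) (expr_extent e)"

definition monotone_root :: "(real \<Rightarrow> real option) \<Rightarrow> real \<Rightarrow> real \<Rightarrow> real option" where
  "monotone_root f lo hi =
     (if (\<forall>x\<in>{lo<..<hi}. f x \<noteq> None) \<and>
         (strict_mono_on {lo<..<hi} (\<lambda>x. the (f x)) \<or>
          strict_antimono_on {lo<..<hi} (\<lambda>x. the (f x))) \<and>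
         (\<exists>x\<in>{lo<..<hi}. f x = Some 0)
      then Some (THE x. x \<in> {lo<..<hi} \<and> f x = Some 0)
      else None)"

definition root_eval :: "nat \<Rightarrow> expr \<Rightarrow> expr \<Rightarrow> expr \<Rightarrow> memory \<Rightarrow> real option" where
  "root_eval d e lo hi m =
     Option.bind (eval lo m) (\<lambda>a. Option.bind (eval hi m)
       (\<lambda>b. monotone_root (\<lambda>x. eval e (m(d := x))) a b))"

abbreviation abort :: "'a spmf" where
  "abort \<equiv> return_pmf None"

definition charge :: "nat \<Rightarrow> nat \<Rightarrow> state \<Rightarrow> state" where
  "charge t w s = s\<lparr>steps := steps s + t, extent := max (extent s) w\<rparr>"

definition put :: "nat \<Rightarrow> real \<Rightarrow> state \<Rightarrow> state" where
  "put d v s = s\<lparr>mem := (mem s)(d := v), extent := max (extent s) (Suc d)\<rparr>"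

partial_function (spmf) while_spmf ::
  "('s \<Rightarrow> bool option) \<Rightarrow> ('s \<Rightarrow> 's) \<Rightarrow> ('s \<Rightarrow> 's spmf) \<Rightarrow> 's \<Rightarrow> 's spmf" where
  "while_spmf b tick body s =
     (case b s of
        None \<Rightarrow> abort
      | Some v \<Rightarrow>
          if v then bind_spmf (body (tick s)) (while_spmf b tick body)
          else return_spmf (tick s))"

text \<open>Sampling a value \<open>k\<close> costs time proportional to \<open>k + 1\<close>; every other elementary
  operation, oracle calls included, costs one unit.\<close>

primrec exec :: "program \<Rightarrow> state \<Rightarrow> state spmf" where
  "exec Skip s = return_spmf (charge 1 0 s)"
| "exec (Assign d e) s =
     (case eval e (mem s) of
        None \<Rightarrow> abort
      | Some v \<Rightarrow> return_spmf (put d v (charge (1 + expr_cost e) (expr_extent e) s)))"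
| "exec (Load d a) s =
     (case nat_of_real (mem s a) of
        None \<Rightarrow> abort
      | Some i \<Rightarrow> return_spmf (put d (mem s i) (charge 1 (Suc (max a i)) s)))"
| "exec (Store a v) s =
     (case nat_of_real (mem s a) of
        None \<Rightarrow> abort
      | Some i \<Rightarrow> return_spmf (put i (mem s v) (charge 1 (Suc (max a v)) s)))"
| "exec (Root d e lo hi) s =
     (case root_eval d e lo hi (mem s) of
        None \<Rightarrow> abort
      | Some v \<Rightarrow> return_spmf (put d v
          (charge (1 + expr_cost e + expr_cost lo + expr_cost hi)
             (max (expr_extent e) (max (expr_extent lo) (expr_extent hi))) s)))"
| "exec (Sample d D) s =
     (case sampler D (mem s) of
        None \<Rightarrow> abort
      | Some p \<Rightarrow> map_spmf
          (\<lambda>k. put d (real k) (charge (1 + dist_cost D + k) (dist_extent D) s))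
          (spmf_of_pmf p))"
| "exec (Seq c1 c2) s = bind_spmf (exec c1 s) (exec c2)"
| "exec (Cond b c1 c2) s =
     (case test_eval b (mem s) of
        None \<Rightarrow> abort
      | Some v \<Rightarrow> (if v then exec c1 else exec c2) (charge (test_cost b) (test_extent b) s))"
| "exec (While b c) s =
     while_spmf (\<lambda>s. test_eval b (mem s)) (charge (test_cost b) (test_extent b)) (exec c) s"


section \<open>Input, output and resources\<close>

definition initial :: "nat \<Rightarrow> state" where
  "initial n = \<lparr>mem = (\<lambda>_. 0)(0 := real n), steps = 0, extent = 1\<rparr>"

definition run :: "program \<Rightarrow> nat \<Rightarrow> state spmf" where
  "run P n = exec P (initial n)"

text \<open>On termination cell \<open>0\<close> holds the number of summands, and the \<open>i\<close>-th summand (counting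
  from \<open>0\<close>) is stored in cells \<open>3 * i + 1\<close>, \<open>3 * i + 2\<close>, \<open>3 * i + 3\<close> as the multiplicities
  of the letters \<open>1\<close>, \<open>2\<close>, \<open>3\<close>. All these numbers have to be exact naturals.\<close>

definition decode :: "memory \<Rightarrow> nat multiset multiset option" where
  "decode m =
     (let c = (\<lambda>i. nat \<lfloor>m i\<rfloor>) in
      if m 0 \<in> \<nat> \<and> (\<forall>i \<in> {1..3 * c 0}. m i \<in> \<nat>)
      then Some (image_mset
             (\<lambda>i. replicate_mset (c (3 * i + 1)) 1 + replicate_mset (c (3 * i + 2)) 2
                + replicate_mset (c (3 * i + 3)) 3)
             (mset_set {0..<c 0}))
      else None)"

definition expected_time :: "program \<Rightarrow> nat \<Rightarrow> ennreal" where
  "expected_time P n = (\<integral>\<^sup>+ s. of_nat (steps s) \<partial>measure_spmf (run P n))"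

end

theory Submission
  imports Defs "HOL-Real_Asymp.Real_Asymp"
begin

text \<open>
  Let \<open>c\<^sub>n\<close> be the number of condensates of energy \<open>n\<close> and \<open>b\<^sub>d\<close> the number of summands of size \<open>d\<close>.
  Marking a unit of energy gives \<open>n c\<^sub>n = \<Sum> d b\<^sub>d c\<^bsub>n - d j\<^esub>\<close>, the sum ranging over the pairs \<open>(d, j)\<close> with
  \<open>d j \<le> n\<close>. Given the table of the \<open>c\<^sub>m\<close>, a uniform condensate is therefore obtained by choosing
  \<open>(d, j)\<close> with probability proportional to \<open>d b\<^sub>d c\<^bsub>n - d j\<^esub>\<close>, then a summand of size \<open>d\<close> uniformly, taking
  \<open>j\<close> copies of it, and continuing with energy \<open>n - d j\<close>.

  If only pairs with \<open>d, j \<le> K\<close> are used, where \<open>K \<approx> n powr (5/16)\<close>, then table and generation cost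
  \<open>O(n K\<^sup>2) = O(n powr 1.625)\<close>. The recurrence itself implies \<open>c\<^sub>m \<ge> 2 c\<^bsub>m - J\<^esub>\<close> as soon as
  \<open>J\<^sup>4 \<ge> 16 m\<close>, so the pairs that were left out have total probability less than any power of \<open>1 / n\<close>.
  Hence the uniform distribution is a mixture of the truncated one, with weight \<open>1 - 1 / n\<^sup>2\<close>, and a
  remainder that is sampled with full tables in time \<open>O(n\<^sup>3)\<close>.
\<close>

section \<open>Counting condensates\<close>

text \<open>Truncation does more than fail on a few condensates: it returns \<open>M\<close> with
  probability \<open>share K 1 0 M / table K 1 0 n\<close>, which varies with \<open>M\<close>.
  Exact uniformity therefore requires the remainder to have precisely the complementary
  distribution. Its masses are affine in \<open>share K 1 0 M\<close>, and since
  \<open>share\<close> is linear in its two scores \<open>a\<close> and \<open>b\<close>, they are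
  again of the form \<open>share K a b M / table K a b n\<close>. This is why the walk carries two
  scores and why one program can draw from both components. The score \<open>a\<close> needed there
  is non-negative exactly if truncation loses at most the fraction \<open>1 / n ^ 2\<close> of all
  condensates.

  The growth estimate needs \<open>K\<close> to exceed \<open>n powr (1/4)\<close> by more than a
  logarithmic factor, and \<open>1 + 2 * (5/16) = 1.625\<close> is the exponent allowed. A remainder
  of cubic cost and probability \<open>1 / n ^ 2\<close> adds only a linear term to the expectation.
  The estimate holds from some threshold on, which becomes the literal \<open>n0\<close> of the
  program and bounds \<open>K\<close> from below.\<close>

definition summand :: "nat \<Rightarrow> nat \<Rightarrow> nat \<Rightarrow> nat multiset" where
  "summand x y z = replicate_mset x 1 + replicate_mset y 2 + replicate_mset z 3"

definition summands :: "nat \<Rightarrow> nat multiset set" where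
  "summands d = {p. size p = d \<and> set_mset p \<subseteq> {1, 2, 3}}"

lemma count_summand:
  "count (summand x y z) 1 = x" "count (summand x y z) 2 = y" "count (summand x y z) 3 = z"
  by (simp_all add: summand_def)

lemma size_summand: "size (summand x y z) = x + y + z"
  by (simp add: summand_def)

lemma set_summand: "set_mset (summand x y z) \<subseteq> {1, 2, 3}"
  by (auto simp: summand_def)

lemma summand_count:
  assumes "set_mset p \<subseteq> {1, 2, 3}"
  shows "p = summand (count p 1) (count p 2) (count p 3)"
proof (rule multiset_eqI)
  fix a
  show "count p a = count (summand (count p 1) (count p 2) (count p 3)) a"
  proof (cases "a \<in> {1, 2, 3}")
    case True
    then show ?thesis by (auto simp: count_summand[unfolded One_nat_def] count_summand)
  next
    case False
    then have "a \<notin># p" "a \<notin># summand (count p 1) (count p 2) (count p 3)"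
      using assms set_summand by blast+
    then show ?thesis by (simp add: not_in_iff)
  qed
qed

lemma sum_summands:
  fixes F :: "nat multiset \<Rightarrow> 'a :: comm_monoid_add"
  shows "(\<Sum>p\<in>summands d. F p) = (\<Sum>x\<le>d. \<Sum>y\<le>d - x. F (summand x y (d - (x + y))))"
proof -
  have "(\<Sum>x\<le>d. \<Sum>y\<le>d - x. F (summand x y (d - (x + y))))
      = (\<Sum>(x, y)\<in>Sigma {..d} (\<lambda>x. {..d - x}). F (summand x y (d - (x + y))))"
    by (simp add: sum.Sigma)
  also have "\<dots> = (\<Sum>p\<in>summands d. F p)"
  proof (rule sum.reindex_bij_witness[where i = "\<lambda>p. (count p 1, count p 2)"
        and j = "\<lambda>(x, y). summand x y (d - (x + y))"])
    fix p assume p: "p \<in> summands d"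
    then have e: "p = summand (count p 1) (count p 2) (count p 3)"
      by (intro summand_count) (simp add: summands_def)
    then have "d = count p 1 + count p 2 + count p 3"
      using p size_summand[of "count p 1" "count p 2" "count p 3"] by (simp add: summands_def)
    then show "(case (count p 1, count p 2) of (x, y) \<Rightarrow> summand x y (d - (x + y))) = p"
      "(count p 1, count p 2) \<in> Sigma {..d} (\<lambda>x. {..d - x})"
      using e by auto
  qed (use count_summand size_summand set_summand in \<open>force simp: summands_def\<close>)+
  finally show ?thesis ..
qed

lemma finite_summands: "finite (summands d)"
proof -
  have "summands d \<subseteq> (\<lambda>(x, y, z). summand x y z) ` ({..d} \<times> {..d} \<times> {..d})"
  proof
    fix p assume p: "p \<in> summands d"
    then have e: "p = summand (count p 1) (count p 2) (count p 3)"
      by (intro summand_count) (simp add: summands_def)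
    moreover have "count p a \<le> d" for a
      using p count_le_size[of p a] by (simp add: summands_def)
    ultimately show "p \<in> (\<lambda>(x, y, z). summand x y z) ` ({..d} \<times> {..d} \<times> {..d})"
      by (intro image_eqI[of _ _ "(count p 1, count p 2, count p 3)"]) auto
  qed
  then show ?thesis by (rule finite_subset) auto
qed

text \<open>The binomial coefficient \<open>d + 2\<close> over 2, counting the triples of
  multiplicities with sum \<open>d\<close>. It is real because it enters weights that the program
  computes with exact reals.\<close>

definition choices :: "nat \<Rightarrow> real" where
  "choices d = real ((d + 1) * (d + 2)) / 2"

lemma card_summands: "real (card (summands d)) = choices d"
proof -
  have *: "2 * (\<Sum>x\<le>d. Suc (d - x)) = (d + 1) * (d + 2)" for d :: nat
  proof -
    have "(\<Sum>x\<le>d. Suc (d - x)) = (\<Sum>x\<le>d. Suc x)"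
      using sum.nat_diff_reindex[of Suc "Suc d"] by (simp add: lessThan_Suc_atMost)
    moreover have "2 * (\<Sum>x\<le>d. Suc x) = (d + 1) * (d + 2)"
      by (induction d) auto
    ultimately show ?thesis by simp
  qed
  have "card (summands d) = (\<Sum>x\<le>d. Suc (d - x))"
    using sum_summands[of "\<lambda>_. 1::nat" d] by simp
  then have "2 * card (summands d) = (d + 1) * (d + 2)" using *[of d] by simp
  then have "2 * real (card (summands d)) = real ((d + 1) * (d + 2))"
    by (metis of_nat_mult of_nat_numeral)
  then show ?thesis by (simp add: choices_def)
qed

section \<open>Taking condensates apart by removing copies of one summand\<close>

definition weight :: "nat multiset multiset \<Rightarrow> nat" where
  "weight M = (\<Sum>m\<in>#M. size m)"

lemma condensates_iff:
  "M \<in> condensates m \<longleftrightarrow> (\<forall>p\<in>#M. p \<noteq> {#} \<and> set_mset p \<subseteq> {1, 2, 3}) \<and> weight M = m"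
  by (simp add: condensates_def weight_def)

lemma weight_add [simp]: "weight (M + N) = weight M + weight N"
  by (simp add: weight_def)

lemma weight_replicate [simp]: "weight (replicate_mset j p) = j * size p"
  by (simp add: weight_def)

lemma replicate_subseteq_iff: "replicate_mset j p \<subseteq># M \<longleftrightarrow> j \<le> count M p"
  by (metis count_le_replicate_mset_subset_eq)

lemma weight_diff:
  assumes "j \<le> count M p"
  shows "weight M = weight (M - replicate_mset j p) + j * size p"
  using assms by (metis replicate_subseteq_iff subset_mset.diff_add weight_add weight_replicate)

lemma weight_eq_sum:
  assumes "finite S" "set_mset M \<subseteq> S"
  shows "(\<Sum>p\<in>S. count M p * size p) = weight M"
  using assms(2)
proof (induction M)
  case empty
  then show ?case by (simp add: weight_def)
next
  case (add a M)
  have "(\<Sum>p\<in>S. count (add_mset a M) p * size p)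
      = (\<Sum>p\<in>S. (if p = a then size p else 0) + count M p * size p)"
    by (intro sum.cong) auto
  also have "\<dots> = size a + weight M"
    using add assms(1) by (simp add: sum.distrib)
  finally show ?case by (simp add: weight_def)
qed

lemma condensates_0: "condensates 0 = {{#}}"
proof -
  have "M = {#}" if "M \<in> condensates 0" for M
  proof (rule ccontr)
    assume "M \<noteq> {#}"
    then obtain p where p: "p \<in># M" by blast
    then have "size p \<le> weight M" by (auto simp: weight_def dest!: multi_member_split)
    with that p show False by (auto simp: condensates_iff)
  qed
  then show ?thesis by (auto simp: condensates_iff weight_def)
qed

lemma condensates_diff:
  assumes "M \<in> condensates m" "j \<le> count M p" "0 < j"
  shows "M - replicate_mset j p \<in> condensates (m - size p * j)" "size p * j \<le> m"
    "0 < size p" "j \<le> m" "size p \<le> m" "p \<in> summands (size p)"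
proof -
  have p: "p \<in># M" using assms by (metis count_greater_zero_iff order.strict_trans2)
  then show sz: "0 < size p" and "p \<in> summands (size p)"
    using assms by (auto simp: condensates_iff summands_def simp flip: nonempty_has_size)
  have w: "weight M = weight (M - replicate_mset j p) + j * size p"
    by (rule weight_diff) fact
  then show le: "size p * j \<le> m" using assms(1) by (auto simp: condensates_iff mult.commute)
  show "M - replicate_mset j p \<in> condensates (m - size p * j)"
    using assms(1) w by (auto simp: condensates_iff mult.commute dest: in_diffD)
  show "j \<le> m" "size p \<le> m" using le sz assms(3)
    by (metis One_nat_def Suc_leI le_trans mult_le_mono1 mult_le_mono2 nat_mult_1 nat_mult_1_right)+
qed

lemma condensates_insert:
  assumes "M \<in> condensates m" "p \<in> summands d" "0 < d"
  shows "M + replicate_mset j p \<in> condensates (m + d * j)"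
  using assms by (cases "j = 0") (auto simp: condensates_iff summands_def simp flip: nonempty_has_size)

text \<open>Remembering \<open>p\<close> and \<open>j\<close> makes the removal of \<open>j\<close>
  copies invertible: every condensate of energy \<open>m - d * j\<close>, extended by
  \<open>j\<close> copies of any summand of size \<open>d\<close>, arises exactly once.
  \<open>F\<close> may depend on the remainder because \<open>share\<close> is evaluated there
  again.\<close>

lemma sum_condensates_remove:
  fixes F :: "nat multiset \<Rightarrow> nat \<Rightarrow> nat multiset multiset \<Rightarrow> 'a :: comm_monoid_add"
  shows "(\<Sum>M\<in>condensates m. \<Sum>p\<in>set_mset M. \<Sum>j=1..count M p. F p j (M - replicate_mset j p))
    = (\<Sum>d=1..m. \<Sum>j=1..m. if d * j \<le> m
        then \<Sum>p\<in>summands d. \<Sum>M\<in>condensates (m - d * j). F p j M else 0)"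
proof -
  define D where "D = {(d, j). d \<in> {1..m} \<and> j \<in> {1..m} \<and> d * j \<le> m}"
  have fD: "finite D" by (rule finite_subset[of _ "{1..m} \<times> {1..m}"]) (auto simp: D_def)
  have "(\<Sum>d=1..m. \<Sum>j=1..m. if d * j \<le> m
        then \<Sum>p\<in>summands d. \<Sum>M\<in>condensates (m - d * j). F p j M else 0)
      = (\<Sum>(d, j)\<in>{1..m} \<times> {1..m}. if d * j \<le> m
          then \<Sum>p\<in>summands d. \<Sum>M\<in>condensates (m - d * j). F p j M else 0)"
    by (simp add: sum.cartesian_product)
  also have "\<dots> = (\<Sum>(d, j)\<in>D. \<Sum>p\<in>summands d. \<Sum>M\<in>condensates (m - d * j). F p j M)"
    by (rule sum.mono_neutral_cong_right) (auto simp: D_def split: if_splits)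
  also have "\<dots> = (\<Sum>(d, j)\<in>D. \<Sum>(p, M)\<in>summands d \<times> condensates (m - d * j). F p j M)"
    by (simp add: sum.cartesian_product)
  also have "\<dots> = (\<Sum>(e, p, M)\<in>Sigma D (\<lambda>(d, j). summands d \<times> condensates (m - d * j)). F p (snd e) M)"
    using fD by (subst sum.Sigma[symmetric]) (auto simp: finite_summands finite_condensates split_beta)
  also have "\<dots> = (\<Sum>(M, p, j)\<in>Sigma (condensates m) (\<lambda>M. Sigma (set_mset M) (\<lambda>p. {1..count M p})).
      F p j (M - replicate_mset j p))"
  proof (rule sum.reindex_bij_witness[where
          j = "\<lambda>((d, j), p, M). (M + replicate_mset j p, p, j)" and
          i = "\<lambda>(M, p, j). ((size p, j), p, M - replicate_mset j p)"])
    fix t assume "t \<in> Sigma (condensates m) (\<lambda>M. Sigma (set_mset M) (\<lambda>p. {1..count M p}))"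
    then obtain M p j where t: "t = (M, p, j)" "M \<in> condensates m" "j \<le> count M p" "0 < j"
      by (cases t) auto
    show "(case t of (M, p, j) \<Rightarrow> ((size p, j), p, M - replicate_mset j p))
        \<in> Sigma D (\<lambda>(d, j). summands d \<times> condensates (m - d * j))"
      using t condensates_diff[OF t(2-4)] by (auto simp: D_def)
    show "(\<lambda>((d, j), p, M). (M + replicate_mset j p, p, j))
        ((\<lambda>(M, p, j). ((size p, j), p, M - replicate_mset j p)) t) = t"
      using t by (simp add: replicate_subseteq_iff)
  next
    fix t assume "t \<in> Sigma D (\<lambda>(d, j). summands d \<times> condensates (m - d * j))"
    then obtain d j p M where t: "t = ((d, j), p, M)" "M \<in> condensates (m - d * j)"
        "p \<in> summands d" "0 < d" "0 < j" "d * j \<le> m"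
      by (cases t) (auto simp: D_def)
    have "M + replicate_mset j p \<in> condensates m"
      using condensates_insert[OF t(2-4), of j] t(6) by simp
    then show "(\<lambda>((d, j), p, M). (M + replicate_mset j p, p, j)) t
        \<in> Sigma (condensates m) (\<lambda>M. Sigma (set_mset M) (\<lambda>p. {1..count M p}))"
      using t by auto
    show "(\<lambda>(M, p, j). ((size p, j), p, M - replicate_mset j p))
        ((\<lambda>((d, j), p, M). (M + replicate_mset j p, p, j)) t) = t"
      using t by (simp add: summands_def)
  qed auto
  also have "\<dots> = (\<Sum>M\<in>condensates m. \<Sum>p\<in>set_mset M. \<Sum>j=1..count M p.
      F p j (M - replicate_mset j p))"
    by (subst sum.Sigma[symmetric]) (auto simp: finite_condensates sum.Sigma split_beta)
  finally show ?thesis ..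
qed

text \<open>
  Dismantle \<open>M\<close> by repeatedly removing \<open>j\<close> copies of a summand \<open>p\<close> at once, each pair \<open>(p, j)\<close> with
  \<open>1 \<le> j \<le> count M p\<close> having probability \<open>size p / weight M\<close>. Then \<open>share K a b M\<close> is \<open>a\<close> times the
  probability that \<open>size p \<le> K\<close> and \<open>j \<le> K\<close> hold in every step, plus \<open>b\<close> times the probability of
  the opposite. The sampler runs this walk backwards in time.
\<close>

function share :: "nat \<Rightarrow> real \<Rightarrow> real \<Rightarrow> nat multiset multiset \<Rightarrow> real" where
  "share K a b M = (if M = {#} then a else
     (\<Sum>p\<in>set_mset M. \<Sum>j=1..count M p. real (size p) *
        (if size p \<le> K \<and> j \<le> K then share K a b (M - replicate_mset j p) else b))
     / real (weight M))"
  by auto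
termination
proof (relation "Wellfounded.measure (\<lambda>(K, a, b, M). size M)")
  fix K :: nat and a b :: real and M :: "nat multiset multiset" and p :: "nat multiset" and j :: nat
  assume "p \<in> set_mset M" "j \<in> {1..count M p}"
  then have "replicate_mset j p \<subseteq># M" "0 < j" "0 < size M"
    by (auto simp: replicate_subseteq_iff simp flip: nonempty_has_size)
  then show "((K, a, b, M - replicate_mset j p), K, a, b, M) \<in> Wellfounded.measure (\<lambda>(K, a, b, M). size M)"
    by (simp add: size_Diff_submset)
qed auto

declare share.simps [simp del]

text \<open>The total of \<open>share K a b\<close> over the condensates of energy \<open>m\<close>,
  as a recurrence on energies alone. Once a pair exceeds the cutoff, every condensate that may
  remain scores \<open>b\<close>, hence the product with their number.\<close>

function table :: "nat \<Rightarrow> real \<Rightarrow> real \<Rightarrow> nat \<Rightarrow> real" where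
  "table K a b m = (if m = 0 then a else
     (\<Sum>d=1..m. \<Sum>j=1..m. if d * j \<le> m then real d * choices d *
        (if d \<le> K \<and> j \<le> K then table K a b (m - d * j) else b * real (card (condensates (m - d * j))))
        else 0) / real m)"
  by auto
termination
  by (relation "Wellfounded.measure (\<lambda>(K, a, b, m). m)") auto

declare table.simps [simp del]

text \<open>The share of the remainder does not involve the removed summand \<open>p\<close>, so the
  sum over \<open>p\<close> in \<open>summands d\<close> collapses to the factor
  \<open>choices d\<close>, and grouping by \<open>(d, j)\<close> turns a recursion on multisets
  into one on energies.\<close>

lemma sum_share: "(\<Sum>M\<in>condensates m. share K a b M) = table K a b m"
proof (induction m rule: less_induct)
  case (less m)
  show ?case
  proof (cases "m = 0")
    case True
    then show ?thesis by (simp add: condensates_0 share.simps table.simps)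
  next
    case False
    have "(\<Sum>M\<in>condensates m. share K a b M)
        = (\<Sum>M\<in>condensates m. \<Sum>p\<in>set_mset M. \<Sum>j=1..count M p. real (size p) *
        (if size p \<le> K \<and> j \<le> K then share K a b (M - replicate_mset j p) else b)) / real m"
    proof (subst sum_divide_distrib, rule sum.cong)
      fix M assume "M \<in> condensates m"
      with False have "weight M = m" "M \<noteq> {#}" by (auto simp: condensates_iff weight_def)
      then show "share K a b M = (\<Sum>p\<in>set_mset M. \<Sum>j=1..count M p. real (size p) *
        (if size p \<le> K \<and> j \<le> K then share K a b (M - replicate_mset j p) else b)) / real m"
        by (subst share.simps) simp
    qed simp
    also have "\<dots> = (\<Sum>d=1..m. \<Sum>j=1..m. if d * j \<le> m
        then \<Sum>p\<in>summands d. \<Sum>M\<in>condensates (m - d * j). real (size p) *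
          (if size p \<le> K \<and> j \<le> K then share K a b M else b) else 0) / real m"
      by (subst sum_condensates_remove) simp
    also have "\<dots> = (\<Sum>d=1..m. \<Sum>j=1..m. if d * j \<le> m then real d * choices d *
        (if d \<le> K \<and> j \<le> K then table K a b (m - d * j) else b * real (card (condensates (m - d * j))))
        else 0) / real m"
    proof (rule arg_cong[where f = "\<lambda>x. x / real m"], rule sum.cong[OF refl], rule sum.cong[OF refl],
        rule if_cong[OF refl _ refl])
      fix d j assume dj: "d \<in> {1..m}" "j \<in> {1..m}" "d * j \<le> m"
      have "(\<Sum>p\<in>summands d. \<Sum>M\<in>condensates (m - d * j). real (size p) *
          (if size p \<le> K \<and> j \<le> K then share K a b M else b))
        = (\<Sum>p\<in>summands d. real d * (\<Sum>M\<in>condensates (m - d * j).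
          (if d \<le> K \<and> j \<le> K then share K a b M else b)))"
        unfolding sum_distrib_left by (intro sum.cong) (auto simp: summands_def)
      also have "\<dots> = real d * choices d * (\<Sum>M\<in>condensates (m - d * j).
          (if d \<le> K \<and> j \<le> K then share K a b M else b))"
        by (simp add: card_summands)
      also have "(\<Sum>M\<in>condensates (m - d * j). (if d \<le> K \<and> j \<le> K then share K a b M else b))
        = (if d \<le> K \<and> j \<le> K then table K a b (m - d * j) else b * real (card (condensates (m - d * j))))"
        using less.IH[of "m - d * j"] dj False by (cases "d \<le> K"; cases "j \<le> K") simp_all
      finally show "(\<Sum>p\<in>summands d. \<Sum>M\<in>condensates (m - d * j). real (size p) *
          (if size p \<le> K \<and> j \<le> K then share K a b M else b))
        = real d * choices d * (if d \<le> K \<and> j \<le> K then table K a b (m - d * j)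
            else b * real (card (condensates (m - d * j))))" .
    qed
    also have "\<dots> = table K a b m" using False by (subst (2) table.simps) simp
    finally show ?thesis .
  qed
qed

lemma weight_eq_0_iff:
  assumes "M \<in> condensates m"
  shows "weight M = 0 \<longleftrightarrow> M = {#}"
  using assms condensates_0 by (auto simp: condensates_iff weight_def)

text \<open>In the probabilistic reading \<open>share K a b M\<close> is an expected score with
  values \<open>a\<close> and \<open>b\<close>, hence linear in the pair of scores. Every share can
  thus be expressed through \<open>share K 1 0 M\<close>.\<close>

lemma share_linear:
  "share K (r * a + s * a') (r * b + s * b') M = r * share K a b M + s * share K a' b' M"
proof (induction "size M" arbitrary: M rule: less_induct)
  case less
  show ?case
  proof (cases "M = {#}")
    case True
    then show ?thesis by (simp add: share.simps)
  next
    case False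
    have "(if size p \<le> K \<and> j \<le> K then share K (r * a + s * a') (r * b + s * b') (M - replicate_mset j p)
          else r * b + s * b')
        = r * (if size p \<le> K \<and> j \<le> K then share K a b (M - replicate_mset j p) else b)
          + s * (if size p \<le> K \<and> j \<le> K then share K a' b' (M - replicate_mset j p) else b')"
      if "p \<in># M" "j \<in> {1..count M p}" for p j
    proof -
      have "replicate_mset j p \<subseteq># M" "0 < j" "0 < size M"
        using that by (auto simp: replicate_subseteq_iff simp flip: nonempty_has_size)
      then have "size (M - replicate_mset j p) < size M" by (simp add: size_Diff_submset)
      then show ?thesis using less by auto
    qed
    then have "(\<Sum>p\<in>set_mset M. \<Sum>j=1..count M p. real (size p) * (if size p \<le> K \<and> j \<le> K
          then share K (r * a + s * a') (r * b + s * b') (M - replicate_mset j p) else r * b + s * b'))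
        = (\<Sum>p\<in>set_mset M. \<Sum>j=1..count M p. r * (real (size p) *
            (if size p \<le> K \<and> j \<le> K then share K a b (M - replicate_mset j p) else b))
          + s * (real (size p) *
            (if size p \<le> K \<and> j \<le> K then share K a' b' (M - replicate_mset j p) else b')))"
      by (intro sum.cong refl) (simp add: algebra_simps)
    then show ?thesis using False
      by (simp add: share.simps[of _ _ _ M] sum.distrib add_divide_distrib flip: sum_distrib_left)
  qed
qed

text \<open>Each \<open>p\<close> occurs in \<open>count M p\<close> pairs \<open>(p, j)\<close>, so
  the weights \<open>size p\<close> add up to the energy: the removal rule is a probability
  distribution.\<close>

lemma sum_size_remove: "(\<Sum>p\<in>set_mset M. \<Sum>j=1..count M p. real (size p) * r) = real (weight M) * r"
proof -
  have "(\<Sum>p\<in>set_mset M. \<Sum>j=1..count M p. real (size p) * r)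
      = real (\<Sum>p\<in>set_mset M. count M p * size p) * r"
    by (simp add: sum_distrib_right mult.assoc)
  then show ?thesis by (subst (asm) weight_eq_sum) auto
qed

text \<open>With \<open>b = 1\<close> both outcomes of the walk score 1; if no size and no
  multiplicity exceeds \<open>K\<close>, the score \<open>b\<close> is never reached. One induction
  handles both cases because either condition survives a removal.\<close>

lemma share_eq_1:
  assumes "M \<in> condensates m" "b = 1 \<or> (\<forall>p\<in>#M. size p \<le> K \<and> count M p \<le> K)"
  shows "share K 1 b M = 1"
  using assms
proof (induction m arbitrary: M rule: less_induct)
  case (less m)
  show ?case
  proof (cases "M = {#}")
    case True
    then show ?thesis by (simp add: share.simps)
  next
    case False
    have "(if size p \<le> K \<and> j \<le> K then share K 1 b (M - replicate_mset j p) else b) = 1"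
      if "p \<in># M" "j \<in> {1..count M p}" for p j
    proof (cases "size p \<le> K \<and> j \<le> K")
      case True
      have "j \<le> count M p" "0 < j" using that by auto
      note * = condensates_diff[OF less.prems(1) this]
      have "b = 1 \<or> (\<forall>q\<in>#M - replicate_mset j p. size q \<le> K \<and> count (M - replicate_mset j p) q \<le> K)"
        using less.prems(2) by (auto dest: in_diffD intro: le_trans[OF diff_le_self])
      moreover have "m - size p * j < m" using *(2-5) that by simp
      ultimately show ?thesis using True less.IH * by auto
    next
      case F: False
      then show ?thesis using less.prems that by force
    qed
    then have "(\<Sum>p\<in>set_mset M. \<Sum>j=1..count M p. real (size p) *
        (if size p \<le> K \<and> j \<le> K then share K 1 b (M - replicate_mset j p) else b))
        = (\<Sum>p\<in>set_mset M. \<Sum>j=1..count M p. real (size p) * 1)"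
      by (intro sum.cong refl) simp
    then show ?thesis using False weight_eq_0_iff[OF less.prems(1)]
      by (simp only: share.simps[of _ _ _ M] sum_size_remove) simp
  qed
qed

lemma share_nonneg: "0 \<le> a \<Longrightarrow> 0 \<le> b \<Longrightarrow> 0 \<le> share K a b M"
proof (induction K a b M rule: share.induct)
  case (1 K a b M)
  then show ?case by (subst share.simps) (auto intro!: divide_nonneg_nonneg sum_nonneg)
qed

lemma share_le_1:
  assumes "M \<in> condensates m"
  shows "share K 1 0 M \<le> 1"
proof -
  have "share K (1 * 1 + 1 * 0) (1 * 0 + 1 * 1) M = 1"
    using share_eq_1[OF assms, of 1] by simp
  then show ?thesis unfolding share_linear using share_nonneg[of 0 1 K M] by simp
qed

lemma table_0_1: "table K 0 1 m = real (card (condensates m)) - table K 1 0 m"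
proof -
  have "share K 0 1 M = 1 - share K 1 0 M" if "M \<in> condensates m" for M
    using share_linear[of K 1 1 "-1" 1 1 0 M] share_eq_1[OF that, of 1 K] by simp
  then show ?thesis by (simp add: sum_subtractf flip: sum_share)
qed

lemma table_linear: "table K (r * a + s * a') (r * b + s * b') m = r * table K a b m + s * table K a' b' m"
  by (simp add: share_linear sum.distrib sum_distrib_left flip: sum_share)

lemma table_nonneg: "0 \<le> a \<Longrightarrow> 0 \<le> b \<Longrightarrow> 0 \<le> table K a b m"
  unfolding sum_share[symmetric] by (intro sum_nonneg share_nonneg)

section \<open>Growth of the number of condensates and the loss caused by the cutoff\<close>

lemma card_condensates_rec:
  assumes "0 < m"
  shows "real m * real (card (condensates m)) = (\<Sum>d=1..m. \<Sum>j=1..m. if d * j \<le> m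
    then real d * choices d * real (card (condensates (m - d * j))) else 0)"
proof -
  \<comment> \<open>With cutoff 0 the first removal already scores \<open>b = 1\<close>, so
    unfolding \<open>table 0 1 1\<close> once gives the plain counting recurrence.\<close>
  have "real (card (condensates m)) = table 0 1 1 m"
    by (simp add: share_eq_1 flip: sum_share)
  also have "\<dots> = (\<Sum>d=1..m. \<Sum>j=1..m. if d * j \<le> m
    then real d * choices d * real (card (condensates (m - d * j))) else 0) / real m"
    using assms by (subst table.simps) (auto intro!: sum.cong)
  finally show ?thesis using assms by simp
qed

lemma card_condensates_mono:
  assumes "i \<le> m"
  shows "card (condensates i) \<le> card (condensates m)"
proof (rule card_inj_on_le)
  show "inj_on (\<lambda>M. M + replicate_mset (m - i) {#1#}) (condensates i)" by (simp add: inj_on_def)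
  show "(\<lambda>M. M + replicate_mset (m - i) {#1#}) ` condensates i \<subseteq> condensates m"
    using assms by (auto simp: condensates_iff)
qed (rule finite_condensates)

lemma choices_ge: "real d ^ 2 / 2 \<le> choices d"
  by (simp add: choices_def power2_eq_square field_simps)

lemma sum_cubes_ge: "real J ^ 4 / 4 \<le> (\<Sum>d=1..J. real d ^ 3)"
proof -
  have "(\<Sum>d=1..J. real d ^ 3) = (real J * (real J + 1)) ^ 2 / 4"
    by (induction J) (simp_all add: field_simps power2_eq_square power3_eq_cube)
  moreover have "real J ^ 4 \<le> (real J * (real J + 1)) ^ 2"
    by (simp add: power_mult_distrib power2_eq_square power4_eq_xxxx algebra_simps)
  ultimately show ?thesis by simp
qed

text \<open>Only the terms with \<open>j = 1\<close> and \<open>d \<le> J\<close> of the recurrence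
  are kept. There \<open>d * choices d\<close> is at least \<open>d ^ 3 / 2\<close>, the remaining
  count is at least that of energy \<open>m - J\<close>, and the cubes sum to at least
  \<open>J ^ 4 / 4\<close>. This gives the factor \<open>J ^ 4 / 8\<close> against \<open>m\<close>,
  and 16 is what makes the quotient 2.\<close>

lemma card_condensates_double:
  assumes "J \<le> m" "0 < m" "16 * real m \<le> real J ^ 4"
  shows "2 * real (card (condensates (m - J))) \<le> real (card (condensates m))"
proof -
  let ?c = "\<lambda>m. real (card (condensates m))"
  have pos: "0 \<le> choices d" for d by (simp add: choices_def)
  have "2 * real m * ?c (m - J) \<le> (real J ^ 4 / 8) * ?c (m - J)"
    using assms by (intro mult_right_mono) auto
  also have "\<dots> \<le> ((\<Sum>d=1..J. real d ^ 3) / 2) * ?c (m - J)"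
    using sum_cubes_ge[of J] by (intro mult_right_mono) auto
  also have "\<dots> = (\<Sum>d=1..J. real d * (real d ^ 2 / 2) * ?c (m - J))"
    by (simp add: sum_divide_distrib sum_distrib_right power2_eq_square power3_eq_cube mult.assoc)
  also have "\<dots> \<le> (\<Sum>d=1..J. real d * choices d * ?c (m - d))"
    using card_condensates_mono assms pos
    by (intro sum_mono mult_mono choices_ge) (auto intro!: mult_left_mono)
  also have "\<dots> \<le> (\<Sum>d=1..m. real d * choices d * ?c (m - d))"
    using assms pos by (intro sum_mono2) auto
  also have "\<dots> = (\<Sum>d=1..m. \<Sum>j=1..1. if d * j \<le> m then real d * choices d * ?c (m - d * j) else 0)"
    by (intro sum.cong) auto
  also have "\<dots> \<le> (\<Sum>d=1..m. \<Sum>j=1..m. if d * j \<le> m then real d * choices d * ?c (m - d * j) else 0)"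
    using assms pos by (intro sum_mono sum_mono2) auto
  also have "\<dots> = real m * ?c m" using card_condensates_rec[OF assms(2)] by simp
  finally have "real m * (2 * ?c (m - J)) \<le> real m * ?c m" by (simp add: mult_ac)
  then show ?thesis using assms(2) by simp
qed

text \<open>One \<open>J\<close> serves all \<open>i\<close> doublings, since the condition on it
  only weakens as the energy decreases.\<close>

lemma card_condensates_growth:
  assumes "i * J \<le> m" "16 * real m \<le> real J ^ 4" "0 < m"
  shows "2 ^ i * real (card (condensates (m - i * J))) \<le> real (card (condensates m))"
  using assms(1)
proof (induction i)
  case (Suc i)
  have "0 < J" using assms(2,3) by (cases J) auto
  have "m - Suc i * J = m - i * J - J" by simp
  moreover have "2 * real (card (condensates (m - i * J - J))) \<le> real (card (condensates (m - i * J)))"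
    using Suc.prems \<open>0 < J\<close> assms(2)
    by (intro card_condensates_double order_trans[OF _ assms(2)]) simp_all
  ultimately have "2 ^ Suc i * real (card (condensates (m - Suc i * J)))
      \<le> 2 ^ i * real (card (condensates (m - i * J)))" by simp
  also have "\<dots> \<le> real (card (condensates m))" using Suc by simp
  finally show ?case .
qed simp

text \<open>A union bound: the walk can exceed the cutoff only if some summand \<open>p\<close> is
  larger than \<open>K\<close> or occurs more than \<open>K\<close> times. For fixed
  \<open>p\<close>, removing the offending copies is injective and takes away more than
  \<open>K\<close> units, and at most \<open>(n + 2) ^ 3\<close> summands \<open>p\<close> come into
  question.\<close>

lemma table_0_1_le:
  "table K 0 1 n \<le> (if K < n then real ((n + 2) ^ 3) * real (card (condensates (n - Suc K))) else 0)"
proof -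
  define bad where "bad = {M \<in> condensates n. \<not> (\<forall>p\<in>#M. size p \<le> K \<and> count M p \<le> K)}"
  \<comment> \<open>A summand larger than \<open>K\<close> is removed once, a smaller one
    \<open>K + 1\<close> times; either way a nonempty summand takes at least \<open>K + 1\<close>
    units with it.\<close>
  define mult where "mult p = (if K < size p then 1 else Suc K)" for p :: "nat multiset"
  define A where "A p = {M \<in> condensates n. mult p \<le> count M p}" for p
  have fin: "finite bad" "finite (A p)" for p by (auto simp: bad_def A_def finite_condensates)
  have "table K 0 1 n = (\<Sum>M\<in>condensates n. share K 0 1 M)" by (simp add: sum_share)
  also have "\<dots> \<le> (\<Sum>M\<in>condensates n. if M \<in> bad then 1 else 0)"
  proof (rule sum_mono)
    fix M assume M: "M \<in> condensates n"
    have *: "share K 0 1 M = 1 - share K 1 0 M"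
      using share_linear[of K 1 1 "-1" 1 1 0 M] share_eq_1[OF M, of 1 K] by simp
    show "share K 0 1 M \<le> (if M \<in> bad then 1 else 0)"
      using share_eq_1[OF M, of 0 K] share_nonneg[of 1 0 K M] M * by (auto simp: bad_def)
  qed
  also have "\<dots> = real (card bad)"
    by (simp add: finite_condensates bad_def flip: sum.inter_filter)
  finally have le: "table K 0 1 n \<le> real (card bad)" .
  have sub: "bad \<subseteq> (\<Union>d\<in>{1..n}. \<Union>p\<in>summands d. A p)"
  proof
    fix M assume "M \<in> bad"
    then obtain p where p: "M \<in> condensates n" "p \<in># M" "\<not> (size p \<le> K \<and> count M p \<le> K)"
      by (auto simp: bad_def)
    have "1 \<le> count M p" using p(2) by simp
    note * = condensates_diff[OF p(1) this]
    have "M \<in> A p" using p by (auto simp: A_def mult_def not_le Suc_le_eq)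
    with * show "M \<in> (\<Union>d\<in>{1..n}. \<Union>p\<in>summands d. A p)" by auto
  qed
  have A: "card (A p) \<le> card (condensates (n - Suc K))" "A p \<noteq> {} \<Longrightarrow> K < n"
    if "0 < size p" for p
  proof -
    have large: "K < size p * mult p"
      using that by (cases "size p") (auto simp: mult_def)
    have pos: "0 < mult p" by (simp add: mult_def)
    note * = condensates_diff[OF _ _ pos, of _ n p]
    show "K < n" if "A p \<noteq> {}" using that *(2) large by (fastforce simp: A_def)
    have "card (A p) \<le> card (condensates (n - size p * mult p))"
    proof (rule card_inj_on_le)
      show "inj_on (\<lambda>M. M - replicate_mset (mult p) p) (A p)"
        by (rule inj_onI) (metis (no_types, lifting) A_def mem_Collect_eq replicate_subseteq_iff
            subset_mset.diff_add)
      show "(\<lambda>M. M - replicate_mset (mult p) p) ` A p \<subseteq> condensates (n - size p * mult p)"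
        using * by (auto simp: A_def)
    qed (rule finite_condensates)
    also have "\<dots> \<le> card (condensates (n - Suc K))"
      using large by (intro card_condensates_mono) auto
    finally show "card (A p) \<le> card (condensates (n - Suc K))" .
  qed
  show ?thesis
  proof (cases "K < n")
    case False
    then have "A p = {}" if "p \<in> summands d" "d \<in> {1..n}" for p d
      using A(2)[of p] that by (auto simp: summands_def)
    with sub have "bad = {}" by blast
    then show ?thesis using le False by simp
  next
    case True
    have "card bad \<le> card (\<Union>d\<in>{1..n}. \<Union>p\<in>summands d. A p)"
      using fin finite_summands by (intro card_mono sub) auto
    also have "\<dots> \<le> (\<Sum>d=1..n. card (\<Union>p\<in>summands d. A p))" by (intro card_UN_le) simp
    also have "\<dots> \<le> (\<Sum>d=1..n. \<Sum>p\<in>summands d. card (A p))"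
      by (intro sum_mono card_UN_le finite_summands)
    also have "\<dots> \<le> (\<Sum>d=1..n. \<Sum>p\<in>summands d. card (condensates (n - Suc K)))"
      by (intro sum_mono A) (auto simp: summands_def)
    finally have "real (card bad) \<le> real (\<Sum>d=1..n. card (summands d) * card (condensates (n - Suc K)))"
      by (simp only: sum_constant of_nat_le_iff of_nat_id)
    also have "\<dots> = (\<Sum>d=1..n. choices d) * real (card (condensates (n - Suc K)))"
      by (simp add: sum_distrib_right card_summands)
    also have "\<dots> \<le> real ((n + 2) ^ 3) * real (card (condensates (n - Suc K)))"
    proof (rule mult_right_mono)
      have "(\<Sum>d=1..n. choices d) \<le> (\<Sum>d=1..n. real ((n + 2) ^ 2))"
      proof (rule sum_mono)
        fix d assume "d \<in> {1..n}"
        then have "(d + 1) * (d + 2) \<le> (n + 2) * (n + 2)" by (intro mult_mono) auto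
        then have "real ((d + 1) * (d + 2)) \<le> real ((n + 2) ^ 2)"
          unfolding power2_eq_square by (rule of_nat_mono)
        moreover have "x / 2 \<le> y" if "0 \<le> x" "x \<le> y" for x y :: real using that by simp
        ultimately show "choices d \<le> real ((n + 2) ^ 2)"
          unfolding choices_def using of_nat_0_le_iff by blast
      qed
      also have "\<dots> = real (n * (n + 2) ^ 2)" by simp
      also have "\<dots> \<le> real ((n + 2) ^ 3)"
        unfolding of_nat_le_iff power3_eq_cube power2_eq_square by (simp add: mult_ac)
      finally show "(\<Sum>d=1..n. choices d) \<le> real ((n + 2) ^ 3)" .
    qed simp
    finally show ?thesis using le True by simp
  qed
qed

text \<open>Energy \<open>J \<approx> 2 n powr (1/4)\<close> doubles the number of condensates, so that removing more than
  \<open>n powr (5/16)\<close> units at once divides it by more than any power of \<open>n\<close>.\<close>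

lemma table_0_1_small:
  obtains n0 :: nat where "0 < n0"
    "\<And>n K. n0 \<le> K \<Longrightarrow> n ^ 5 \<le> K ^ 16 \<Longrightarrow> 0 < n \<Longrightarrow>
       table K 0 1 n \<le> real (card (condensates n)) / real n ^ 2"
proof -
  \<comment> \<open>For \<open>K \<ge> x powr (5/16)\<close> and
    \<open>J \<le> 2 * x powr (1/4) + 1\<close> the exponent is a lower bound for the number
    \<open>K div J\<close> of doublings. It grows like \<open>x powr (1/16) / 2\<close> and so beats
    the polynomial, in which \<open>(x + 2) ^ 3\<close> stems from the union bound and
    \<open>x ^ 2\<close> from the claim.\<close>
  have "eventually (\<lambda>x::real. (x + 2) ^ 3 * x ^ 2 \<le> 2 powr (x powr (5/16) / (2 * x powr (1/4) + 1) - 1)) at_top"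
    by real_asymp
  then obtain B :: real where B: "\<And>x. B \<le> x \<Longrightarrow>
      (x + 2) ^ 3 * x ^ 2 \<le> 2 powr (x powr (5/16) / (2 * x powr (1/4) + 1) - 1)"
    unfolding eventually_at_top_linorder by blast
  define n0 where "n0 = Suc (nat \<lceil>B\<rceil>)"
  have "table K 0 1 n \<le> real (card (condensates n)) / real n ^ 2"
    if K: "n0 \<le> K" "n ^ 5 \<le> K ^ 16" "0 < n" for n K
  proof (cases "K < n")
    case False
    then have "table K 0 1 n \<le> 0" using table_0_1_le[of K n] by simp
    also have "0 \<le> real (card (condensates n)) / real n ^ 2" by simp
    finally show ?thesis .
  next
    case True
    \<comment> \<open>The factor 2 is the fourth root of the 16 in the doubling condition.\<close>
    define J where "J = nat \<lceil>2 * real n powr (1/4)\<rceil>"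
    define i where "i = K div J"
    have J1: "2 * real n powr (1/4) \<le> real J" unfolding J_def by linarith
    have J2: "real J \<le> 2 * real n powr (1/4) + 1"
      unfolding J_def using of_int_ceiling_le_add_one[of "2 * real n powr (1/4)"] by simp
    have "0 < 2 * real n powr (1/4)" using K(3) by simp
    with J1 have "0 < J" by linarith
    have "16 * real n = (2 * real n powr (1/4)) ^ 4"
      using K(3) by (simp add: power_mult_distrib powr_power)
    also have "\<dots> \<le> real J ^ 4" using J1 by (intro power_mono) auto
    finally have J4: "16 * real n \<le> real J ^ 4" .
    have iJ: "i * J \<le> K" by (simp add: i_def)
    have pow: "(x ^ k) powr (1/16) = x powr (real k / 16)" if "0 < x" for x :: real and k
      by (simp add: that powr_powr powr_realpow[symmetric, OF that])
    have "real n powr (5/16) = (real n ^ 5) powr (1/16)"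
      using K(3) pow[of "real n" 5] by simp
    also have "\<dots> \<le> (real K ^ 16) powr (1/16)"
      using K(2) by (intro powr_mono2) (auto simp flip: of_nat_power)
    also have "\<dots> = real K"
    proof -
      have "0 < K" using K(1) by (simp add: n0_def)
      then show ?thesis using pow[of "real K" 16] by simp
    qed
    finally have Kge: "real n powr (5/16) \<le> real K" .
    have "real n powr (5/16) / (2 * real n powr (1/4) + 1) \<le> real K / real J"
      using Kge J2 \<open>0 < J\<close> by (intro frac_le) auto
    also have "real K / real J \<le> real i + 1"
    proof -
      have "K \<le> (i + 1) * J"
        using div_mult_mod_eq[of K J] mod_less_divisor[OF \<open>0 < J\<close>, of K]
        unfolding i_def by (metis add_le_cancel_left add_mult_distrib less_imp_le mult_1)
      then have "real K \<le> real ((i + 1) * J)" by (rule of_nat_mono)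
      then show ?thesis using \<open>0 < J\<close> by (simp add: pos_divide_le_eq algebra_simps)
    qed
    finally have ige: "real n powr (5/16) / (2 * real n powr (1/4) + 1) - 1 \<le> real i" by simp
    have "B \<le> real n" using True K(1) unfolding n0_def by linarith
    then have "(real n + 2) ^ 3 * real n ^ 2 \<le> 2 powr (real n powr (5/16) / (2 * real n powr (1/4) + 1) - 1)"
      by (rule B)
    also have "\<dots> \<le> 2 powr real i" using ige by (intro powr_mono) auto
    finally have p: "(real n + 2) ^ 3 * real n ^ 2 \<le> 2 ^ i" by (simp add: powr_realpow)
    have "table K 0 1 n \<le> (real n + 2) ^ 3 * real (card (condensates (n - Suc K)))"
      using table_0_1_le[of K n] True by (simp add: algebra_simps)
    also have "\<dots> \<le> (real n + 2) ^ 3 * real (card (condensates (n - i * J)))"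
      using iJ by (intro mult_left_mono of_nat_mono card_condensates_mono) auto
    finally have "table K 0 1 n * real n ^ 2
        \<le> ((real n + 2) ^ 3 * real (card (condensates (n - i * J)))) * real n ^ 2"
      by (intro mult_right_mono) auto
    also have "\<dots> = ((real n + 2) ^ 3 * real n ^ 2) * real (card (condensates (n - i * J)))"
      by (simp add: mult_ac)
    also have "\<dots> \<le> 2 ^ i * real (card (condensates (n - i * J)))"
      using p by (intro mult_right_mono) auto
    also have "\<dots> \<le> real (card (condensates n))"
      using iJ True by (intro card_condensates_growth J4 K(3)) auto
    finally show ?thesis using K(3) by (simp add: pos_le_divide_eq)
  qed
  moreover have "0 < n0" by (simp add: n0_def)
  ultimately show ?thesis using that by blast
qed

section \<open>Reasoning about programs\<close>

lemma mem_put [simp]: "mem (put d v s) = (mem s)(d := v)"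
  and steps_put [simp]: "steps (put d v s) = steps s"
  and extent_put [simp]: "extent (put d v s) = max (extent s) (Suc d)"
  and mem_charge [simp]: "mem (charge t w s) = mem s"
  and steps_charge [simp]: "steps (charge t w s) = steps s + t"
  and extent_charge [simp]: "extent (charge t w s) = max (extent s) w"
  by (simp_all add: put_def charge_def)

lemma lift2_Some [simp]: "lift2 f (Some x) (Some y) = Some (f x y)"
  by (simp add: lift2_def)

lemma nat_of_real_of_nat [simp]: "nat_of_real (real k) = Some k"
  by (simp add: nat_of_real_def)

lemma nat_of_real_eqI: "x = real k \<Longrightarrow> nat_of_real x = Some k"
  by simp

text \<open>
  Only lower bounds on \<open>wp\<close> are ever needed: a family of disjoint outcomes whose probabilities are
  bounded below by numbers of sum 1 has exactly these probabilities, and the program then also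
  terminates almost surely.
\<close>

definition sure :: "program \<Rightarrow> state \<Rightarrow> (state \<Rightarrow> bool) \<Rightarrow> bool" where
  "sure P s Q \<longleftrightarrow> lossless_spmf (exec P s) \<and> (\<forall>s'\<in>set_spmf (exec P s). Q s')"

definition wp :: "program \<Rightarrow> (state \<Rightarrow> ennreal) \<Rightarrow> state \<Rightarrow> ennreal" where
  "wp P f s = (\<integral>\<^sup>+ s'. f s' \<partial>measure_spmf (exec P s))"

lemma sure_Skip [simp]: "sure Skip s Q \<longleftrightarrow> Q (charge 1 0 s)"
  by (simp add: sure_def)

lemma sure_Assign [simp]:
  "sure (Assign d e) s Q \<longleftrightarrow> (case eval e (mem s) of None \<Rightarrow> False
     | Some v \<Rightarrow> Q (put d v (charge (1 + expr_cost e) (expr_extent e) s)))"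
  by (simp add: sure_def split: option.split)

lemma sure_Load:
  "mem s a = real i \<Longrightarrow> sure (Load d a) s Q \<longleftrightarrow> Q (put d (mem s i) (charge 1 (Suc (max a i)) s))"
  by (simp add: sure_def)

lemma sure_Store:
  "mem s a = real i \<Longrightarrow> sure (Store a v) s Q \<longleftrightarrow> Q (put i (mem s v) (charge 1 (Suc (max a v)) s))"
  by (simp add: sure_def)

lemma sure_Seq [simp]: "sure (Seq c1 c2) s Q \<longleftrightarrow> sure c1 s (\<lambda>s'. sure c2 s' Q)"
  by (auto simp: sure_def set_bind_spmf)

lemma sure_Cond [simp]:
  "sure (Cond b c1 c2) s Q \<longleftrightarrow> (case test_eval b (mem s) of None \<Rightarrow> False
     | Some v \<Rightarrow> sure (if v then c1 else c2) (charge (test_cost b) (test_extent b) s) Q)"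
  by (simp add: sure_def split: option.split)

lemma sure_mono: "sure P s Q \<Longrightarrow> (\<And>s'. Q s' \<Longrightarrow> Q' s') \<Longrightarrow> sure P s Q'"
  by (auto simp: sure_def)

lemma exec_While: "exec (While b c) s = (case test_eval b (mem s) of None \<Rightarrow> abort
   | Some v \<Rightarrow> if v then bind_spmf (exec c (charge (test_cost b) (test_extent b) s)) (exec (While b c))
       else return_spmf (charge (test_cost b) (test_extent b) s))"
proof -
  have "exec (While b c) = while_spmf (\<lambda>s. test_eval b (mem s)) (charge (test_cost b) (test_extent b)) (exec c)"
    by (rule ext) simp
  then show ?thesis
    by (simp only: while_spmf.simps[of _ _ _ s])
qed

text \<open>The index of \<open>I\<close> is a variant that decreases in every outcome, so the loop
  is unrolled by induction and losslessness needs no limit argument. Loops that make random choices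
  are instead unfolded with \<open>wp_While\<close> inside an induction of their own.\<close>

lemma sure_While:
  fixes I :: "nat \<Rightarrow> state \<Rightarrow> bool"
  assumes "I v s"
    and "\<And>v s. I v s \<Longrightarrow>
      test_eval b (mem s) = Some True \<and>
        sure c (charge (test_cost b) (test_extent b) s) (\<lambda>s'. \<exists>v'<v. I v' s') \<or>
      test_eval b (mem s) = Some False \<and> Q (charge (test_cost b) (test_extent b) s)"
  shows "sure (While b c) s Q"
  using assms(1)
proof (induction v arbitrary: s rule: less_induct)
  case (less v)
  from assms(2)[OF less.prems] show ?case
  proof (elim disjE conjE)
    assume t: "test_eval b (mem s) = Some True"
      and "sure c (charge (test_cost b) (test_extent b) s) (\<lambda>s'. \<exists>v'<v. I v' s')"
    then have "sure c (charge (test_cost b) (test_extent b) s) (\<lambda>s'. sure (While b c) s' Q)"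
      by (elim sure_mono) (use less.IH in blast)
    then show ?thesis
      using t unfolding sure_def exec_While[of b c s]
      by (auto simp: set_bind_spmf simp del: exec.simps)
  next
    assume "test_eval b (mem s) = Some False" "Q (charge (test_cost b) (test_extent b) s)"
    then show ?thesis by (simp add: sure_def exec_While del: exec.simps)
  qed
qed

lemma nn_integral_bind_spmf:
  "(\<integral>\<^sup>+ y. f y \<partial>measure_spmf (bind_spmf p g)) = (\<integral>\<^sup>+ x. \<integral>\<^sup>+ y. f y \<partial>measure_spmf (g x) \<partial>measure_spmf p)"
  unfolding measure_spmf_bind
  by (subst nn_integral_bind[where B = "count_space UNIV"])
     (auto simp: space_subprob_algebra subprob_space_measure_spmf)

lemma wp_Seq: "wp (Seq c1 c2) f = wp c1 (wp c2 f)"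
  by (rule ext) (simp add: wp_def[of _ _ "_ :: state"] nn_integral_bind_spmf)

lemma wp_While: "test_eval b (mem s) = Some v \<Longrightarrow>
    wp (While b c) f s = (if v then wp c (wp (While b c) f) (charge (test_cost b) (test_extent b) s)
      else f (charge (test_cost b) (test_extent b) s))"
  unfolding wp_def exec_While[of b c s] by (simp add: nn_integral_bind_spmf nn_integral_return measure_spmf_return_spmf del: exec.simps)

lemma wp_Sample: "sampler D (mem s) = Some p \<Longrightarrow>
    wp (Sample d D) f s
      = (\<integral>\<^sup>+ k. f (put d (real k) (charge (1 + dist_cost D + k) (dist_extent D) s)) \<partial>measure_pmf p)"
  by (simp add: wp_def o_def measure_spmf_spmf_of_pmf)

lemma wp_sure:
  assumes "sure P s Q" "\<And>s'. Q s' \<Longrightarrow> r \<le> f s'"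
  shows "r \<le> wp P f s"
proof -
  have "r = (\<integral>\<^sup>+ s'. r \<partial>measure_spmf (exec P s))"
    using assms(1) by (simp add: sure_def lossless_spmf_def space_measure_spmf weight_spmf_def
        measure_spmf.emeasure_eq_measure)
  also have "\<dots> \<le> wp P f s"
    unfolding wp_def by (intro nn_integral_mono_AE) (use assms in \<open>auto simp: sure_def\<close>)
  finally show ?thesis .
qed

lemma wp_Seq_sure:
  assumes "sure c1 s Q" "\<And>s'. Q s' \<Longrightarrow> r \<le> wp c2 f s'"
  shows "r \<le> wp (Seq c1 c2) f s"
  unfolding wp_Seq using assms by (rule wp_sure)

text \<open>Lower bounds \<open>h0\<close> and \<open>h1\<close> for the two continuations combine
  to their mean. Outcome 1 is charged one unit more than outcome 0, because the sampled value is
  paid for.\<close>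

lemma wp_Bernoulli:
  assumes "eval e (mem s) = Some p" "0 \<le> p" "p \<le> 1"
    and "ennreal h0 \<le> f (put d 0 (charge (1 + expr_cost e) (expr_extent e) s))" "0 \<le> h0"
    and "ennreal h1 \<le> f (put d 1 (charge (2 + expr_cost e) (expr_extent e) s))" "0 \<le> h1"
  shows "ennreal (p * h1 + (1 - p) * h0) \<le> wp (Sample d (Bernoulli e)) f s"
proof -
  have "ennreal (p * h1 + (1 - p) * h0) = ennreal h1 * ennreal p + ennreal h0 * ennreal (1 - p)"
    using assms by (simp add: ennreal_mult ennreal_plus mult.commute)
  also have "\<dots> \<le> f (put d 1 (charge (2 + expr_cost e) (expr_extent e) s)) * ennreal p
      + f (put d 0 (charge (1 + expr_cost e) (expr_extent e) s)) * ennreal (1 - p)"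
    using assms by (intro add_mono mult_right_mono) auto
  also have "\<dots> = wp (Sample d (Bernoulli e)) f s"
    using assms by (subst wp_Sample[of _ s "map_pmf of_bool (bernoulli_pmf p)"]) (auto simp: numeral_2_eq_2)
  finally show ?thesis .
qed

lemma wp_Uniform:
  assumes "eval e (mem s) = Some (real N)" "0 < N"
    and "\<And>k. k < N \<Longrightarrow> ennreal (h k) \<le> f (put d (real k) (charge (1 + expr_cost e + k) (expr_extent e) s))"
    and "\<And>k. k < N \<Longrightarrow> 0 \<le> h k"
  shows "ennreal ((\<Sum>k<N. h k) / real N) \<le> wp (Sample d (Uniform e)) f s"
proof -
  have "ennreal ((\<Sum>k<N. h k) / real N) = (\<Sum>k<N. ennreal (h k)) / ennreal (real N)"
    using assms(2,4) sum_nonneg[of "{..<N}" h] by (subst sum_ennreal) (auto simp: divide_ennreal)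
  also have "\<dots> \<le> (\<Sum>k<N. f (put d (real k) (charge (1 + expr_cost e + k) (expr_extent e) s))) / ennreal (real N)"
    using assms by (intro divide_right_mono_ennreal sum_mono) auto
  also have "\<dots> = wp (Sample d (Uniform e)) f s"
    using assms by (subst wp_Sample[of _ s "pmf_of_set {0..<N}"])
      (auto simp: nn_integral_pmf_of_set lessThan_atLeast0 ennreal_of_nat_eq_real_of_nat)
  finally show ?thesis .
qed

section \<open>Filling the tables\<close>

text \<open>Numeral addresses and costs would otherwise be turned into towers of \<open>Suc\<close>.\<close>

declare One_nat_def [simp del] One_nat_def [symmetric, simp]

text \<open>
  Memory layout. Cells below 20 are registers: 0 holds \<open>n\<close>, 1 the cutoff \<open>K\<close>, 2 the bound \<open>L\<close> of
  the loops over \<open>(d, j)\<close>, 3 and 4 the parameters \<open>a\<close> and \<open>b\<close>, 5 the outcome of the last Bernoulli trial,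
  6 the energy still to be distributed, 7 and 8 the pair \<open>(d, j)\<close>, 9 and 10 are accumulators, 11 an
  address, 12 a value, 13 the base address of the table in use, 14 to 16 the current summand, 17 the
  next output cell. Output cell \<open>i < 20\<close> is kept at \<open>3 * n + 20 + i\<close> until the very end. The cells
  \<open>3 * n + 40 + i\<close> and \<open>4 * n + 41 + i\<close> hold \<open>table K a b i\<close> and \<open>table K b b i\<close>.
\<close>

definition xbase :: expr where "xbase = Add (Mul (Lit 3) (Cell 0)) (Lit 40)"
definition ybase :: expr where "ybase = Add (Mul (Lit 4) (Cell 0)) (Lit 41)"
definition bbase :: expr where "bbase = Add (Mul (Lit 3) (Cell 0)) (Lit 20)"
text \<open>Evaluates \<open>d * choices d\<close>, the coefficient in the recurrence of
  \<open>table\<close>, for the \<open>d\<close> in cell 7.\<close>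

definition rate :: expr where
  "rate = Div (Mul (Cell 7) (Mul (Add (Cell 7) (Lit 1)) (Add (Cell 7) (Lit 2)))) (Lit 2)"

lemma base_simps [simp]:
  "eval xbase m = Some (3 * m 0 + 40)" "expr_cost xbase = 5" "expr_extent xbase = 1"
  "eval ybase m = Some (4 * m 0 + 41)" "expr_cost ybase = 5" "expr_extent ybase = 1"
  "eval bbase m = Some (3 * m 0 + 20)" "expr_cost bbase = 5" "expr_extent bbase = 1"
  "expr_cost rate = 11" "expr_extent rate = 8"
  by (simp_all add: xbase_def ybase_def bbase_def rate_def)

lemma eval_rate [simp]: "eval rate m = Some (m 7 * ((m 7 + 1) * (m 7 + 2)) / 2)"
  by (simp add: rate_def)

lemma choices_eq: "choices d = (real d + 1) * (real d + 2) / 2"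
  by (simp add: choices_def algebra_simps)

section \<open>Walking through the pairs \<open>(d, j)\<close> row by row\<close>

definition fetch :: "expr \<Rightarrow> program" where
  "fetch base = Seq (Assign 11 (Add base (Sub (Cell 6) (Mul (Cell 7) (Cell 8))))) (Load 12 11)"

lemma sure_fetchI:
  assumes "eval base (mem s) = Some (real p)" "mem s 6 = real (d * j + k)" "mem s 7 = real d" "mem s 8 = real j"
    and "20 \<le> p" "expr_extent base \<le> 20" "p + k < bnd" "extent s \<le> bnd" "mem s (p + k) = v"
    and "\<And>s' u. mem s' = (mem s)(11 := u, 12 := v) \<Longrightarrow>
      steps s' = steps s + 8 + expr_cost base \<Longrightarrow> extent s' \<le> bnd \<Longrightarrow> Q s'"
  shows "sure (fetch base) s Q"
proof -
  have e: "real p + (real (d * j + k) - real d * real j) = real (p + k)"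
    by simp
  define s1 where "s1 = put 11 (real (p + k)) (charge (7 + expr_cost base) (max (expr_extent base) 9) s)"
  have "exec (fetch base) s = return_spmf (put 12 (mem s1 (p + k)) (charge 1 (Suc (max 11 (p + k))) s1))"
    using assms(1-4) unfolding fetch_def by (simp add: e s1_def del: of_nat_add)
  then show ?thesis
    using assms(5-9) by (auto simp: sure_def s1_def intro!: assms(10))
qed

text \<open>Cells 7 and 8 hold the pair visited last, so a row starts at \<open>j = 0\<close>. One
  call either visits the next pair, running \<open>c\<close> unless \<open>d * j\<close> exceeds the
  energy, or merely moves on to the next row. Filling the tables and drawing a pair share this
  walk.\<close>

definition advance :: "program \<Rightarrow> program" where
  "advance c = Cond (Less (Cell 8) (Cell 2))
     (Seq (Assign 8 (Add (Cell 8) (Lit 1)))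
       (Cond (Less (Cell 6) (Mul (Cell 7) (Cell 8))) Skip c))
     (Seq (Assign 7 (Add (Cell 7) (Lit 1))) (Assign 8 (Lit 0)))"

text \<open>Both tables grow in one pass: cell 10 collects the sum for \<open>table K b b\<close>,
  cell 9 that for \<open>table K a b\<close>. If the pair exceeds the cutoff, cell 12 still holds
  the entry of \<open>table K b b\<close>, which is the one wanted in that case.\<close>

definition accumulate :: program where
  "accumulate = Seq (fetch ybase) (Seq (Assign 10 (Add (Cell 10) (Mul rate (Cell 12))))
     (Seq (Cond (Less (Cell 1) (Cell 7)) Skip (Cond (Less (Cell 1) (Cell 8)) Skip (fetch xbase)))
       (Assign 9 (Add (Cell 9) (Mul rate (Cell 12))))))"

text \<open>One term of the recurrence of \<open>table\<close>, with the two tables abstracted to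
  \<open>X\<close> within the cutoff and \<open>Y\<close> beyond it. Taking \<open>Y\<close> for
  both gives the recurrence of \<open>table K b b\<close>.\<close>

definition term_at :: "nat \<Rightarrow> nat \<Rightarrow> (nat \<Rightarrow> real) \<Rightarrow> (nat \<Rightarrow> real) \<Rightarrow> nat \<Rightarrow> nat \<Rightarrow> real" where
  "term_at K m X Y d j =
     (if d * j \<le> m then real d * choices d * (if d \<le> K \<and> j \<le> K then X (m - d * j) else Y (m - d * j)) else 0)"

lemma sure_accumulate:
  assumes regs: "mem s 0 = real n" "mem s 1 = real K" "mem s 6 = real m" "mem s 7 = real d" "mem s 8 = real j"
    and ext: "extent s \<le> 5 * n + 42" and m: "m \<le> n" "d * j \<le> m" "0 < d * j"
    and X: "\<And>i. i < m \<Longrightarrow> mem s (3 * n + 40 + i) = X i"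
    and Y: "\<And>i. i < m \<Longrightarrow> mem s (4 * n + 41 + i) = Y i"
  shows "sure accumulate s (\<lambda>s'. (\<forall>i. i < 9 \<or> 12 < i \<longrightarrow> mem s' i = mem s i) \<and> extent s' \<le> 5 * n + 42
    \<and> steps s' \<le> steps s + 80 \<and> mem s' 9 = mem s 9 + term_at K m X Y d j
    \<and> mem s' 10 = mem s 10 + term_at K m Y Y d j)"
  unfolding accumulate_def sure_Seq
proof -
  obtain k where k: "m = d * j + k" using m(2) by (metis le_Suc_ex)
  have lt: "k < m" using m k by simp
  have v1: "mem s (4 * n + 41 + k) = Y k" using Y[OF lt] by simp
  have v2: "mem s (3 * n + 40 + k) = X k" using X[OF lt] by simp
  show "sure (fetch ybase) s (\<lambda>s'. sure (Assign 10 (Add (Cell 10) (Mul rate (Cell 12)))) s' (\<lambda>s'.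
     sure (Cond (Less (Cell 1) (Cell 7)) Skip (Cond (Less (Cell 1) (Cell 8)) Skip (fetch xbase))) s' (\<lambda>s'.
     sure (Assign 9 (Add (Cell 9) (Mul rate (Cell 12)))) s' (\<lambda>s'.
      (\<forall>i. i < 9 \<or> 12 < i \<longrightarrow> mem s' i = mem s i) \<and> extent s' \<le> 5 * n + 42
    \<and> steps s' \<le> steps s + 80 \<and> mem s' 9 = mem s 9 + term_at K m X Y d j
    \<and> mem s' 10 = mem s 10 + term_at K m Y Y d j))))"
  proof (rule sure_fetchI[where p = "4 * n + 41" and d = d and j = j and k = k and bnd = "5 * n + 42", OF _ _ _ _ _ _ _ _ v1])
    fix s1 :: state and u assume s1: "mem s1 = (mem s)(11 := u, 12 := Y k)" "steps s1 = steps s + 8 + expr_cost ybase"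
      "extent s1 \<le> 5 * n + 42"
    show "sure (Assign 10 (Add (Cell 10) (Mul rate (Cell 12)))) s1 (\<lambda>s'.
     sure (Cond (Less (Cell 1) (Cell 7)) Skip (Cond (Less (Cell 1) (Cell 8)) Skip (fetch xbase))) s' (\<lambda>s'.
     sure (Assign 9 (Add (Cell 9) (Mul rate (Cell 12)))) s' (\<lambda>s'.
      (\<forall>i. i < 9 \<or> 12 < i \<longrightarrow> mem s' i = mem s i) \<and> extent s' \<le> 5 * n + 42
    \<and> steps s' \<le> steps s + 80 \<and> mem s' 9 = mem s 9 + term_at K m X Y d j
    \<and> mem s' 10 = mem s 10 + term_at K m Y Y d j)))"
    proof (cases "d \<le> K \<and> j \<le> K")
      case True
      with s1 regs ext m show ?thesis
        apply simp
        apply (rule sure_fetchI[where p = "3 * n + 40" and d = d and j = j and k = k and v = "X k"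
              and bnd = "5 * n + 42"])
        using v2 k by (simp_all add: term_at_def choices_eq)
    next
      case False
      with s1 regs ext m k show ?thesis by (auto simp add: term_at_def choices_eq)
    qed
  qed (use assms k in simp_all)
qed

text \<open>Stated as equations for \<open>exec\<close> rather than as a rule for
  \<open>sure\<close>, since the body \<open>c\<close> is deterministic when tables are filled and
  random when a pair is drawn.\<close>

lemma exec_advance_cases:
  assumes "mem s 0 = real n" "mem s 2 = real L" "mem s 6 = real m" "mem s 7 = real d" "mem s 8 = real j"
    and "extent s \<le> 5 * n + 42" "j \<le> L"
  obtains (skip) s' where "j < L" "m < d * Suc j" "exec (advance c) s = return_spmf s'"
      "mem s' = (mem s)(8 := real (Suc j))" "extent s' \<le> 5 * n + 42" "steps s' \<le> steps s + 20"
  | (row) s' where "j = L" "exec (advance c) s = return_spmf s'"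
      "mem s' = (mem s)(7 := real (Suc d), 8 := 0)" "extent s' \<le> 5 * n + 42" "steps s' \<le> steps s + 20"
  | (step) s' where "j < L" "d * Suc j \<le> m" "exec (advance c) s = exec c s'"
      "mem s' = (mem s)(8 := real (Suc j))" "extent s' \<le> 5 * n + 42" "steps s' \<le> steps s + 20"
proof -
  have e: "real d * (real j + 1) = real (d * Suc j)" by (simp add: algebra_simps)
  have e2: "m < d * Suc j \<longleftrightarrow> real m < real d * (real j + 1)" unfolding e of_nat_less_iff ..
  have e3: "1 + real i = real i + 1" for i by simp
  consider "j < L" "m < d * Suc j" | "j < L" "d * Suc j \<le> m" | "j = L" using assms(7) by linarith
  then show thesis
  proof cases
    case 1
    with assms show thesis
      by (intro skip[where s' = "charge 1 0 (charge 5 9 (put 8 (real j + 1) (charge 4 9 (charge 3 9 s))))"])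
        (simp_all add: advance_def e2 e3 not_less[symmetric] del: mult_Suc_right)
  next
    case 2
    with assms show thesis
      by (intro step[where s' = "charge 5 9 (put 8 (real j + 1) (charge 4 9 (charge 3 9 s)))"])
        (simp_all add: advance_def e2 e3 not_less[symmetric] del: mult_Suc_right)
  next
    case 3
    with assms show thesis
      by (intro row[where s' = "put 8 0 (charge 2 0 (put 7 (real d + 1) (charge 4 8 (charge 3 9 s))))"]) (simp_all add: advance_def e3)
  qed
qed

text \<open>The sum of \<open>G\<close> over the pairs that the walk visits after
  \<open>(d, j)\<close>. The test \<open>d \<le> L\<close> takes care of \<open>d = L + 1\<close>,
  where the walk has ended.\<close>

definition rest :: "nat \<Rightarrow> (nat \<Rightarrow> nat \<Rightarrow> real) \<Rightarrow> nat \<Rightarrow> nat \<Rightarrow> real" where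
  "rest L G d j = (if d \<le> L then \<Sum>i=Suc j..L. G d i else 0) + (\<Sum>e=Suc d..L. \<Sum>i=1..L. G e i)"

lemma rest_start: "0 < L \<Longrightarrow> rest L G 1 0 = (\<Sum>d=1..L. \<Sum>j=1..L. G d j)"
  using sum.atLeast_Suc_atMost[of 1 L "\<lambda>d. \<Sum>j=1..L. G d j"] by (simp add: rest_def)

lemma rest_step: "d \<le> L \<Longrightarrow> j < L \<Longrightarrow> rest L G d j = G d (Suc j) + rest L G d (Suc j)"
  by (simp add: rest_def sum.atLeast_Suc_atMost[of "Suc j" L])

lemma rest_row: "d \<le> L \<Longrightarrow> rest L G d L = rest L G (Suc d) 0"
  by (cases "d = L") (auto simp add: rest_def sum.atLeast_Suc_atMost[of "Suc d" L])

lemma rest_end: "L < d \<Longrightarrow> rest L G d j = 0"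
  by (simp add: rest_def)

lemma rest_nonneg: "(\<And>d j. 0 \<le> G d j) \<Longrightarrow> 0 \<le> rest L G d j"
  by (simp add: rest_def sum_nonneg)

text \<open>The number of calls of \<open>advance\<close> still to come: a full row takes
  \<open>L\<close> visits and one change of row.\<close>

definition left :: "nat \<Rightarrow> nat \<Rightarrow> nat \<Rightarrow> nat" where
  "left L d j = (Suc L - d) * Suc L - j"

lemma left_step: "d \<le> L \<Longrightarrow> j < L \<Longrightarrow> left L d j = Suc (left L d (Suc j))"
proof -
  assume "d \<le> L" "j < L"
  then have "1 * Suc L \<le> (Suc L - d) * Suc L" by (intro mult_le_mono1) auto
  moreover have "x - j = Suc (x - Suc j)" if "1 * Suc L \<le> x" for x using that \<open>j < L\<close> by simp
  ultimately show ?thesis unfolding left_def by blast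
qed

lemma left_row: "d \<le> L \<Longrightarrow> left L d L = Suc (left L (Suc d) 0)"
  by (simp add: left_def Suc_diff_le)

lemma left_start: "left L 1 0 = L * Suc L"
  by (simp add: left_def)

lemma sure_accumulate_loop:
  assumes regs: "mem s 0 = real n" "mem s 1 = real K" "mem s 2 = real L" "mem s 6 = real m"
      "mem s 7 = 1" "mem s 8 = 0" "mem s 9 = 0" "mem s 10 = 0"
    and ext: "extent s \<le> 5 * n + 42" and m: "m \<le> n" and L: "0 < L"
    and X: "\<And>i. i < m \<Longrightarrow> mem s (3 * n + 40 + i) = X i"
    and Y: "\<And>i. i < m \<Longrightarrow> mem s (4 * n + 41 + i) = Y i"
  shows "sure (While (Less (Cell 7) (Add (Cell 2) (Lit 1))) (advance accumulate)) s
    (\<lambda>s'. (\<forall>i. i < 7 \<or> 12 < i \<longrightarrow> mem s' i = mem s i) \<and> extent s' \<le> 5 * n + 42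
    \<and> steps s' \<le> steps s + 106 * (L * Suc L) + 6
    \<and> mem s' 9 = (\<Sum>d=1..L. \<Sum>j=1..L. term_at K m X Y d j)
    \<and> mem s' 10 = (\<Sum>d=1..L. \<Sum>j=1..L. term_at K m Y Y d j))"
    (is "sure _ _ ?Q")
proof -
  \<comment> \<open>Each accumulator plus the \<open>rest\<close> of its terms is constant. The 106
    steps per iteration cover the test (5), \<open>advance\<close> (20) and
    \<open>accumulate\<close> (80).\<close>
  define I where "I v s' \<longleftrightarrow> (\<exists>d j. v = left L d j \<and> j \<le> L \<and> 0 < d \<and> d \<le> Suc L \<and>
    mem s' 7 = real d \<and> mem s' 8 = real j \<and>
    (\<forall>i. i < 7 \<or> 12 < i \<longrightarrow> mem s' i = mem s i) \<and> extent s' \<le> 5 * n + 42 \<and>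
    steps s' + 106 * v \<le> steps s + 106 * (L * Suc L) \<and>
    mem s' 9 + rest L (term_at K m X Y) d j = (\<Sum>d=1..L. \<Sum>j=1..L. term_at K m X Y d j) \<and>
    mem s' 10 + rest L (term_at K m Y Y) d j = (\<Sum>d=1..L. \<Sum>j=1..L. term_at K m Y Y d j))"
    for v and s' :: state
  show ?thesis
  proof (rule sure_While[where I = I])
    show "I (left L 1 0) s"
      unfolding I_def using regs ext L
      by (intro exI[of _ 1] exI[of _ 0]) (simp add: rest_start[simplified] left_start)
  next
    fix v s1 assume "I v s1"
    then obtain d j where I: "v = left L d j" "j \<le> L" "0 < d" "d \<le> Suc L"
        "mem s1 7 = real d" "mem s1 8 = real j"
        "\<And>i. i < 7 \<or> 12 < i \<Longrightarrow> mem s1 i = mem s i" "extent s1 \<le> 5 * n + 42"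
        "steps s1 + 106 * v \<le> steps s + 106 * (L * Suc L)"
        "mem s1 9 + rest L (term_at K m X Y) d j = (\<Sum>d=1..L. \<Sum>j=1..L. term_at K m X Y d j)"
        "mem s1 10 + rest L (term_at K m Y Y) d j = (\<Sum>d=1..L. \<Sum>j=1..L. term_at K m Y Y d j)"
      unfolding I_def by blast
    have r: "mem s1 0 = real n" "mem s1 1 = real K" "mem s1 2 = real L" "mem s1 6 = real m"
      using I(7) regs by auto
    define s2 where "s2 = charge 5 8 s1"
    have s2: "mem s2 = mem s1" "steps s2 = steps s1 + 5" "extent s2 \<le> 5 * n + 42"
      using I(8) by (simp_all add: s2_def)
    have body: "sure (advance accumulate) s2 (\<lambda>s'. \<exists>v'<v. I v' s')" if d: "d \<le> L"
    proof -
      have r2: "mem s2 0 = real n" "mem s2 2 = real L" "mem s2 6 = real m" "mem s2 7 = real d" "mem s2 8 = real j"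
        using r I by (simp_all add: s2)
      from r2 s2(3) I(2) show ?thesis
      proof (cases rule: exec_advance_cases[where c = accumulate])
        case (skip s')
        have "I (left L d (Suc j)) s'"
          unfolding I_def using I skip s2 d left_step[OF d skip(1)] rest_step[OF d skip(1)]
          by (intro exI[of _ d] exI[of _ "Suc j"]) (auto simp add: term_at_def)
        then show ?thesis using skip left_step[OF d skip(1)] I(1) by (auto simp: sure_def)
      next
        case (row s')
        have "I (left L (Suc d) 0) s'"
          unfolding I_def using I row s2 d left_row[OF d] rest_row[OF d]
          by (intro exI[of _ "Suc d"] exI[of _ 0]) auto
        then show ?thesis using row left_row[OF d] I(1) by (auto simp: sure_def)
      next
        case (step s')
        have "sure accumulate s' (\<lambda>s''. (\<forall>i. i < 9 \<or> 12 < i \<longrightarrow> mem s'' i = mem s' i) \<and> extent s'' \<le> 5 * n + 42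
            \<and> steps s'' \<le> steps s' + 80 \<and> mem s'' 9 = mem s' 9 + term_at K m X Y d (Suc j)
            \<and> mem s'' 10 = mem s' 10 + term_at K m Y Y d (Suc j))"
          using step r I s2 m X Y by (intro sure_accumulate) auto
        then have "sure accumulate s' (\<lambda>s'. \<exists>v'<v. I v' s')"
        proof (rule sure_mono)
          fix s'' :: state assume *: "(\<forall>i. i < 9 \<or> 12 < i \<longrightarrow> mem s'' i = mem s' i) \<and> extent s'' \<le> 5 * n + 42
            \<and> steps s'' \<le> steps s' + 80 \<and> mem s'' 9 = mem s' 9 + term_at K m X Y d (Suc j)
            \<and> mem s'' 10 = mem s' 10 + term_at K m Y Y d (Suc j)"
          have "I (left L d (Suc j)) s''"
            unfolding I_def using * I step s2 d left_step[OF d step(1)] rest_step[OF d step(1)]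
            by (intro exI[of _ d] exI[of _ "Suc j"]) auto
          then show "\<exists>v'<v. I v' s''" using left_step[OF d step(1)] I(1) by auto
        qed
        then show ?thesis using step(3) by (simp add: sure_def)
      qed
    qed
    show "test_eval (Less (Cell 7) (Add (Cell 2) (Lit 1))) (mem s1) = Some True \<and>
        sure (advance accumulate) (charge (test_cost (Less (Cell 7) (Add (Cell 2) (Lit 1))))
          (test_extent (Less (Cell 7) (Add (Cell 2) (Lit 1)))) s1) (\<lambda>s'. \<exists>v'<v. I v' s') \<or>
      test_eval (Less (Cell 7) (Add (Cell 2) (Lit 1))) (mem s1) = Some False \<and>
        ?Q (charge (test_cost (Less (Cell 7) (Add (Cell 2) (Lit 1))))
          (test_extent (Less (Cell 7) (Add (Cell 2) (Lit 1)))) s1)"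
    proof (cases "d \<le> L")
      case True
      then show ?thesis using body r I(5) by (simp add: s2_def)
    next
      case False
      then have "rest L G d j = 0" for G by (simp add: rest_end)
      then show ?thesis using False r I by (intro disjI2) simp
    qed
  qed
qed

definition save :: "expr \<Rightarrow> nat \<Rightarrow> program" where
  "save base c = Seq (Assign 11 (Add base (Cell 6))) (Store 11 c)"

definition fill_row :: program where
  "fill_row = Seq (Assign 7 (Lit 1)) (Seq (Assign 8 (Lit 0)) (Seq (Assign 9 (Lit 0)) (Seq (Assign 10 (Lit 0))
     (Seq (While (Less (Cell 7) (Add (Cell 2) (Lit 1))) (advance accumulate))
     (Seq (Assign 12 (Div (Cell 9) (Cell 6))) (Seq (save xbase 12)
     (Seq (Assign 12 (Div (Cell 10) (Cell 6))) (Seq (save ybase 12)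
       (Assign 6 (Add (Cell 6) (Lit 1)))))))))))"

definition fill :: program where
  "fill = Seq (Assign 6 (Lit 0)) (Seq (save xbase 3) (Seq (save ybase 4) (Seq (Assign 6 (Lit 1))
     (While (Less (Cell 6) (Add (Cell 0) (Lit 1))) fill_row))))"

lemma sure_saveI:
  assumes "eval base (mem s) = Some (real p)" "mem s 6 = real k"
    and "20 \<le> p" "expr_extent base \<le> 20" "p + k < bnd" "extent s \<le> bnd" "mem s c = v" "c < 20" "c \<noteq> 11"
    and "\<And>s'. mem s' = (mem s)(11 := real (p + k), p + k := v) \<Longrightarrow>
      steps s' = steps s + 4 + expr_cost base \<Longrightarrow> extent s' \<le> bnd \<Longrightarrow> Q s'"
  shows "sure (save base c) s Q"
proof -
  define s1 where "s1 = put 11 (real (p + k)) (charge (3 + expr_cost base) (max (expr_extent base) 7) s)"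
  have "exec (save base c) s = return_spmf (put (p + k) (mem s1 c) (charge 1 (Suc (max 11 c)) s1))"
    using assms(1,2) unfolding save_def by (simp add: s1_def flip: of_nat_add)
  then show ?thesis
    using assms(3-9) by (auto simp: sure_def s1_def intro!: assms(10))
qed

lemma sure_fill_row:
  assumes regs: "mem s 0 = real n" "mem s 1 = real K" "mem s 2 = real L" "mem s 6 = real m"
    and ext: "extent s \<le> 5 * n + 42" and m: "m \<le> n" "0 < m" and L: "0 < L"
    and X: "\<And>i. i < m \<Longrightarrow> mem s (3 * n + 40 + i) = X i"
    and Y: "\<And>i. i < m \<Longrightarrow> mem s (4 * n + 41 + i) = Y i"
    and recX: "X m = (\<Sum>d=1..L. \<Sum>j=1..L. term_at K m X Y d j) / real m"
    and recY: "Y m = (\<Sum>d=1..L. \<Sum>j=1..L. term_at K m Y Y d j) / real m"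
  shows "sure fill_row s (\<lambda>s'. (\<forall>i<6. mem s' i = mem s i) \<and> extent s' \<le> 5 * n + 42
    \<and> steps s' \<le> steps s + 106 * (L * Suc L) + 60 \<and> mem s' 6 = real (Suc m)
    \<and> (\<forall>i<Suc m. mem s' (3 * n + 40 + i) = X i) \<and> (\<forall>i<Suc m. mem s' (4 * n + 41 + i) = Y i))"
proof -
  define s1 where "s1 = put 10 0 (charge 2 0 (put 9 0 (charge 2 0 (put 8 0 (charge 2 0 (put 7 1 (charge 2 0 s)))))))"
  have s1: "mem s1 = (mem s)(7 := 1, 8 := 0, 9 := 0, 10 := 0)" "steps s1 = steps s + 8" "extent s1 \<le> 5 * n + 42"
    using ext by (simp_all add: s1_def)
  have "sure (While (Less (Cell 7) (Add (Cell 2) (Lit 1))) (advance accumulate)) s1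
    (\<lambda>s'. (\<forall>i. i < 7 \<or> 12 < i \<longrightarrow> mem s' i = mem s1 i) \<and> extent s' \<le> 5 * n + 42
    \<and> steps s' \<le> steps s1 + 106 * (L * Suc L) + 6
    \<and> mem s' 9 = (\<Sum>d=1..L. \<Sum>j=1..L. term_at K m X Y d j)
    \<and> mem s' 10 = (\<Sum>d=1..L. \<Sum>j=1..L. term_at K m Y Y d j))"
    by (rule sure_accumulate_loop) (use regs m L X Y s1 in simp_all)
  then show ?thesis
    unfolding fill_row_def sure_Seq
    apply (simp add: s1_def[symmetric])
    apply (elim sure_mono)
    subgoal for s2
      using regs m
      apply (simp add: s1)
      apply (rule sure_saveI[where p = "3 * n + 40" and k = m and bnd = "5 * n + 42" and v = "X m"])
               apply (simp_all add: recX)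
      apply (rule sure_saveI[where p = "4 * n + 41" and k = m and bnd = "5 * n + 42" and v = "Y m"])
               apply (simp_all add: recX recY less_Suc_eq)
      using X Y s1 
      apply auto
      done
    done
qed

text \<open>The tables enter as arbitrary solutions \<open>X\<close> and \<open>Y\<close> of a
  recurrence over pairs up to \<open>L\<close>, so the statement covers the truncated and the full
  tables alike.\<close>

lemma sure_fill:
  assumes regs: "mem s 0 = real n" "mem s 1 = real K" "mem s 2 = real L" "mem s 3 = X 0" "mem s 4 = Y 0"
    and ext: "extent s \<le> 5 * n + 42" and L: "0 < L"
    and recX: "\<And>m. 0 < m \<Longrightarrow> m \<le> n \<Longrightarrow> X m = (\<Sum>d=1..L. \<Sum>j=1..L. term_at K m X Y d j) / real m"
    and recY: "\<And>m. 0 < m \<Longrightarrow> m \<le> n \<Longrightarrow> Y m = (\<Sum>d=1..L. \<Sum>j=1..L. term_at K m Y Y d j) / real m"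
  shows "sure fill s (\<lambda>s'. (\<forall>i<6. mem s' i = mem s i) \<and> extent s' \<le> 5 * n + 42
    \<and> steps s' \<le> steps s + 200 * (Suc n * (Suc L * Suc L))
    \<and> (\<forall>i\<le>n. mem s' (3 * n + 40 + i) = X i) \<and> (\<forall>i\<le>n. mem s' (4 * n + 41 + i) = Y i))"
    (is "sure _ _ ?Q")
proof -
  define Q where "Q = ?Q"
  define q where "q = Suc L * Suc L"
  have q: "L * Suc L \<le> q" "1 \<le> q" by (simp_all add: q_def)
  \<comment> \<open>\<open>m\<close> is the next energy to be filled. A row costs at most
    \<open>106 * q + 65 \<le> 190 * q\<close> steps including the loop test, and 50 pays for the two
    entries of energy 0.\<close>
  define I where "I v s' \<longleftrightarrow> (\<exists>m. v = Suc n - m \<and> 0 < m \<and> m \<le> Suc n \<and> mem s' 6 = real m \<and>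
    (\<forall>i<6. mem s' i = mem s i) \<and> extent s' \<le> 5 * n + 42 \<and> steps s' + 190 * q * v \<le> steps s + 190 * q * n + 50 \<and>
    (\<forall>i<m. mem s' (3 * n + 40 + i) = X i) \<and> (\<forall>i<m. mem s' (4 * n + 41 + i) = Y i))"
    for v and s' :: state
  have loop: "sure (While (Less (Cell 6) (Add (Cell 0) (Lit 1))) fill_row) s1 Q" if "I n s1" for s1
    using that
  proof (rule sure_While[where I = I])
    fix v s1 assume "I v s1"
    then obtain m where I: "v = Suc n - m" "0 < m" "m \<le> Suc n" "mem s1 6 = real m"
        "\<And>i. i < 6 \<Longrightarrow> mem s1 i = mem s i" "extent s1 \<le> 5 * n + 42"
        "steps s1 + 190 * q * v \<le> steps s + 190 * q * n + 50"
        "\<And>i. i < m \<Longrightarrow> mem s1 (3 * n + 40 + i) = X i" "\<And>i. i < m \<Longrightarrow> mem s1 (4 * n + 41 + i) = Y i"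
      unfolding I_def by blast
    have r: "mem s1 0 = real n" "mem s1 1 = real K" "mem s1 2 = real L"
      using I(5) regs by auto
    show "test_eval (Less (Cell 6) (Add (Cell 0) (Lit 1))) (mem s1) = Some True \<and>
        sure fill_row (charge (test_cost (Less (Cell 6) (Add (Cell 0) (Lit 1))))
          (test_extent (Less (Cell 6) (Add (Cell 0) (Lit 1)))) s1) (\<lambda>s'. \<exists>v'<v. I v' s') \<or>
      test_eval (Less (Cell 6) (Add (Cell 0) (Lit 1))) (mem s1) = Some False \<and>
        Q (charge (test_cost (Less (Cell 6) (Add (Cell 0) (Lit 1))))
          (test_extent (Less (Cell 6) (Add (Cell 0) (Lit 1)))) s1)"
    proof (cases "m \<le> n")
      case True
      have "sure fill_row (charge 5 7 s1) (\<lambda>s'. (\<forall>i<6. mem s' i = mem (charge 5 7 s1) i) \<and> extent s' \<le> 5 * n + 42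
        \<and> steps s' \<le> steps (charge 5 7 s1) + 106 * (L * Suc L) + 60 \<and> mem s' 6 = real (Suc m)
        \<and> (\<forall>i<Suc m. mem s' (3 * n + 40 + i) = X i) \<and> (\<forall>i<Suc m. mem s' (4 * n + 41 + i) = Y i))"
        by (rule sure_fill_row) (use r I True L recX recY in auto)
      then have "sure fill_row (charge 5 7 s1) (\<lambda>s'. \<exists>v'<v. I v' s')"
      proof (rule sure_mono)
        fix s' :: state
        assume *: "(\<forall>i<6. mem s' i = mem (charge 5 7 s1) i) \<and> extent s' \<le> 5 * n + 42
        \<and> steps s' \<le> steps (charge 5 7 s1) + 106 * (L * Suc L) + 60 \<and> mem s' 6 = real (Suc m)
        \<and> (\<forall>i<Suc m. mem s' (3 * n + 40 + i) = X i) \<and> (\<forall>i<Suc m. mem s' (4 * n + 41 + i) = Y i)"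
        have v: "v = Suc (n - m)" using I True by simp
        have "steps s' \<le> steps s1 + 65 + 106 * (L * Suc L)" using * by simp
        also have "\<dots> \<le> steps s1 + 190 * q" using q by linarith
        finally have "steps s' + 190 * q * (n - m) \<le> steps s1 + 190 * q * v" using v by simp
        then have "steps s' + 190 * q * (n - m) \<le> steps s + 190 * q * n + 50" using I(7) by linarith
        then have "I (n - m) s'"
          unfolding I_def using * I True by (intro exI[of _ "Suc m"]) simp
        then show "\<exists>v'<v. I v' s'" using v by auto
      qed
      then show ?thesis using True r I by simp
    next
      case False
      then have "m = Suc n" using I by simp
      moreover have "steps s1 + 5 \<le> steps s + 200 * (Suc n * (Suc L * Suc L))"
      proof -
        have "steps s1 + 5 \<le> steps s + 190 * (q * n) + 55" using I(7) by (simp add: mult_ac)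
        also have "\<dots> \<le> steps s + 200 * (q * n) + 200 * q" using q by linarith
        finally show ?thesis by (simp add: q_def algebra_simps)
      qed
      ultimately show ?thesis using I r regs by (intro disjI2) (auto simp: Q_def less_Suc_eq_le)
    qed
  qed
  have "sure fill s Q"
    unfolding fill_def sure_Seq
    apply simp
    apply (rule sure_saveI[where p = "3 * n + 40" and k = 0 and bnd = "5 * n + 42" and v = "X 0"])
             apply (use regs ext in simp_all)
    apply (rule sure_saveI[where p = "4 * n + 41" and k = 0 and bnd = "5 * n + 42" and v = "Y 0"])
             apply simp_all
    apply (rule loop)
    unfolding I_def
    apply (intro exI[of _ 1])
    apply auto
    done
  then show ?thesis by (simp only: Q_def)
qed

section \<open>Choosing and storing summands\<close>

text \<open>Cell 10 remembers from which table the weight was read: if the pair gets chosen, the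
  remaining energy is distributed according to that table.\<close>

definition weigh :: program where
  "weigh = Seq (Assign 10 (Cell 13)) (Seq (Cond (Less (Cell 1) (Cell 7)) (Assign 10 ybase) Skip)
     (Seq (Cond (Less (Cell 1) (Cell 8)) (Assign 10 ybase) Skip)
     (Seq (fetch (Cell 10)) (Assign 12 (Mul rate (Cell 12))))))"

text \<open>Cell 9 holds the total weight of the pairs not yet rejected, this one included, so the
  coin has the conditional probability of the pair given that all earlier ones were
  rejected.\<close>

definition flip :: program where
  "flip = Seq weigh (Seq (Sample 5 (Bernoulli (Div (Cell 12) (Cell 9)))) (Assign 9 (Sub (Cell 9) (Cell 12))))"

definition scan :: program where
  "scan = While (Equal (Cell 5) (Lit 0)) (advance flip)"

lemma sure_weigh:
  assumes regs: "mem s 0 = real n" "mem s 1 = real K" "mem s 6 = real m" "mem s 7 = real d" "mem s 8 = real j"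
      "mem s 13 = real pa"
    and ext: "extent s \<le> 5 * n + 42" and m: "m \<le> n" "d * j \<le> m" and pa: "20 \<le> pa" "pa + n < 5 * n + 42"
    and X: "\<And>i. i \<le> n \<Longrightarrow> mem s (pa + i) = X i"
    and Y: "\<And>i. i \<le> n \<Longrightarrow> mem s (4 * n + 41 + i) = Y i"
  shows "sure weigh s (\<lambda>s'. (\<forall>i. i < 10 \<or> 12 < i \<longrightarrow> mem s' i = mem s i) \<and> extent s' \<le> 5 * n + 42
    \<and> steps s' \<le> steps s + 60 \<and> mem s' 10 = real (if d \<le> K \<and> j \<le> K then pa else 4 * n + 41)
    \<and> mem s' 12 = term_at K m X Y d j)"
proof -
  obtain k where k: "m = d * j + k" using m(2) by (metis le_Suc_ex)
  have v1: "mem s (4 * n + 41 + k) = Y k" using Y[of k] m k by simp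
  have v2: "mem s (pa + k) = X k" using X[of k] m k by simp
  define p where "p = (if d \<le> K \<and> j \<le> K then pa else 4 * n + 41)"
  define v where "v = (if d \<le> K \<and> j \<le> K then X k else Y k)"
  have pv: "mem s (p + k) = v" "20 \<le> p" "p + k < 5 * n + 42" using v1 v2 pa m k by (simp_all add: p_def v_def)
  define C where "C = (\<lambda>s'. sure (Assign 12 (Mul rate (Cell 12))) s' (\<lambda>s'.
      (\<forall>i. i < 10 \<or> 12 < i \<longrightarrow> mem s' i = mem s i) \<and> extent s' \<le> 5 * n + 42
    \<and> steps s' \<le> steps s + 60 \<and> mem s' 10 = real (if d \<le> K \<and> j \<le> K then pa else 4 * n + 41)
    \<and> mem s' 12 = term_at K m X Y d j))"
  have fetch: "sure (fetch (Cell 10)) s1 C"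
    if s1: "mem s1 = (mem s)(10 := real p)" "steps s1 \<le> steps s + 30" "extent s1 \<le> 5 * n + 42" for s1
  proof (rule sure_fetchI[where p = p and d = d and j = j and k = k and v = v and bnd = "5 * n + 42"])
    fix s2 :: state and u
    assume "mem s2 = (mem s1)(11 := u, 12 := v)" "steps s2 = steps s1 + 8 + expr_cost (Cell 10)"
      "extent s2 \<le> 5 * n + 42"
    with s1 regs m k show "C s2"
      unfolding C_def by (auto simp: term_at_def v_def p_def choices_eq)
  qed (use s1 regs k pv in simp_all)
  show ?thesis
    unfolding weigh_def sure_Seq C_def[symmetric]
    using regs ext by (auto intro!: fetch simp: p_def)
qed

text \<open>Pairs are drawn with probability proportional to their weight. If \<open>h\<close>
  bounds the value of the continuation after each pair, the value before the scan is at least the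
  weighted mean of \<open>h\<close> over the pairs ahead. The deadline \<open>T\<close> is fixed in
  advance, and an iteration uses at most 130 steps of it.\<close>

lemma wp_scan:
  assumes mm: "mm 0 = real n" "mm 1 = real K" "mm 2 = real L" "mm 6 = real m" "mm 13 = real pa"
    and m: "m \<le> n" and pa: "20 \<le> pa" "pa + n < 5 * n + 42"
    and X: "\<And>i. i \<le> n \<Longrightarrow> mm (pa + i) = X i" "\<And>i. 0 \<le> X i"
    and Y: "\<And>i. i \<le> n \<Longrightarrow> mm (4 * n + 41 + i) = Y i" "\<And>i. 0 \<le> Y i"
    and post: "\<And>d j s'. 0 < d \<Longrightarrow> 0 < j \<Longrightarrow> d \<le> L \<Longrightarrow> j \<le> L \<Longrightarrow> d * j \<le> m \<Longrightarrow>
      (\<And>i. i < 5 \<or> i = 6 \<or> 12 < i \<Longrightarrow> mem s' i = mm i) \<Longrightarrow> mem s' 7 = real d \<Longrightarrow> mem s' 8 = real j \<Longrightarrow>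
      mem s' 10 = real (if d \<le> K \<and> j \<le> K then pa else 4 * n + 41) \<Longrightarrow>
      extent s' \<le> 5 * n + 42 \<Longrightarrow> steps s' \<le> T \<Longrightarrow> ennreal (h d j) \<le> f s'"
    and h: "\<And>d j. 0 \<le> h d j"
    and start: "\<And>i. i < 5 \<or> i = 6 \<or> 12 < i \<Longrightarrow> mem s i = mm i" "mem s 5 = 0"
      "mem s 7 = real d" "mem s 8 = real j" "mem s 9 = rest L (term_at K m X Y) d j"
      "0 < rest L (term_at K m X Y) d j" "j \<le> L" "0 < d"
      "extent s \<le> 5 * n + 42" "steps s + 130 * left L d j \<le> T"
  shows "ennreal (rest L (\<lambda>d j. term_at K m X Y d j * h d j) d j / rest L (term_at K m X Y) d j)
    \<le> wp scan f s"
  using start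
proof (induction "left L d j" arbitrary: d j s rule: less_induct)
  case less
  let ?G = "term_at K m X Y"
  let ?H = "\<lambda>d j. ?G d j * h d j"
  have G: "0 \<le> ?G d j" for d j using X(2) Y(2) by (simp add: term_at_def choices_def)
  have H: "0 \<le> ?H d j" for d j using G h by simp
  note I = less.prems
  have d: "d \<le> L" using I(6) rest_end[of L d ?G j] by (cases "d \<le> L") auto
  have r: "mem s 0 = real n" "mem s 1 = real K" "mem s 2 = real L" "mem s 6 = real m" "mem s 13 = real pa"
    using I(1) mm by auto
  define s2 where "s2 = charge 3 6 s"
  have s2: "mem s2 = mem s" "steps s2 = steps s + 3" "extent s2 \<le> 5 * n + 42"
    using I(9) by (simp_all add: s2_def)
  have un: "wp scan f s = wp (advance flip) (wp scan f) s2"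
    unfolding scan_def by (subst wp_While[where v = True]) (simp_all add: I(2) s2_def)
  from r I have r2: "mem s2 0 = real n" "mem s2 2 = real L" "mem s2 6 = real m" "mem s2 7 = real d" "mem s2 8 = real j"
    by (simp_all add: s2)
  from r2 s2(3) I(7) show ?case
  proof (cases rule: exec_advance_cases[where c = flip])
    case (skip s')
    have G0: "?G d (Suc j) = 0" using skip by (simp add: term_at_def)
    have "ennreal (rest L ?H d (Suc j) / rest L ?G d (Suc j)) \<le> wp scan f s'"
      by (rule less.hyps) (use I skip s2 d left_step[OF d skip(1)] rest_step[OF d skip(1)] G0 in auto)
    moreover have "wp (advance flip) (wp scan f) s2 = wp scan f s'"
      unfolding wp_def[of "advance flip"] skip(3) by (simp add: measure_spmf_return_spmf nn_integral_return)
    ultimately show ?thesis using un rest_step[OF d skip(1)] G0 by simp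
  next
    case (row s')
    have "ennreal (rest L ?H (Suc d) 0 / rest L ?G (Suc d) 0) \<le> wp scan f s'"
      by (rule less.hyps) (use I row s2 d left_row[OF d] rest_row[OF d] in auto)
    moreover have "wp (advance flip) (wp scan f) s2 = wp scan f s'"
      unfolding wp_def[of "advance flip"] row(2) by (simp add: measure_spmf_return_spmf nn_integral_return)
    ultimately show ?thesis using un rest_row[OF d] row by simp
  next
    case (step s')
    let ?w = "?G d (Suc j)" and ?R = "rest L ?G d j" and ?R' = "rest L ?G d (Suc j)"
    let ?S' = "rest L ?H d (Suc j)"
    have R: "?R = ?w + ?R'" "rest L ?H d j = ?w * h d (Suc j) + ?S'"
      using rest_step[OF d step(1)] by auto
    have R0: "0 \<le> ?R'" "0 \<le> ?S'" by (intro rest_nonneg G H)+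
    \<comment> \<open>A sum of non-negative weights that vanishes has only zero terms, so
      multiplying them by \<open>h\<close> changes nothing.\<close>
    have S0: "?S' = 0" if "?R' = 0"
    proof -
      have "rest L ?G d (Suc j) = 0" by (rule that)
      then have "(if d \<le> L then \<Sum>i=Suc (Suc j)..L. ?G d i else 0) = 0"
        "(\<Sum>e=Suc d..L. \<Sum>i=1..L. ?G e i) = 0"
        using G unfolding rest_def by (smt (verit) sum_nonneg)+
      then have "\<And>i. i \<in> {Suc (Suc j)..L} \<Longrightarrow> ?G d i = 0"
        "\<And>e i. e \<in> {Suc d..L} \<Longrightarrow> i \<in> {1..L} \<Longrightarrow> ?G e i = 0"
        using G d by (simp_all add: sum_nonneg_eq_0_iff sum_nonneg)
      then show ?thesis by (simp add: rest_def)
    qed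
    \<comment> \<open>For \<open>?R' = 0\<close> the coin shows 1 with certainty, so the bound for
      the other branch is immaterial; it is set to 0, as the induction hypothesis demands positive
      remaining weight.\<close>
    define h0 where "h0 = (if 0 < ?R' then ?S' / ?R' else 0)"
    have h0: "0 \<le> h0" "?R' * h0 = ?S'" using R0 S0 by (auto simp: h0_def)
    have fl: "wp (advance flip) (wp scan f) s2 = wp flip (wp scan f) s'"
      unfolding wp_def[of "advance flip"] wp_def[of flip] step(3) ..
    have "ennreal (rest L ?H d j / ?R) \<le> wp flip (wp scan f) s'"
      unfolding flip_def
    proof (rule wp_Seq_sure)
      show "sure weigh s' (\<lambda>s''. (\<forall>i. i < 10 \<or> 12 < i \<longrightarrow> mem s'' i = mem s' i) \<and> extent s'' \<le> 5 * n + 42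
        \<and> steps s'' \<le> steps s' + 60 \<and> mem s'' 10 = real (if d \<le> K \<and> Suc j \<le> K then pa else 4 * n + 41)
        \<and> mem s'' 12 = ?w)"
        by (rule sure_weigh) (use r I step s2 m pa X Y in auto)
    next
      fix s3 :: state
      assume *: "(\<forall>i. i < 10 \<or> 12 < i \<longrightarrow> mem s3 i = mem s' i) \<and> extent s3 \<le> 5 * n + 42
        \<and> steps s3 \<le> steps s' + 60 \<and> mem s3 10 = real (if d \<le> K \<and> Suc j \<le> K then pa else 4 * n + 41)
        \<and> mem s3 12 = ?w"
      have r3: "\<And>i. i < 5 \<or> i = 6 \<or> 12 < i \<Longrightarrow> mem s3 i = mm i" "mem s3 7 = real d" "mem s3 8 = real (Suc j)"
        "mem s3 9 = ?R" "extent s3 \<le> 5 * n + 42" "steps s3 \<le> steps s + 83" "mem s3 12 = ?w"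
        "mem s3 10 = real (if d \<le> K \<and> Suc j \<le> K then pa else 4 * n + 41)"
        using * step s2 I by auto
      have T: "steps s + 130 * Suc (left L d (Suc j)) \<le> T"
        using I(10) left_step[OF d step(1)] by simp
      have t1: "ennreal (h d (Suc j)) \<le> wp (Assign 9 (Sub (Cell 9) (Cell 12))) (wp scan f) (put 5 1 (charge 5 13 s3))"
      proof (rule wp_sure)
        define s4 where "s4 = put 9 ?R' (charge 4 13 (put 5 1 (charge 5 13 s3)))"
        show "sure (Assign 9 (Sub (Cell 9) (Cell 12))) (put 5 1 (charge 5 13 s3)) (\<lambda>s'. s' = s4)"
          using r3 R by (simp add: s4_def)
        fix s' :: state assume "s' = s4"
        then have "wp scan f s' = f (charge 3 6 s4)"
          unfolding scan_def by (subst wp_While[where v = False]) (simp_all add: s4_def)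
        moreover have "ennreal (h d (Suc j)) \<le> f (charge 3 6 s4)"
          by (rule post) (use r3 T I d step in \<open>auto simp: s4_def\<close>)
        ultimately show "ennreal (h d (Suc j)) \<le> wp scan f s'" by simp
      qed
      have t0: "ennreal h0 \<le> wp (Assign 9 (Sub (Cell 9) (Cell 12))) (wp scan f) (put 5 0 (charge 4 13 s3))"
      proof (rule wp_sure)
        define s4 where "s4 = put 9 ?R' (charge 4 13 (put 5 0 (charge 4 13 s3)))"
        show "sure (Assign 9 (Sub (Cell 9) (Cell 12))) (put 5 0 (charge 4 13 s3)) (\<lambda>s'. s' = s4)"
          using r3 R by (simp add: s4_def)
        fix s' :: state assume s': "s' = s4"
        show "ennreal h0 \<le> wp scan f s'"
        proof (cases "0 < ?R'")
          case True
          have "ennreal (?S' / ?R') \<le> wp scan f s'"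
            by (rule less.hyps) (use r3 T I d step True s' left_step[OF d step(1)] in \<open>auto simp: s4_def\<close>)
          then show ?thesis using True by (simp add: h0_def)
        qed (simp add: h0_def)
      qed
      have "rest L ?H d j / ?R = (?w / ?R) * h d (Suc j) + (1 - ?w / ?R) * h0"
      proof -
        have "1 - ?w / ?R = ?R' / ?R" using I(6) R(1) by (simp add: field_simps)
        then show ?thesis using R(2) h0(2) by (simp add: add_divide_distrib)
      qed
      also have "ennreal \<dots> \<le> wp (Sample 5 (Bernoulli (Div (Cell 12) (Cell 9))))
          (wp (Assign 9 (Sub (Cell 9) (Cell 12))) (wp scan f)) s3"
        using t0 t1 by (intro wp_Bernoulli) (use r3 I(6) G[of d "Suc j"] R R0 h0 h in auto)
      finally show "ennreal (rest L ?H d j / ?R) \<le> wp (Seq (Sample 5 (Bernoulli (Div (Cell 12) (Cell 9))))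
          (Assign 9 (Sub (Cell 9) (Cell 12)))) (wp scan f) s3" by (simp add: wp_Seq)
    qed
    then show ?thesis using un fl by simp
  qed
qed

text \<open>The pairs \<open>x \<le> d\<close>, \<open>y \<le> d + 1\<close> are mapped two-to-one onto the pairs with \<open>x + y \<le> d\<close>, by a point
  reflection of the upper half of the rectangle.\<close>

definition fold_pair :: program where
  "fold_pair = Seq (Cond (Less (Cell 7) (Add (Cell 14) (Cell 15)))
       (Seq (Assign 14 (Sub (Cell 7) (Cell 14))) (Assign 15 (Sub (Add (Cell 7) (Lit 1)) (Cell 15)))) Skip)
     (Assign 16 (Sub (Cell 7) (Add (Cell 14) (Cell 15))))"

definition choose_summand :: program where
  "choose_summand = Seq (Sample 14 (Uniform (Add (Cell 7) (Lit 1))))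
     (Seq (Sample 15 (Uniform (Add (Cell 7) (Lit 2)))) fold_pair)"

lemma sum_fold_pair:
  fixes g :: "nat \<Rightarrow> nat \<Rightarrow> real"
  shows "(\<Sum>x<d + 1. \<Sum>y<d + 2. if d < x + y then g (d - x) (d + 1 - y) else g x y)
    = 2 * (\<Sum>x\<le>d. \<Sum>y\<le>d - x. g x y)"
proof -
  have "(\<Sum>y<d + 2. if d < x + y then g (d - x) (d + 1 - y) else g x y)
      = (\<Sum>y\<le>d - x. g x y) + (\<Sum>y\<le>x. g (d - x) y)" if "x \<le> d" for x
  proof -
    \<comment> \<open>Column \<open>x\<close> is cut at \<open>d - x\<close>: the lower part
      consists of admissible pairs, and the upper part is reflected onto all admissible pairs of
      column \<open>d - x\<close>.\<close>
    have "{..<d + 2} = {..d - x} \<union> {Suc (d - x)..Suc d}" using that by auto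
    then have "(\<Sum>y<d + 2. if d < x + y then g (d - x) (d + 1 - y) else g x y)
      = (\<Sum>y\<in>{..d - x}. if d < x + y then g (d - x) (d + 1 - y) else g x y)
        + (\<Sum>y\<in>{Suc (d - x)..Suc d}. if d < x + y then g (d - x) (d + 1 - y) else g x y)"
      by (simp only:) (rule sum.union_disjoint, auto)
    also have "(\<Sum>y\<in>{..d - x}. if d < x + y then g (d - x) (d + 1 - y) else g x y) = (\<Sum>y\<le>d - x. g x y)"
      using that by (intro sum.cong) auto
    also have "(\<Sum>y\<in>{Suc (d - x)..Suc d}. if d < x + y then g (d - x) (d + 1 - y) else g x y)
        = (\<Sum>y\<le>x. g (d - x) y)"
      by (rule sum.reindex_bij_witness[where i = "\<lambda>y. d + 1 - y" and j = "\<lambda>y. d + 1 - y"]) (use that in auto)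
    finally show ?thesis .
  qed
  then have "(\<Sum>x<d + 1. \<Sum>y<d + 2. if d < x + y then g (d - x) (d + 1 - y) else g x y)
      = (\<Sum>x\<le>d. (\<Sum>y\<le>d - x. g x y) + (\<Sum>y\<le>x. g (d - x) y))"
    by (intro sum.cong) auto
  also have "\<dots> = (\<Sum>x\<le>d. \<Sum>y\<le>d - x. g x y) + (\<Sum>x\<le>d. \<Sum>y\<le>x. g (d - x) y)"
    by (rule sum.distrib)
  also have "(\<Sum>x\<le>d. \<Sum>y\<le>x. g (d - x) y) = (\<Sum>x\<le>d. \<Sum>y\<le>d - x. g x y)"
    by (rule sum.reindex_bij_witness[where i = "\<lambda>x. d - x" and j = "\<lambda>x. d - x"]) auto
  finally show ?thesis by simp
qed

text \<open>The \<open>(d + 1) * (d + 2)\<close> equally likely pairs cover each summand of size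
  \<open>d\<close> twice, hence the denominator \<open>choices d\<close>. A rectangle lets both
  coordinates be drawn uniformly, and the two values cost at most \<open>2 * d + 1\<close>
  steps.\<close>

lemma wp_choose_summand:
  assumes d: "mem s 7 = real d" and ext: "extent s \<le> bnd" "17 \<le> bnd"
    and g: "\<And>x y. 0 \<le> g x y"
    and post: "\<And>x y s'. x + y \<le> d \<Longrightarrow>
      mem s' = (mem s)(14 := real x, 15 := real y, 16 := real (d - (x + y))) \<Longrightarrow>
      extent s' \<le> bnd \<Longrightarrow> steps s' \<le> steps s + 2 * d + 60 \<Longrightarrow> ennreal (g x y) \<le> f s'"
  shows "ennreal ((\<Sum>x\<le>d. \<Sum>y\<le>d - x. g x y) / choices d) \<le> wp choose_summand f s"
proof -
  define g' where "g' x y = (if d < x + y then g (d - x) (d + 1 - y) else g x y)" for x y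
  have fp: "ennreal (g' x y) \<le> wp fold_pair f s1"
    if s1: "mem s1 = (mem s)(14 := real x, 15 := real y)" "extent s1 \<le> bnd" "steps s1 \<le> steps s + 2 * d + 20"
      and xy: "x < d + 1" "y < d + 2" for s1 x y
  proof (rule wp_sure)
    let ?x = "if d < x + y then d - x else x" and ?y = "if d < x + y then d + 1 - y else y"
    show "sure fold_pair s1 (\<lambda>s'. mem s' = (mem s)(14 := real ?x, 15 := real ?y, 16 := real (d - (?x + ?y)))
        \<and> extent s' \<le> bnd \<and> steps s' \<le> steps s + 2 * d + 60)"
      unfolding fold_pair_def using s1 xy d ext
      by (auto simp: of_nat_diff fun_upd_twist simp flip: of_nat_add)
    fix s' :: state assume "mem s' = (mem s)(14 := real ?x, 15 := real ?y, 16 := real (d - (?x + ?y)))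
        \<and> extent s' \<le> bnd \<and> steps s' \<le> steps s + 2 * d + 60"
    then show "ennreal (g' x y) \<le> f s'"
      using post[of ?x ?y s'] xy by (auto simp: g'_def split: if_splits)
  qed
  have y: "ennreal ((\<Sum>y<d + 2. g' x y) / real (d + 2)) \<le>
      wp (Seq (Sample 15 (Uniform (Add (Cell 7) (Lit 2)))) fold_pair) f s1"
    if s1: "mem s1 = (mem s)(14 := real x)" "extent s1 \<le> bnd" "steps s1 \<le> steps s + d + 4" "x < d + 1" for s1 x
    unfolding wp_Seq
    by (rule wp_Uniform) (use s1 d ext g in \<open>auto simp: g'_def[symmetric] intro!: fp\<close>, simp add: g'_def g)
  have x: "ennreal ((\<Sum>x<d + 1. (\<Sum>y<d + 2. g' x y) / real (d + 2)) / real (d + 1)) \<le> wp choose_summand f s"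
    unfolding choose_summand_def wp_Seq[of "Sample 14 _"]
  proof (rule wp_Uniform)
    fix k assume "k < d + 1"
    then show "ennreal ((\<Sum>y<d + 2. g' k y) / real (d + 2))
        \<le> wp (Seq (Sample 15 (Uniform (Add (Cell 7) (Lit 2)))) fold_pair) f
            (put 14 (real k) (charge (1 + expr_cost (Add (Cell 7) (Lit 1)) + k)
              (expr_extent (Add (Cell 7) (Lit 1))) s))"
      by (intro y) (use d ext in auto)
    show "0 \<le> (\<Sum>y<d + 2. g' k y) / real (d + 2)"
      by (intro divide_nonneg_nonneg sum_nonneg) (simp_all add: g'_def g)
  qed (use d in simp_all)
  have "(\<Sum>x<d + 1. (\<Sum>y<d + 2. g' x y) / real (d + 2)) / real (d + 1)
      = (\<Sum>x<d + 1. \<Sum>y<d + 2. g' x y) / (real (d + 2) * real (d + 1))"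
    by (simp add: sum_divide_distrib)
  also have "\<dots> = (\<Sum>x\<le>d. \<Sum>y\<le>d - x. g x y) / choices d"
    unfolding g'_def sum_fold_pair choices_def by (simp add: field_simps)
  finally show ?thesis using x by simp
qed

section \<open>Writing the output and decoding it\<close>

definition slot :: "nat \<Rightarrow> nat \<Rightarrow> nat" where
  "slot n i = (if i < 20 then 3 * n + 20 + i else i)"

definition triple :: "nat \<times> nat \<times> nat \<Rightarrow> nat multiset" where
  "triple = (\<lambda>(x, y, z). summand x y z)"

definition stored :: "nat \<Rightarrow> memory \<Rightarrow> (nat \<times> nat \<times> nat) list \<Rightarrow> bool" where
  "stored n m ps \<longleftrightarrow> (\<forall>i<length ps. m (slot n (3 * i + 1)) = real (fst (ps ! i)) \<and>
     m (slot n (3 * i + 2)) = real (fst (snd (ps ! i))) \<and> m (slot n (3 * i + 3)) = real (snd (snd (ps ! i))))"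

lemma slot_ge: "20 \<le> slot n i" by (simp add: slot_def)

lemma slot_less: "i \<le> 3 * n \<Longrightarrow> slot n i < 3 * n + 40" by (simp add: slot_def)

text \<open>The relocated cells start at \<open>3 * n + 20\<close>, past every output cell that
  keeps its own address.\<close>

lemma slot_inj: "i \<le> 3 * n \<Longrightarrow> j \<le> 3 * n \<Longrightarrow> slot n i = slot n j \<longleftrightarrow> i = j"
  by (auto simp: slot_def split: if_splits)

lemma stored_cong: "(\<And>i. 20 \<le> i \<Longrightarrow> m i = m' i) \<Longrightarrow> stored n m ps = stored n m' ps"
  by (simp add: stored_def slot_ge)

lemma stored_snoc:
  assumes "stored n m ps" "length ps < n" "\<And>i. i \<le> 3 * length ps \<Longrightarrow> m' (slot n i) = m (slot n i)"
    and "m' (slot n (3 * length ps + 1)) = real x" "m' (slot n (3 * length ps + 2)) = real y"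
      "m' (slot n (3 * length ps + 3)) = real z"
  shows "stored n m' (ps @ [(x, y, z)])"
  unfolding stored_def
proof (intro allI impI)
  fix i assume "i < length (ps @ [(x, y, z)])"
  then consider "i < length ps" | "i = length ps" by fastforce
  then show "m' (slot n (3 * i + 1)) = real (fst ((ps @ [(x, y, z)]) ! i)) \<and>
      m' (slot n (3 * i + 2)) = real (fst (snd ((ps @ [(x, y, z)]) ! i))) \<and>
      m' (slot n (3 * i + 3)) = real (snd (snd ((ps @ [(x, y, z)]) ! i)))"
  proof cases
    case 1
    then show ?thesis using assms(1,3) by (auto simp: stored_def nth_append)
  next
    case 2
    then show ?thesis using assms(4-6) by (simp only: nth_append_length fst_conv snd_conv)
  qed
qed

definition put_out :: "nat \<Rightarrow> program" where
  "put_out c = Seq (Assign 11 (Cell 17)) (Seq (Cond (Less (Cell 17) (Lit 20)) (Assign 11 (Add bbase (Cell 17))) Skip)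
     (Seq (Store 11 c) (Assign 17 (Add (Cell 17) (Lit 1)))))"

definition emit :: program where
  "emit = While (Less (Lit 0) (Cell 8)) (Seq (put_out 14) (Seq (put_out 15) (Seq (put_out 16)
     (Assign 8 (Sub (Cell 8) (Lit 1))))))"

lemma sure_put_outI:
  assumes "mem s 0 = real n" "mem s 17 = real i" "i \<le> 3 * n" "extent s \<le> 5 * n + 42" "mem s c = v"
    and c: "11 < c" "c < 17"
    and Q: "\<And>s'. mem s' = (mem s)(11 := real (slot n i), slot n i := v, 17 := real (Suc i)) \<Longrightarrow>
      steps s' \<le> steps s + 20 \<Longrightarrow> extent s' \<le> 5 * n + 42 \<Longrightarrow> Q s'"
  shows "sure (put_out c) s Q"
proof -
  define C where "C = (\<lambda>s'. sure (Assign 17 (Add (Cell 17) (Lit 1))) s' Q)"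
  have st: "sure (Store 11 c) s1 C"
    if s1: "mem s1 = (mem s)(11 := real (slot n i))" "steps s1 \<le> steps s + 15" "extent s1 \<le> 5 * n + 42" for s1
  proof -
    have "17 \<noteq> slot n i" "c \<noteq> slot n i" using slot_ge[of n i] c by auto
    then show ?thesis
      using s1 assms(1-7) slot_less[of i n]
      by (subst sure_Store[where i = "slot n i"]) (auto simp: C_def intro!: Q)
  qed
  show ?thesis
    unfolding put_out_def sure_Seq C_def[symmetric]
    using assms(1-7) by (auto simp: slot_def intro!: st)
qed

text \<open>The bound \<open>length ps + j \<le> n\<close> will hold because every summand takes at
  least one unit of energy. It keeps the output below \<open>3 * n + 40\<close>, where the tables
  begin.\<close>

lemma sure_emit:
  assumes "mem s 0 = real n" "mem s 8 = real j" "mem s 14 = real x" "mem s 15 = real y" "mem s 16 = real z"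
    and "mem s 17 = real (3 * length ps + 1)" "stored n (mem s) ps" "length ps + j \<le> n" "extent s \<le> 5 * n + 42"
  shows "sure emit s (\<lambda>s'. (\<forall>i. i < 8 \<or> i = 13 \<or> 3 * n + 40 \<le> i \<longrightarrow> mem s' i = mem s i) \<and>
    mem s' 17 = real (3 * length (ps @ replicate j (x, y, z)) + 1) \<and>
    stored n (mem s') (ps @ replicate j (x, y, z)) \<and> extent s' \<le> 5 * n + 42 \<and> steps s' \<le> steps s + 70 * j + 3)"
    (is "sure _ _ ?Q")
proof -
  \<comment> \<open>\<open>t\<close> copies are written and \<open>v\<close> remain, so the counter
    in cell 8 is itself the variant; a copy costs at most 70 steps.\<close>
  define I where "I v s' \<longleftrightarrow> (\<exists>t. t + v = j \<and> mem s' 8 = real v \<and>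
      (\<forall>i. i < 8 \<or> (12 < i \<and> i < 17) \<or> 3 * n + 40 \<le> i \<longrightarrow> mem s' i = mem s i) \<and>
      mem s' 17 = real (3 * length (ps @ replicate t (x, y, z)) + 1) \<and>
      stored n (mem s') (ps @ replicate t (x, y, z)) \<and> extent s' \<le> 5 * n + 42 \<and> steps s' + 70 * v \<le> steps s + 70 * j)"
    for v and s' :: state
  show ?thesis
    unfolding emit_def
  proof (rule sure_While[where I = I])
    show "I j s" unfolding I_def by (rule exI[of _ 0]) (use assms in auto)
  next
    fix v s1 assume "I v s1"
    then obtain t where I: "t + v = j" "mem s1 8 = real v"
      "\<And>i. i < 8 \<or> (12 < i \<and> i < 17) \<or> 3 * n + 40 \<le> i \<Longrightarrow> mem s1 i = mem s i"
      "mem s1 17 = real (3 * length (ps @ replicate t (x, y, z)) + 1)"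
      "stored n (mem s1) (ps @ replicate t (x, y, z))" "extent s1 \<le> 5 * n + 42" "steps s1 + 70 * v \<le> steps s + 70 * j"
      unfolding I_def by blast
    define k where "k = length (ps @ replicate t (x, y, z))"
    have r: "mem s1 0 = real n" "mem s1 14 = real x" "mem s1 15 = real y" "mem s1 16 = real z"
      using I(3) assms by auto
    show "test_eval (Less (Lit 0) (Cell 8)) (mem s1) = Some True \<and>
       sure (Seq (put_out 14) (Seq (put_out 15) (Seq (put_out 16) (Assign 8 (Sub (Cell 8) (Lit 1))))))
        (charge (test_cost (Less (Lit 0) (Cell 8))) (test_extent (Less (Lit 0) (Cell 8))) s1) (\<lambda>s'. \<exists>v'<v. I v' s') \<or>
       test_eval (Less (Lit 0) (Cell 8)) (mem s1) = Some False \<and>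
       ?Q (charge (test_cost (Less (Lit 0) (Cell 8))) (test_extent (Less (Lit 0) (Cell 8))) s1)"
    proof (cases v)
      case 0
      then show ?thesis using I by (intro disjI2) auto
    next
      case (Suc w)
      have k: "k < n" "k = length ps + t" using Suc I(1) assms(8) by (auto simp: k_def)
      have ne: "slot n i \<noteq> c" "c \<noteq> slot n i" if "c < 20" for i c using slot_ge[of n i] that by auto
      have "sure (put_out 14) (charge 3 9 s1) (\<lambda>s'. sure (put_out 15) s' (\<lambda>s'. sure (put_out 16) s' (\<lambda>s'.
          sure (Assign 8 (Sub (Cell 8) (Lit 1))) s' (\<lambda>s'. \<exists>v'<v. I v' s'))))"
      proof (rule sure_put_outI[where i = "3 * k + 1" and v = "real x"])
        fix s2 :: state
        assume s2: "mem s2 = (mem (charge 3 9 s1))(11 := real (slot n (3 * k + 1)), slot n (3 * k + 1) := real x,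
            17 := real (Suc (3 * k + 1)))" "steps s2 \<le> steps (charge 3 9 s1) + 20" "extent s2 \<le> 5 * n + 42"
        show "sure (put_out 15) s2 (\<lambda>s'. sure (put_out 16) s' (\<lambda>s'.
          sure (Assign 8 (Sub (Cell 8) (Lit 1))) s' (\<lambda>s'. \<exists>v'<v. I v' s')))"
        proof (rule sure_put_outI[where i = "3 * k + 2" and v = "real y"])
          fix s3 :: state
          assume s3: "mem s3 = (mem s2)(11 := real (slot n (3 * k + 2)), slot n (3 * k + 2) := real y,
            17 := real (Suc (3 * k + 2)))" "steps s3 \<le> steps s2 + 20" "extent s3 \<le> 5 * n + 42"
          show "sure (put_out 16) s3 (\<lambda>s'. sure (Assign 8 (Sub (Cell 8) (Lit 1))) s' (\<lambda>s'. \<exists>v'<v. I v' s'))"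
          proof (rule sure_put_outI[where i = "3 * k + 3" and v = "real z"])
            fix s4 :: state
            assume s4: "mem s4 = (mem s3)(11 := real (slot n (3 * k + 3)), slot n (3 * k + 3) := real z,
              17 := real (Suc (3 * k + 3)))" "steps s4 \<le> steps s3 + 20" "extent s4 \<le> 5 * n + 42"
            define s5 where "s5 = put 8 (real w) (charge 4 9 s4)"
            have st: "steps s5 + 70 * w \<le> steps s + 70 * j"
              using s2 s3 s4 I(7) Suc by (simp add: s5_def)
            have l: "length (ps @ replicate (Suc t) (x, y, z)) = Suc k" using k by simp
            have "stored n (mem s5) ((ps @ replicate t (x, y, z)) @ [(x, y, z)])"
              by (rule stored_snoc[OF I(5)])
                (use k in \<open>simp_all add: s5_def s2 s3 s4 ne slot_inj fun_upd_apply k_def[symmetric]\<close>)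
            then have sd: "stored n (mem s5) (ps @ replicate (Suc t) (x, y, z))"
              by (simp add: replicate_append_same)
            have fr: "mem s5 i = mem s i" if "i < 8 \<or> (12 < i \<and> i < 17) \<or> 3 * n + 40 \<le> i" for i
            proof -
              have "i \<noteq> slot n (3 * k + e)" if "e \<le> 3" for e
                using slot_less[of "3 * k + e" n] slot_ge[of n "3 * k + e"] that k
                  \<open>i < 8 \<or> (12 < i \<and> i < 17) \<or> 3 * n + 40 \<le> i\<close> by linarith
              from this[of 1] this[of 2] this[of 3] show ?thesis
                using I(3)[OF that] that by (auto simp: s5_def s4 s3 s2)
            qed
            have "I w s5"
              unfolding I_def using st sd fr s4(3) Suc I(1)
              by (intro exI[of _ "Suc t"]) (auto simp: s5_def s4 k)
            moreover have "mem s4 8 = real v" by (simp add: s4 s3 s2 ne I)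
            ultimately show "sure (Assign 8 (Sub (Cell 8) (Lit 1))) s4 (\<lambda>s'. \<exists>v'<v. I v' s')"
              using Suc by (auto simp: s5_def)
          qed (use s3 s2 r k I in \<open>simp_all add: ne\<close>)
        qed (use s2 r k I in \<open>simp_all add: ne\<close>)
      qed (use r k I in \<open>simp_all add: k_def[symmetric]\<close>)
      then show ?thesis using I Suc by simp
    qed
  qed
qed

text \<open>The registers are overwritten by the output last: each cell first receives the address of its
  final content and then loads through itself.\<close>

primrec spread :: "nat \<Rightarrow> program" where
  "spread 0 = Skip"
| "spread (Suc k) = Seq (spread k) (Assign (Suc k) (Add (Cell 0) (Lit (int (Suc k)))))"

primrec gather :: "nat \<Rightarrow> program" where
  "gather 0 = Load 0 0"
| "gather (Suc k) = Seq (Load (Suc k) (Suc k)) (gather k)"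

definition finish :: program where
  "finish = Seq (Assign 11 bbase) (Seq (Assign 12 (Div (Sub (Cell 17) (Lit 1)) (Lit 3))) (Seq (Store 11 12)
     (Seq (Assign 0 bbase) (Seq (spread 19) (gather 19)))))"

lemma sure_spread:
  assumes "mem s 0 = real B" "k < bnd" "extent s \<le> bnd"
  shows "sure (spread k) s (\<lambda>s'. (\<forall>i. mem s' i = (if 0 < i \<and> i \<le> k then real (B + i) else mem s i)) \<and>
    extent s' \<le> bnd \<and> steps s' \<le> steps s + 1 + 4 * k)"
  using assms(2)
proof (induction k)
  case 0
  then show ?case using assms by simp
next
  case (Suc k)
  then have "sure (spread k) s (\<lambda>s'. (\<forall>i. mem s' i = (if 0 < i \<and> i \<le> k then real (B + i) else mem s i)) \<and>
    extent s' \<le> bnd \<and> steps s' \<le> steps s + 1 + 4 * k)" by simp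
  then show ?case
    unfolding spread.simps sure_Seq
    by (rule sure_mono) (use assms Suc.prems in \<open>auto simp: le_Suc_eq\<close>)
qed

text \<open>Because \<open>k < B\<close>, the sources from \<open>B\<close> to \<open>B + k\<close>
  are disjoint from the destinations up to \<open>k\<close>, so no load reads a cell that was
  already overwritten.\<close>

lemma sure_gather:
  assumes "\<And>i. i \<le> k \<Longrightarrow> mem s i = real (B + i)" "k < B" "B + k < bnd" "extent s \<le> bnd"
  shows "sure (gather k) s (\<lambda>s'. (\<forall>i. mem s' i = (if i \<le> k then mem s (B + i) else mem s i)) \<and>
    extent s' \<le> bnd \<and> steps s' \<le> steps s + Suc k)"
  using assms
proof (induction k arbitrary: s)
  case 0
  then show ?case by (simp add: sure_Load[where i = B])
next
  case (Suc k)
  define s1 where "s1 = put (Suc k) (mem s (B + Suc k)) (charge 1 (Suc (max (Suc k) (B + Suc k))) s)"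
  have "sure (gather k) s1 (\<lambda>s'. (\<forall>i. mem s' i = (if i \<le> k then mem s1 (B + i) else mem s1 i)) \<and>
    extent s' \<le> bnd \<and> steps s' \<le> steps s1 + Suc k)"
    by (rule Suc.IH) (use Suc.prems in \<open>auto simp: s1_def\<close>)
  then have "sure (gather k) s1 (\<lambda>s'. (\<forall>i. mem s' i = (if i \<le> Suc k then mem s (B + i) else mem s i)) \<and>
    extent s' \<le> bnd \<and> steps s' \<le> steps s + Suc (Suc k))"
    by (rule sure_mono) (use Suc.prems in \<open>auto simp: s1_def le_Suc_eq\<close>)
  moreover have "mem s (Suc k) = real (B + Suc k)" by (rule Suc.prems) simp
  ultimately show ?case by (simp only: gather.simps sure_Seq sure_Load s1_def)
qed

lemma decode_stored:
  assumes "m 0 = real (length ps)"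
    and "\<And>i. i < length ps \<Longrightarrow> m (3 * i + 1) = real (fst (ps ! i)) \<and>
      m (3 * i + 2) = real (fst (snd (ps ! i))) \<and> m (3 * i + 3) = real (snd (snd (ps ! i)))"
  shows "decode m = Some (image_mset triple (mset ps))"
proof -
  have nat: "m i \<in> \<nat>" if "i \<in> {1..3 * length ps}" for i
  proof -
    define k where "k = (i - 1) div 3"
    have i: "1 \<le> i" "i - 1 < length ps * 3" using that by auto
    then have "i = 3 * k + 1 \<or> i = 3 * k + 2 \<or> i = 3 * k + 3" unfolding k_def by presburger
    moreover have "k < length ps" unfolding k_def by (rule less_mult_imp_div_less) (rule i)
    ultimately show ?thesis using assms(2)[of k] by auto
  qed
  have "image_mset (\<lambda>i. replicate_mset (nat \<lfloor>m (3 * i + 1)\<rfloor>) 1 + replicate_mset (nat \<lfloor>m (3 * i + 2)\<rfloor>) 2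
                + replicate_mset (nat \<lfloor>m (3 * i + 3)\<rfloor>) 3) (mset_set {0..<length ps})
      = image_mset (\<lambda>i. triple (ps ! i)) (mset_set {0..<length ps})"
    using assms(2) by (intro image_mset_cong) (auto simp: triple_def summand_def split_beta)
  also have "\<dots> = mset (map (\<lambda>i. triple (ps ! i)) [0..<length ps])"
    by (simp flip: mset_upt)
  also have "map (\<lambda>i. triple (ps ! i)) [0..<length ps] = map triple ps"
    by (rule nth_equalityI) auto
  finally show ?thesis using nat assms(1) by (simp add: decode_def Let_def)
qed

lemma sure_finish:
  assumes "mem s 0 = real n" "mem s 17 = real (3 * length ps + 1)" "stored n (mem s) ps" "length ps \<le> n"
    and "extent s \<le> 5 * n + 42"
  shows "sure finish s (\<lambda>s'. decode (mem s') = Some (image_mset triple (mset ps)) \<and>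
    extent s' \<le> 5 * n + 42 \<and> steps s' \<le> steps s + 150)"
proof -
  \<comment> \<open>This is \<open>slot n 0\<close>, the temporary place of output cell 0. It
    receives the number of summands before the registers are given up.\<close>
  define B where "B = 3 * n + 20"
  define s1 where "s1 = put 0 (real B) (charge 6 1 (put B (real (length ps)) (charge 1 13
    (put 12 (real (length ps)) (charge 6 18 (put 11 (real B) (charge 6 1 s)))))))"
  have s1: "mem s1 0 = real B" "extent s1 \<le> 5 * n + 42" "steps s1 = steps s + 19"
      "\<And>i. 20 \<le> i \<Longrightarrow> mem s1 i = (if i = B then real (length ps) else mem s i)"
    using assms by (simp_all add: s1_def B_def)
  have "sure (spread 19) s1 (\<lambda>s'. (\<forall>i. mem s' i = (if 0 < i \<and> i \<le> 19 then real (B + i) else mem s1 i)) \<and>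
    extent s' \<le> 5 * n + 42 \<and> steps s' \<le> steps s1 + 1 + 4 * 19)"
    by (rule sure_spread) (use s1 in auto)
  then have "sure (spread 19) s1 (\<lambda>s'. sure (gather 19) s' (\<lambda>s'. decode (mem s') = Some (image_mset triple (mset ps)) \<and>
    extent s' \<le> 5 * n + 42 \<and> steps s' \<le> steps s + 150))"
  proof (rule sure_mono)
    fix s2 :: state
    assume s2: "(\<forall>i. mem s2 i = (if 0 < i \<and> i \<le> 19 then real (B + i) else mem s1 i)) \<and>
      extent s2 \<le> 5 * n + 42 \<and> steps s2 \<le> steps s1 + 1 + 4 * 19"
    have "sure (gather 19) s2 (\<lambda>s'. (\<forall>i. mem s' i = (if i \<le> 19 then mem s2 (B + i) else mem s2 i)) \<and>
      extent s' \<le> 5 * n + 42 \<and> steps s' \<le> steps s2 + Suc 19)"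
      by (rule sure_gather) (use s1 s2 in \<open>auto simp: B_def\<close>)
    then show "sure (gather 19) s2 (\<lambda>s'. decode (mem s') = Some (image_mset triple (mset ps)) \<and>
      extent s' \<le> 5 * n + 42 \<and> steps s' \<le> steps s + 150)"
    proof (rule sure_mono)
      fix s3 :: state
      assume s3: "(\<forall>i. mem s3 i = (if i \<le> 19 then mem s2 (B + i) else mem s2 i)) \<and>
        extent s3 \<le> 5 * n + 42 \<and> steps s3 \<le> steps s2 + Suc 19"
      have m3: "mem s3 i = mem s1 (slot n i)" for i
        using s2 s3 by (auto simp: slot_def B_def)
      have m4: "mem s3 i = mem s (slot n i)" if "0 < i" "i \<le> 3 * length ps" for i
      proof -
        have "slot n i \<noteq> B" using that assms(4) by (auto simp: slot_def B_def)
        then show ?thesis using m3 s1(4)[OF slot_ge] by simp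
      qed
      have "decode (mem s3) = Some (image_mset triple (mset ps))"
        by (rule decode_stored)
          (use assms(3) s1(4)[of B] m3[of 0] in \<open>auto simp: m4 stored_def slot_def[of n 0] B_def\<close>)
      then show "decode (mem s3) = Some (image_mset triple (mset ps)) \<and>
        extent s3 \<le> 5 * n + 42 \<and> steps s3 \<le> steps s + 150"
        using s1 s2 s3 by auto
    qed
  qed
  moreover have "exec (Seq (Assign 11 bbase) (Seq (Assign 12 (Div (Sub (Cell 17) (Lit 1)) (Lit 3))) (Seq (Store 11 12)
     (Assign 0 bbase)))) s = return_spmf s1"
    using assms(1,2) by (simp add: s1_def B_def nat_of_real_eqI[of "3 * real n + 20" "3 * n + 20"])
  then have "sure (Seq (Assign 11 bbase) (Seq (Assign 12 (Div (Sub (Cell 17) (Lit 1)) (Lit 3))) (Seq (Store 11 12)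
     (Assign 0 bbase)))) s (\<lambda>s'. s' = s1)" by (simp only: sure_def) simp
  ultimately show ?thesis
    unfolding finish_def sure_Seq by (auto elim!: sure_mono simp del: sure_Assign)
qed

section \<open>Generating condensates\<close>

lemma share_const:
  assumes "M \<in> condensates m"
  shows "share K b b M = b"
  using share_linear[of K b 1 0 1 1 1 M] share_eq_1[OF assms, of 1 K] by simp

text \<open>So the second table holds \<open>b\<close> times the numbers of condensates, which is
  the term of \<open>table\<close> for pairs beyond the cutoff.\<close>

lemma table_const: "table K b b m = b * real (card (condensates m))"
  by (simp add: share_const flip: sum_share)

text \<open>Needed where a table entry vanishes: all shares summed up in it then vanish too, so
  nothing is lost by never drawing a pair of weight 0.\<close>

lemma share_le_table:
  assumes "M \<in> condensates m" "0 \<le> a" "0 \<le> b"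
  shows "share K a b M \<le> table K a b m"
  unfolding sum_share[symmetric]
  using assms finite_condensates by (intro member_le_sum share_nonneg) auto

lemma sum_rectangle:
  fixes F :: "nat \<Rightarrow> nat \<Rightarrow> real"
  assumes "\<And>d j. 0 < d \<Longrightarrow> 0 < j \<Longrightarrow> F d j \<noteq> 0 \<Longrightarrow> d \<le> m \<and> j \<le> m \<and> d \<le> L \<and> j \<le> L"
  shows "(\<Sum>d=1..m. \<Sum>j=1..m. F d j) = (\<Sum>d=1..L. \<Sum>j=1..L. F d j)"
proof -
  have *: "(\<Sum>d=1..k. \<Sum>j=1..k. F d j) = (\<Sum>(d, j)\<in>{1..min m L} \<times> {1..min m L}. F d j)"
    if "min m L \<le> k" for k
    unfolding sum.cartesian_product
  proof (rule sum.mono_neutral_right)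
    show "\<forall>i\<in>{1..k} \<times> {1..k} - {1..min m L} \<times> {1..min m L}. (case i of (d, j) \<Rightarrow> F d j) = 0"
    proof
      fix i assume i: "i \<in> {1..k} \<times> {1..k} - {1..min m L} \<times> {1..min m L}"
      then obtain d j where [simp]: "i = (d, j)" and dj: "0 < d" "0 < j" "\<not> (d \<le> m \<and> j \<le> m \<and> d \<le> L \<and> j \<le> L)"
        by (cases i) auto
      show "(case i of (d, j) \<Rightarrow> F d j) = 0" using assms[OF dj(1,2)] dj(3) by auto
    qed
  qed (use that in auto)
  show ?thesis using *[of m] *[of L] by simp
qed

text \<open>Pairs \<open>(d, j)\<close> outside \<open>{1..L} \<times> {1..L}\<close> contribute nothing to \<open>table\<close> up to energy \<open>n\<close>.\<close>

definition covers :: "nat \<Rightarrow> nat \<Rightarrow> nat \<Rightarrow> real \<Rightarrow> bool" where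
  "covers n K L b \<longleftrightarrow> n \<le> L \<or> L = K \<and> b = 0"

lemma factor_le: "0 < d \<Longrightarrow> 0 < j \<Longrightarrow> d * j \<le> m \<Longrightarrow> d \<le> m \<and> j \<le> (m::nat)"
  by (cases d; cases j) auto

text \<open>Both members of a pair with \<open>d * j \<le> m\<close> are at most \<open>m\<close>,
  so \<open>L \<ge> n\<close> loses no term. With \<open>b = 0\<close> and \<open>L = K\<close> the
  terms left out are 0, and this alternative is where the speed-up comes from.\<close>

lemma table_rec:
  assumes "0 < m" "m \<le> n" "covers n K L b"
  shows "real m * table K a b m
    = (\<Sum>d=1..L. \<Sum>j=1..L. term_at K m (table K a b) (table K b b) d j)"
proof -
  have "real m * table K a b m = (\<Sum>d=1..m. \<Sum>j=1..m. term_at K m (table K a b) (table K b b) d j)"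
    using assms(1) by (subst table.simps) (simp add: term_at_def table_const cong: if_cong)
  also have "\<dots> = (\<Sum>d=1..L. \<Sum>j=1..L. term_at K m (table K a b) (table K b b) d j)"
  proof (rule sum_rectangle)
    fix d j assume "0 < d" "0 < j" "term_at K m (table K a b) (table K b b) d j \<noteq> 0"
    then have "d * j \<le> m" "d \<le> K \<and> j \<le> K \<or> b \<noteq> 0"
      by (auto simp: term_at_def table_const split: if_splits)
    with factor_le[of d j m] \<open>0 < d\<close> \<open>0 < j\<close> assms show "d \<le> m \<and> j \<le> m \<and> d \<le> L \<and> j \<le> L"
      by (auto simp: covers_def)
  qed
  finally show ?thesis .
qed

text \<open>The recursion of \<open>share\<close>, regrouped by \<open>(d, j)\<close> to match
  \<open>table_rec\<close> term by term. After a violation the score is settled; writing it as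
  \<open>share K b b\<close> of the remainder makes both cases look alike.\<close>

lemma share_rec:
  assumes "0 < m" "m \<le> n" "covers n K L b" "M \<in> condensates m"
  shows "real m * share K a b M = (\<Sum>d=1..L. \<Sum>j=1..L. if d * j \<le> m then real d *
    (\<Sum>p\<in>summands d. if j \<le> count M p then
      share K (if d \<le> K \<and> j \<le> K then a else b) b (M - replicate_mset j p) else 0) else 0)"
proof -
  let ?s = "\<lambda>p j. share K (if size p \<le> K \<and> j \<le> K then a else b) b (M - replicate_mset j p)"
  let ?F = "\<lambda>d j. if d * j \<le> m then real d *
    (\<Sum>p\<in>summands d. if j \<le> count M p then
      share K (if d \<le> K \<and> j \<le> K then a else b) b (M - replicate_mset j p) else 0) else 0"
  have M: "M \<noteq> {#}" "weight M = m" using assms(1,4) by (auto simp: condensates_iff weight_def)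
  have sub: "set_mset M \<subseteq> (\<Union>d\<in>{1..m}. summands d)"
  proof
    fix p assume "p \<in># M"
    then have "1 \<le> count M p" by simp
    from condensates_diff[OF assms(4) this] show "p \<in> (\<Union>d\<in>{1..m}. summands d)" by auto
  qed
  have "real m * share K a b M = (\<Sum>p\<in>set_mset M. \<Sum>j=1..count M p. real (size p) *
        (if size p \<le> K \<and> j \<le> K then share K a b (M - replicate_mset j p) else b))"
    using M assms(1) by (subst share.simps) simp
  also have "\<dots> = (\<Sum>p\<in>set_mset M. \<Sum>j=1..m. if j \<le> count M p then real (size p) * ?s p j else 0)"
  proof (rule sum.cong[OF refl])
    fix p assume "p \<in># M"
    then have c: "1 \<le> count M p" by simp
    have le: "count M p \<le> m" using condensates_diff(4)[OF assms(4), of "count M p" p] c by simp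
    have "(\<Sum>j=1..m. if j \<le> count M p then real (size p) * ?s p j else 0)
        = (\<Sum>j=1..count M p. real (size p) * ?s p j)"
      using le by (intro sum.mono_neutral_cong_right) auto
    also have "\<dots> = (\<Sum>j=1..count M p. real (size p) *
        (if size p \<le> K \<and> j \<le> K then share K a b (M - replicate_mset j p) else b))"
    proof (intro sum.cong refl)
      fix j assume j: "j \<in> {1..count M p}"
      then have "M - replicate_mset j p \<in> condensates (m - size p * j)"
        using condensates_diff(1)[OF assms(4)] by simp
      then show "real (size p) * ?s p j = real (size p) *
        (if size p \<le> K \<and> j \<le> K then share K a b (M - replicate_mset j p) else b)"
        by (simp add: share_const)
    qed
    finally show "(\<Sum>j=1..count M p. real (size p) *
        (if size p \<le> K \<and> j \<le> K then share K a b (M - replicate_mset j p) else b))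
      = (\<Sum>j=1..m. if j \<le> count M p then real (size p) * ?s p j else 0)" ..
  qed
  also have "\<dots> = (\<Sum>p\<in>(\<Union>d\<in>{1..m}. summands d). \<Sum>j=1..m. if j \<le> count M p then real (size p) * ?s p j else 0)"
    using sub by (intro sum.mono_neutral_left) (auto simp: finite_summands not_in_iff)
  also have "\<dots> = (\<Sum>d=1..m. \<Sum>p\<in>summands d. \<Sum>j=1..m. if j \<le> count M p then real (size p) * ?s p j else 0)"
    by (intro sum.UNION_disjoint) (auto simp: finite_summands, auto simp: summands_def)
  also have "\<dots> = (\<Sum>d=1..m. \<Sum>j=1..m. \<Sum>p\<in>summands d. if j \<le> count M p then real (size p) * ?s p j else 0)"
    by (intro sum.cong refl sum.swap)
  also have "\<dots> = (\<Sum>d=1..m. \<Sum>j=1..m. ?F d j)"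
  proof (intro sum.cong refl)
    fix d j assume dj: "d \<in> {1..m}" "j \<in> {1..m}"
    have "(\<Sum>p\<in>summands d. if j \<le> count M p then real (size p) * ?s p j else 0)
       = (\<Sum>p\<in>summands d. if j \<le> count M p then real d *
           share K (if d \<le> K \<and> j \<le> K then a else b) b (M - replicate_mset j p) else 0)"
      by (intro sum.cong) (auto simp: summands_def)
    also have "\<dots> = ?F d j"
    proof (cases "d * j \<le> m")
      case True
      then show ?thesis by (simp add: sum_distrib_left if_distrib cong: if_cong)
    next
      case False
      then have "\<not> j \<le> count M p" if "p \<in> summands d" for p
        using condensates_diff(2)[OF assms(4), of j p] that dj by (auto simp: summands_def)
      then show ?thesis using False by simp
    qed
    finally show "(\<Sum>p\<in>summands d. if j \<le> count M p then real (size p) * ?s p j else 0) = ?F d j" .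
  qed
  also have "\<dots> = (\<Sum>d=1..L. \<Sum>j=1..L. ?F d j)"
  proof (rule sum_rectangle)
    fix d j assume 0: "0 < d" "0 < j" "?F d j \<noteq> 0"
    then have dj: "d * j \<le> m" by (auto split: if_splits)
    have "b \<noteq> 0" if "\<not> (d \<le> K \<and> j \<le> K)"
    proof
      assume "b = 0"
      then have "(if j \<le> count M p then share K (if d \<le> K \<and> j \<le> K then a else b) b (M - replicate_mset j p) else 0) = 0"
        for p
        using that condensates_diff(1)[OF assms(4), of j p] 0(2) share_const by auto
      then show False using 0(3) dj by simp
    qed
    with factor_le[OF 0(1,2) dj] assms(2,3) show "d \<le> m \<and> j \<le> m \<and> d \<le> L \<and> j \<le> L"
      by (auto simp: covers_def)
  qed
  finally show ?thesis .
qed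

text \<open>By \<open>table_rec\<close> the total weight of all pairs is the energy times its table
  entry, so cell 9 is initialised without a pass over the pairs. The walk starts just before the
  pair \<open>(1, 1)\<close>.\<close>

definition prepare :: program where
  "prepare = Seq (Assign 11 (Add (Cell 13) (Cell 6))) (Seq (Load 12 11) (Seq (Assign 9 (Mul (Cell 6) (Cell 12)))
     (Seq (Assign 7 (Lit 1)) (Seq (Assign 8 (Lit 0)) (Assign 5 (Lit 0))))))"

definition generate :: program where
  "generate = While (Less (Lit 0) (Cell 6)) (Seq prepare (Seq scan (Seq (Assign 13 (Cell 10))
     (Seq choose_summand (Seq (Assign 6 (Sub (Cell 6) (Mul (Cell 7) (Cell 8)))) emit)))))"

lemma sure_prepare:
  assumes "mem s 6 = real m" "mem s 13 = real pa" "pa + m < bnd" "20 \<le> bnd" "20 \<le> pa" "extent s \<le> bnd"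
    and "mem s (pa + m) = v"
  shows "sure prepare s (\<lambda>s'. (\<forall>i. i < 5 \<or> i = 6 \<or> 12 < i \<longrightarrow> mem s' i = mem s i) \<and> mem s' 5 = 0 \<and>
    mem s' 7 = 1 \<and> mem s' 8 = 0 \<and> mem s' 9 = real m * v \<and> extent s' \<le> bnd \<and> steps s' \<le> steps s + 15)"
proof -
  define s1 where "s1 = put 11 (real (pa + m)) (charge 4 14 s)"
  define s2 where "s2 = put 12 (mem s1 (pa + m)) (charge 1 (Suc (max 11 (pa + m))) s1)"
  have "sure (Seq (Assign 11 (Add (Cell 13) (Cell 6))) (Load 12 11)) s (\<lambda>s'. s' = s2)"
    using assms(1,2) by (simp add: sure_def s1_def s2_def flip: of_nat_add)
  then have "sure (Seq (Assign 11 (Add (Cell 13) (Cell 6))) (Load 12 11)) s (\<lambda>s'.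
    sure (Seq (Assign 9 (Mul (Cell 6) (Cell 12))) (Seq (Assign 7 (Lit 1)) (Seq (Assign 8 (Lit 0)) (Assign 5 (Lit 0))))) s'
    (\<lambda>s'. (\<forall>i. i < 5 \<or> i = 6 \<or> 12 < i \<longrightarrow> mem s' i = mem s i) \<and> mem s' 5 = 0 \<and>
    mem s' 7 = 1 \<and> mem s' 8 = 0 \<and> mem s' 9 = real m * v \<and> extent s' \<le> bnd \<and> steps s' \<le> steps s + 15))"
  proof (rule sure_mono)
    fix s' assume "s' = s2"
    then show "sure (Seq (Assign 9 (Mul (Cell 6) (Cell 12))) (Seq (Assign 7 (Lit 1)) (Seq (Assign 8 (Lit 0)) (Assign 5 (Lit 0))))) s'
    (\<lambda>s'. (\<forall>i. i < 5 \<or> i = 6 \<or> 12 < i \<longrightarrow> mem s' i = mem s i) \<and> mem s' 5 = 0 \<and>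
    mem s' 7 = 1 \<and> mem s' 8 = 0 \<and> mem s' 9 = real m * v \<and> extent s' \<le> bnd \<and> steps s' \<le> steps s + 15)"
      using assms by (auto simp: s2_def s1_def)
  qed
  then show ?thesis unfolding prepare_def sure_Seq .
qed

text \<open>The probability of producing \<open>M\<close> obeys the recursion of
  \<open>share\<close> divided by that of \<open>table\<close>. The score \<open>a\<close> and the
  base \<open>pa\<close> vary in the induction, because after a violation \<open>a\<close> becomes
  \<open>b\<close> and the second table takes over. Every round uses up at least one unit of energy
  and costs \<open>O(L ^ 2)\<close>, which explains the budget of
  \<open>300 * (Suc L * Suc L)\<close> steps per unit.\<close>

lemma wp_generate:
  assumes L: "0 < L" and b: "0 \<le> b" and cov: "covers n K L b"
    and regs: "mem s 0 = real n" "mem s 1 = real K" "mem s 2 = real L" "mem s 6 = real m" "mem s 13 = real pa"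
      "mem s 17 = real (3 * length ps + 1)"
    and pa: "20 \<le> pa" "3 * n + 40 \<le> pa" "pa + n < 5 * n + 42"
    and a: "0 \<le> a" "0 < table K a b m"
    and tabs: "\<And>i. i \<le> n \<Longrightarrow> mem s (pa + i) = table K a b i" "\<And>i. i \<le> n \<Longrightarrow> mem s (4 * n + 41 + i) = table K b b i"
    and out: "stored n (mem s) ps" "length ps + m \<le> n"
    and res: "extent s \<le> 5 * n + 42" "steps s + 300 * (Suc L * Suc L) * m + 3 \<le> T"
    and M: "M \<in> condensates m"
    and final: "\<And>s' ps'. image_mset triple (mset ps') = image_mset triple (mset ps) + M \<Longrightarrow> mem s' 0 = real n \<Longrightarrow>
      mem s' 17 = real (3 * length ps' + 1) \<Longrightarrow> length ps' \<le> n \<Longrightarrow> stored n (mem s') ps' \<Longrightarrow>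
      extent s' \<le> 5 * n + 42 \<Longrightarrow> steps s' \<le> T \<Longrightarrow> 1 \<le> f s'"
  shows "ennreal (share K a b M / table K a b m) \<le> wp generate f s"
  using regs pa a tabs out res M final
proof (induction m arbitrary: s pa ps a M rule: less_induct)
  case (less m)
  note regs = less.prems(1-6) and pa = less.prems(7-9) and a = less.prems(10,11) and tabs = less.prems(12,13)
    and out = less.prems(14,15) and res = less.prems(16,17) and M = less.prems(18) and final = less.prems(19)
  define s0 where "s0 = charge 3 7 s"
  have s0: "mem s0 = mem s" "extent s0 \<le> 5 * n + 42" "steps s0 = steps s + 3"
    using res by (simp_all add: s0_def)
  show ?case
  proof (cases "m = 0")
    case True
    then have [simp]: "M = {#}" using M condensates_0 by auto
    have "wp generate f s = f s0"
      unfolding generate_def using regs True by (subst wp_While[where v = False]) (simp_all add: s0_def)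
    moreover have "1 \<le> f s0"
      by (rule final[of ps]) (use regs out res True s0 in auto)
    moreover have "share K a b M / table K a b m = 1"
      using a True by (simp add: share.simps table.simps)
    ultimately show ?thesis by simp
  next
    case False
    define q where "q = Suc L * Suc L"
    let ?X = "table K a b" and ?Y = "table K b b"
    let ?G = "term_at K m ?X ?Y"
    \<comment> \<open>Beyond the cutoff both the score and the table switch; as \<open>a\<close>
      then equals \<open>b\<close>, they never switch back.\<close>
    define a' where "a' d j = (if d \<le> K \<and> j \<le> K then a else b)" for d j
    define pa' where "pa' d j = (if d \<le> K \<and> j \<le> K then pa else 4 * n + 41)" for d j
    define Z where "Z d j = table K (a' d j) b (m - d * j)" for d j
    define S where "S = (\<lambda>d j p. if j \<le> count M p then share K (a' d j) b (M - replicate_mset j p) else 0)"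
    define g where "g d j x y = S d j (summand x y (d - (x + y))) / Z d j" for d j x y
    \<comment> \<open>The chance of completing \<open>M\<close> after \<open>(d, j)\<close> was
      drawn, averaged over the summands of size \<open>d\<close>. If \<open>Z d j = 0\<close>, the
      pair has weight 0 and the default 0 claims nothing about it.\<close>
    define h where "h d j = (if 0 < d \<and> 0 < j \<and> 0 < Z d j then (\<Sum>x\<le>d. \<Sum>y\<le>d - x. g d j x y) / choices d else 0)" for d j
    have a'0: "0 \<le> a' d j" for d j using a b by (simp add: a'_def)
    have S0: "0 \<le> S d j p" for d j p using a'0 b by (simp add: S_def share_nonneg)
    have Z0: "0 \<le> Z d j" for d j unfolding Z_def by (intro table_nonneg a'0 b)
    have g0: "0 \<le> g d j x y" for d j x y using S0 Z0 by (simp add: g_def)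
    have ch: "0 < choices d" for d unfolding choices_eq by (intro divide_pos_pos mult_pos_pos) auto
    have h0: "0 \<le> h d j" for d j using g0 ch by (auto simp: h_def intro!: divide_nonneg_pos sum_nonneg)
    \<comment> \<open>The denominators \<open>choices d\<close> and \<open>Z d j\<close> in
      \<open>h\<close> cancel against the weight of the pair, which leaves the term of
      \<open>share_rec\<close>.\<close>
    have Gh: "?G d j * h d j = (if d * j \<le> m then real d * (\<Sum>p\<in>summands d. S d j p) else 0)"
      if "0 < d" "0 < j" for d j
    proof (cases "d * j \<le> m")
      case True
      have G: "?G d j = real d * choices d * Z d j" using True by (simp add: term_at_def Z_def a'_def)
      show ?thesis
      proof (cases "0 < Z d j")
        case T: True
        have "(\<Sum>x\<le>d. \<Sum>y\<le>d - x. g d j x y) = (\<Sum>p\<in>summands d. S d j p) / Z d j"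
          by (simp add: g_def sum_summands sum_divide_distrib)
        then show ?thesis using T True that ch[of d] by (simp add: G h_def)
      next
        case F: False
        then have "Z d j = 0" using Z0[of d j] by simp
        then have "S d j p \<le> 0" if "p \<in> summands d" for p
          using share_le_table[OF condensates_diff(1)[OF M, of j p] a'0 b, of K d j] \<open>0 < j\<close> that
          by (auto simp: S_def Z_def summands_def)
        then have "S d j p = 0" if "p \<in> summands d" for p using S0 that by (meson order.antisym)
        then show ?thesis using True \<open>Z d j = 0\<close> by (simp add: G)
      qed
    qed (simp add: term_at_def)
    have rG: "rest L ?G 1 0 = real m * ?X m"
      unfolding rest_start[OF L] using table_rec[of m n K L b a] False out cov by simp
    have rH: "rest L (\<lambda>d j. ?G d j * h d j) 1 0 = real m * share K a b M"
    proof -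
      have "rest L (\<lambda>d j. ?G d j * h d j) 1 0 = (\<Sum>d=1..L. \<Sum>j=1..L. if d * j \<le> m then real d * (\<Sum>p\<in>summands d. S d j p) else 0)"
        unfolding rest_start[OF L] by (intro sum.cong refl Gh) auto
      also have "\<dots> = real m * share K a b M"
        unfolding S_def a'_def using share_rec[of m n K L b M a] False out cov M by simp
      finally show ?thesis .
    qed
    have "ennreal (share K a b M / table K a b m) \<le> wp (Seq prepare (Seq scan (Seq (Assign 13 (Cell 10))
     (Seq choose_summand (Seq (Assign 6 (Sub (Cell 6) (Mul (Cell 7) (Cell 8)))) emit))))) (wp generate f) s0"
    proof (rule wp_Seq_sure)
      show "sure prepare s0 (\<lambda>s'. (\<forall>i. i < 5 \<or> i = 6 \<or> 12 < i \<longrightarrow> mem s' i = mem s0 i) \<and> mem s' 5 = 0 \<and>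
        mem s' 7 = 1 \<and> mem s' 8 = 0 \<and> mem s' 9 = real m * ?X m \<and> extent s' \<le> 5 * n + 42 \<and> steps s' \<le> steps s0 + 15)"
        by (rule sure_prepare) (use regs pa tabs(1)[of m] out s0 in auto)
    next
      fix s1 :: state
      assume s1: "(\<forall>i. i < 5 \<or> i = 6 \<or> 12 < i \<longrightarrow> mem s1 i = mem s0 i) \<and> mem s1 5 = 0 \<and>
        mem s1 7 = 1 \<and> mem s1 8 = 0 \<and> mem s1 9 = real m * ?X m \<and> extent s1 \<le> 5 * n + 42 \<and> steps s1 \<le> steps s0 + 15"
      have fr1: "mem s1 i = mem s i" if "i < 5 \<or> i = 6 \<or> 12 < i" for i using s1 s0 that by auto
      have r1: "mem s1 0 = real n" "mem s1 1 = real K" "mem s1 2 = real L" "mem s1 6 = real m" "mem s1 13 = real pa"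
          "mem s1 5 = 0" "mem s1 7 = real 1" "mem s1 8 = real 0" "extent s1 \<le> 5 * n + 42" "0 \<le> L" "0 < (1::nat)"
        using fr1[of 0] fr1[of 1] fr1[of 2] fr1[of 6] fr1[of 13] regs s1 by simp_all
      have mn: "m \<le> n" using out(2) by simp
      have eq: "share K a b M / table K a b m = rest L (\<lambda>d j. ?G d j * h d j) 1 0 / rest L ?G 1 0"
        using rG rH False by simp
      have "ennreal (rest L (\<lambda>d j. ?G d j * h d j) 1 0 / rest L ?G 1 0) \<le> wp scan (wp (Seq (Assign 13 (Cell 10))
          (Seq choose_summand (Seq (Assign 6 (Sub (Cell 6) (Mul (Cell 7) (Cell 8)))) emit))) (wp generate f)) s1"
      proof (rule wp_scan[where mm = "mem s1" and n = n and pa = pa and T = "steps s + 18 + 130 * (L * Suc L)"])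
        fix d j and s2 :: state
        assume dj: "0 < d" "0 < j" "d \<le> L" "j \<le> L" "d * j \<le> m"
          and fr2: "\<And>i. i < 5 \<or> i = 6 \<or> 12 < i \<Longrightarrow> mem s2 i = mem s1 i"
          and r2: "mem s2 7 = real d" "mem s2 8 = real j"
            "mem s2 10 = real (if d \<le> K \<and> j \<le> K then pa else 4 * n + 41)" "extent s2 \<le> 5 * n + 42"
            "steps s2 \<le> steps s + 18 + 130 * (L * Suc L)"
        show "ennreal (h d j) \<le> wp (Seq (Assign 13 (Cell 10))
          (Seq choose_summand (Seq (Assign 6 (Sub (Cell 6) (Mul (Cell 7) (Cell 8)))) emit))) (wp generate f) s2"
        proof (cases "0 < Z d j")
          case False
          then show ?thesis by (simp add: h_def)
        next
          case Zpos: True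
          define s3 where "s3 = put 13 (real (pa' d j)) (charge 2 11 s2)"
          have fr3: "mem s3 i = mem s i" if "i < 5 \<or> i = 6 \<or> 13 < i" for i
            using fr1[of i] fr2[of i] that by (auto simp: s3_def)
          have r3: "mem s3 7 = real d" "mem s3 8 = real j" "mem s3 13 = real (pa' d j)" "extent s3 \<le> 5 * n + 42"
            "steps s3 \<le> steps s + 20 + 130 * (L * Suc L)"
            using r2 by (simp_all add: s3_def)
          show ?thesis
          proof (rule wp_Seq_sure)
            show "sure (Assign 13 (Cell 10)) s2 (\<lambda>s'. s' = s3)"
              using r2 by (simp add: s3_def pa'_def)
            fix s' assume "s' = s3"
            have "ennreal ((\<Sum>x\<le>d. \<Sum>y\<le>d - x. g d j x y) / choices d)
                \<le> wp choose_summand (wp (Seq (Assign 6 (Sub (Cell 6) (Mul (Cell 7) (Cell 8)))) emit) (wp generate f)) s3"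
            proof (rule wp_choose_summand[where bnd = "5 * n + 42"])
              fix x y and s4 :: state
              assume xy: "x + y \<le> d"
                and s4: "mem s4 = (mem s3)(14 := real x, 15 := real y, 16 := real (d - (x + y)))"
                  "extent s4 \<le> 5 * n + 42" "steps s4 \<le> steps s3 + 2 * d + 60"
              define p where "p = summand x y (d - (x + y))"
              show "ennreal (g d j x y) \<le> wp (Seq (Assign 6 (Sub (Cell 6) (Mul (Cell 7) (Cell 8)))) emit) (wp generate f) s4"
              proof (cases "j \<le> count M p")
                case False
                then show ?thesis by (simp add: g_def S_def p_def)
              next
                case True
                have szp: "size p = d" using xy by (simp add: p_def size_summand)
                define m' where "m' = m - d * j"
                define ps' where "ps' = ps @ replicate j (x, y, d - (x + y))"
                have dj1: "j \<le> d * j" "0 < d * j" using dj by auto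
                have m': "m' < m" "m' + d * j = m" using dj(5) dj1(2) unfolding m'_def by linarith+
                have lps: "length ps' + m' \<le> n" using out(2) m'(2) dj1(1) unfolding ps'_def length_append length_replicate by linarith
                define s5 where "s5 = put 6 (real m') (charge 6 9 s4)"
                have fr5: "mem s5 i = mem s i" if "i < 5 \<or> 16 < i" for i
                  using fr3[of i] that by (auto simp: s5_def s4)
                have r5: "mem s5 6 = real m'" "mem s5 8 = real j" "mem s5 13 = real (pa' d j)"
                    "mem s5 14 = real x" "mem s5 15 = real y" "mem s5 16 = real (d - (x + y))"
                    "extent s5 \<le> 5 * n + 42" "steps s5 \<le> steps s + 86 + 130 * (L * Suc L) + 2 * d"
                  using s4 r3 by (simp_all add: s5_def)
                show ?thesis
                proof (rule wp_Seq_sure)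
                  show "sure (Assign 6 (Sub (Cell 6) (Mul (Cell 7) (Cell 8)))) s4 (\<lambda>s'. s' = s5)"
                    using r3 fr3[of 6] regs dj by (simp add: s4 s5_def m'_def of_nat_diff)
                  fix s' assume "s' = s5"
                  have st5: "stored n (mem s5) ps"
                    using out(1) stored_cong[of "mem s5" "mem s" n ps] fr5 by simp
                  have "sure emit s5 (\<lambda>s'. (\<forall>i. i < 8 \<or> i = 13 \<or> 3 * n + 40 \<le> i \<longrightarrow> mem s' i = mem s5 i) \<and>
                      mem s' 17 = real (3 * length ps' + 1) \<and> stored n (mem s') ps' \<and>
                      extent s' \<le> 5 * n + 42 \<and> steps s' \<le> steps s5 + 70 * j + 3)"
                    unfolding ps'_def
                    by (rule sure_emit) (use fr5 regs r5 st5 lps in \<open>auto simp: ps'_def\<close>)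
                  then have "ennreal (share K (a' d j) b (M - replicate_mset j p) / table K (a' d j) b m') \<le> wp emit (wp generate f) s5"
                  proof (rule wp_sure)
                    fix s6 :: state
                    assume s6: "(\<forall>i. i < 8 \<or> i = 13 \<or> 3 * n + 40 \<le> i \<longrightarrow> mem s6 i = mem s5 i) \<and>
                      mem s6 17 = real (3 * length ps' + 1) \<and> stored n (mem s6) ps' \<and>
                      extent s6 \<le> 5 * n + 42 \<and> steps s6 \<le> steps s5 + 70 * j + 3"
                    have fr6: "mem s6 i = mem s i" if "i < 5 \<or> 3 * n + 40 \<le> i" for i
                      using s6 fr5[of i] that by auto
                    have E: "image_mset triple (mset ps') = image_mset triple (mset ps) + replicate_mset j p"
                      by (simp add: ps'_def triple_def p_def)
                    have Mp: "replicate_mset j p + (M - replicate_mset j p) = M"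
                      using True by (simp add: replicate_subseteq_iff)
                    \<comment> \<open>One round pays \<open>130 * (L * Suc L)\<close> for the scan,
                      \<open>2 * d\<close> for the choice of the summand and \<open>70 * j\<close>
                      for its copies, where \<open>d\<close> and \<open>j\<close> are at most
                      \<open>L\<close>.\<close>
                    have "steps s6 + 300 * q * m' + 3 \<le> T"
                    proof -
                      have "steps s6 \<le> steps s + 89 + 130 * (L * Suc L) + 2 * d + 70 * j"
                        using s6 r5 by linarith
                      also have "\<dots> \<le> steps s + 89 + 130 * (L * Suc L) + 72 * L" using dj by linarith
                      also have "\<dots> \<le> steps s + 300 * q" by (simp add: q_def)
                      finally have "steps s6 + 300 * q * m' \<le> steps s + 300 * q * Suc m'" by simp
                      also have "\<dots> \<le> steps s + 300 * q * m" using m' by (intro add_left_mono mult_le_mono2) simp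
                      finally show ?thesis using res(2) by (simp add: q_def)
                    qed
                    then have tm: "steps s6 + 300 * (Suc L * Suc L) * m' + 3 \<le> T" by (simp only: q_def)
                    have r6: "mem s6 0 = real n" "mem s6 1 = real K" "mem s6 2 = real L" "mem s6 6 = real m'"
                        "mem s6 13 = real (pa' d j)" "mem s6 17 = real (3 * length ps' + 1)"
                        "stored n (mem s6) ps'" "extent s6 \<le> 5 * n + 42"
                      using s6 r5 fr6[of 0] fr6[of 1] fr6[of 2] regs by simp_all
                    have pa6: "20 \<le> pa' d j" "3 * n + 40 \<le> pa' d j" "pa' d j + n < 5 * n + 42"
                      using pa by (simp_all add: pa'_def)
                    show "ennreal (share K (a' d j) b (M - replicate_mset j p) / table K (a' d j) b m') \<le> wp generate f s6"
                    proof (rule less.IH[where ps = ps' and pa = "pa' d j"])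
                      show "M - replicate_mset j p \<in> condensates m'"
                        using condensates_diff(1)[OF M True] dj szp by (simp add: m'_def)
                      show "mem s6 (pa' d j + i) = table K (a' d j) b i" if "i \<le> n" for i
                        using fr6[of "pa + i"] fr6[of "4 * n + 41 + i"] pa tabs(1)[OF that] tabs(2)[OF that]
                        by (auto simp: pa'_def a'_def)
                      show "mem s6 (4 * n + 41 + i) = table K b b i" if "i \<le> n" for i
                        using fr6[of "4 * n + 41 + i"] tabs(2)[OF that] by simp
                      show "1 \<le> f s''" if "image_mset triple (mset ps'') = image_mset triple (mset ps') + (M - replicate_mset j p)"
                        "mem s'' 0 = real n" "mem s'' 17 = real (3 * length ps'' + 1)" "length ps'' \<le> n"
                        "stored n (mem s'') ps''" "extent s'' \<le> 5 * n + 42" "steps s'' \<le> T" for s'' ps''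
                        by (rule final) (use that Mp in \<open>simp_all add: E add.assoc\<close>)
                      show "0 < table K (a' d j) b m'" using Zpos by (simp add: Z_def m'_def)
                    qed (fact m' r6 pa6 a'0 lps tm)+
                  qed
                  then show "ennreal (g d j x y) \<le> wp emit (wp generate f) s'"
                    using True \<open>s' = s5\<close> by (simp add: g_def S_def Z_def p_def m'_def)
                qed
              qed
            qed (use r3 g0 in simp_all)
            then show "ennreal (h d j) \<le> wp (Seq choose_summand (Seq (Assign 6 (Sub (Cell 6) (Mul (Cell 7) (Cell 8)))) emit)) (wp generate f) s'"
              using dj Zpos \<open>s' = s3\<close> by (simp add: h_def wp_Seq)
          qed
        qed
      next
        show "mem s1 (pa + i) = ?X i" if "i \<le> n" for i using fr1[of "pa + i"] pa tabs(1)[OF that] by simp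
        show "mem s1 (4 * n + 41 + i) = ?Y i" if "i \<le> n" for i using fr1[of "4 * n + 41 + i"] tabs(2)[OF that] by simp
        show "0 < rest L ?G 1 0" using rG False a by simp
        show "mem s1 9 = rest L ?G 1 0" using rG s1 by simp
        show "steps s1 + 130 * left L 1 0 \<le> steps s + 18 + 130 * (L * Suc L)"
          using s1 s0 by (simp add: left_start)
        show "\<And>i. 0 \<le> ?X i" "\<And>i. 0 \<le> ?Y i" by (intro table_nonneg a b)+
      qed ((fact r1 pa h0 mn | rule refl)+)
      then show "ennreal (share K a b M / table K a b m) \<le> wp (Seq scan (Seq (Assign 13 (Cell 10))
          (Seq choose_summand (Seq (Assign 6 (Sub (Cell 6) (Mul (Cell 7) (Cell 8)))) emit)))) (wp generate f) s1"
        unfolding eq wp_Seq[of scan] .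
    qed
    moreover have "wp generate f s = wp (Seq prepare (Seq scan (Seq (Assign 13 (Cell 10))
     (Seq choose_summand (Seq (Assign 6 (Sub (Cell 6) (Mul (Cell 7) (Cell 8)))) emit))))) (wp generate f) s0"
      unfolding generate_def using regs False by (subst wp_While[where v = True]) (simp_all add: s0_def)
    ultimately show ?thesis by simp
  qed
qed

section \<open>The sampler\<close>

primrec power_expr :: "expr \<Rightarrow> nat \<Rightarrow> expr" where
  "power_expr e 0 = Lit 1"
| "power_expr e (Suc k) = Mul e (power_expr e k)"

lemma eval_power_expr: "eval e m = Some v \<Longrightarrow> eval (power_expr e k) m = Some (v ^ k)"
  by (induction k) simp_all

lemma cost_power_expr: "expr_cost (power_expr e k) = 1 + k * (expr_cost e + 1)"
  by (induction k) simp_all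

lemma extent_power_expr: "expr_extent (power_expr e k) = (if k = 0 then 0 else expr_extent e)"
  by (induction k) simp_all

text \<open>The condition \<open>K \<ge> n powr (5/16)\<close> is tested as
  \<open>n ^ 5 \<le> K ^ 16\<close>, which needs neither a fractional power nor rounding. Counting
  upwards costs \<open>O(K)\<close> steps.\<close>

definition find_cutoff :: "nat \<Rightarrow> program" where
  "find_cutoff n0 = Seq (Assign 1 (Lit (int n0)))
     (While (Less (power_expr (Cell 1) 16) (power_expr (Cell 0) 5)) (Assign 1 (Add (Cell 1) (Lit 1))))"

text \<open>With \<open>y\<close> the number of condensates and \<open>e = table K 0 1 n\<close>, the parameters \<open>y / n\<^sup>2 - e\<close> and
  \<open>y - e\<close> make up for the bias of the truncated sampler, see \<open>fallback_mixture\<close> below.\<close>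

definition fallback :: program where
  "fallback = Seq (Assign 2 (Cell 0)) (Seq (Assign 3 (Lit 0)) (Seq (Assign 4 (Lit 1)) (Seq fill
     (Seq (Assign 11 (Add xbase (Cell 0))) (Seq (Load 9 11)
     (Seq (Assign 11 (Add ybase (Cell 0))) (Seq (Load 10 11)
     (Seq (Assign 3 (Sub (Div (Cell 10) (Mul (Cell 0) (Cell 0))) (Cell 9)))
       (Assign 4 (Sub (Cell 10) (Cell 9)))))))))))"

definition produce :: program where
  "produce = Seq fill (Seq (Assign 13 xbase) (Seq (Assign 17 (Lit 1)) (Seq (Assign 6 (Cell 0))
     (Seq generate finish))))"

definition condensate_sampler :: "nat \<Rightarrow> program" where
  "condensate_sampler n0 = Seq (find_cutoff n0)
     (Seq (Sample 5 (Bernoulli (Div (Lit 1) (Mul (Cell 0) (Cell 0)))))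
     (Seq (Cond (Equal (Cell 5) (Lit 0))
        (Seq (Assign 2 (Cell 1)) (Seq (Assign 3 (Lit 1)) (Assign 4 (Lit 0)))) fallback)
       produce))"

lemma sure_find_cutoff:
  assumes "mem s 0 = real n" "0 < n0" "extent s \<le> 5 * n + 42"
  shows "sure (find_cutoff n0) s (\<lambda>s'. \<exists>K. mem s' = (mem s)(1 := real K) \<and> n0 \<le> K \<and> n ^ 5 \<le> K ^ 16 \<and>
    (K = n0 \<or> (K - 1) ^ 16 < n ^ 5) \<and> extent s' \<le> 5 * n + 42 \<and> steps s' \<le> steps s + 50 * K + 50)"
    (is "sure _ _ ?Q")
proof -
  define Q where "Q = ?Q"
  define I where "I v s' \<longleftrightarrow> (\<exists>K. v = n ^ 5 - K \<and> mem s' = (mem s)(1 := real K) \<and> n0 \<le> K \<and>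
    (K = n0 \<or> (K - 1) ^ 16 < n ^ 5) \<and> extent s' \<le> 5 * n + 42 \<and> steps s' \<le> steps s + 2 + 50 * (K - n0))"
    for v and s' :: state
  have loop: "sure (While (Less (power_expr (Cell 1) 16) (power_expr (Cell 0) 5)) (Assign 1 (Add (Cell 1) (Lit 1)))) s1 Q"
    if "I v s1" for v s1
    using that
  proof (rule sure_While[where I = I])
    fix v s1 assume "I v s1"
    then obtain K where K: "v = n ^ 5 - K" "mem s1 = (mem s)(1 := real K)" "n0 \<le> K"
      "K = n0 \<or> (K - 1) ^ 16 < n ^ 5" "extent s1 \<le> 5 * n + 42" "steps s1 \<le> steps s + 2 + 50 * (K - n0)"
      unfolding I_def by blast
    have test: "test_eval (Less (power_expr (Cell 1) 16) (power_expr (Cell 0) 5)) (mem s1) = Some (K ^ 16 < n ^ 5)"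
      using eval_power_expr[of "Cell 1" "mem s1" "real K" 16] eval_power_expr[of "Cell 0" "mem s1" "real n" 5] K(2) assms(1)
      by (simp flip: of_nat_power)
    define s2 where "s2 = charge (test_cost (Less (power_expr (Cell 1) 16) (power_expr (Cell 0) 5)))
      (test_extent (Less (power_expr (Cell 1) 16) (power_expr (Cell 0) 5))) s1"
    have s2: "mem s2 = mem s1" "extent s2 \<le> 5 * n + 42" "steps s2 = steps s1 + 45"
      using K(5) by (simp_all add: s2_def cost_power_expr extent_power_expr)
    show "test_eval (Less (power_expr (Cell 1) 16) (power_expr (Cell 0) 5)) (mem s1) = Some True \<and>
        sure (Assign 1 (Add (Cell 1) (Lit 1)))
          (charge (test_cost (Less (power_expr (Cell 1) 16) (power_expr (Cell 0) 5)))
            (test_extent (Less (power_expr (Cell 1) 16) (power_expr (Cell 0) 5))) s1) (\<lambda>s'. \<exists>v'<v. I v' s') \<or>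
      test_eval (Less (power_expr (Cell 1) 16) (power_expr (Cell 0) 5)) (mem s1) = Some False \<and>
        Q (charge (test_cost (Less (power_expr (Cell 1) 16) (power_expr (Cell 0) 5)))
            (test_extent (Less (power_expr (Cell 1) 16) (power_expr (Cell 0) 5))) s1)"
      unfolding s2_def[symmetric] test
    proof (cases "K ^ 16 < n ^ 5")
      case True
      \<comment> \<open>Hence \<open>K < n ^ 5\<close>, and the truncated subtraction in the variant
        really decreases.\<close>
      have "K \<le> K ^ 16" using K(3) assms(2) by (intro self_le_power) auto
      with True have "n ^ 5 - Suc K < v" using K(1) by linarith
      moreover have "I (n ^ 5 - Suc K) (put 1 (real (Suc K)) (charge 4 2 s2))"
        unfolding I_def
        by (intro exI[of _ "Suc K"]) (use K s2 True in \<open>auto simp: Suc_diff_le\<close>)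
      ultimately have "\<exists>v'<v. I v' (put 1 (real (Suc K)) (charge 4 2 s2))" by blast
      then show "Some (K ^ 16 < n ^ 5) = Some True \<and> sure (Assign 1 (Add (Cell 1) (Lit 1))) s2 (\<lambda>s'. \<exists>v'<v. I v' s') \<or>
        Some (K ^ 16 < n ^ 5) = Some False \<and> Q s2"
        using True s2 K(2) by (simp add: add.commute)
    next
      case False
      then have "Q s2" unfolding Q_def using K s2 by (intro exI[of _ K]) auto
      then show "Some (K ^ 16 < n ^ 5) = Some True \<and> sure (Assign 1 (Add (Cell 1) (Lit 1))) s2 (\<lambda>s'. \<exists>v'<v. I v' s') \<or>
        Some (K ^ 16 < n ^ 5) = Some False \<and> Q s2"
        using False by simp
    qed
  qed
  have "I (n ^ 5 - n0) (put 1 (real n0) (charge 2 0 s))"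
    unfolding I_def by (intro exI[of _ n0]) (use assms in auto)
  from loop[OF this] show ?thesis unfolding find_cutoff_def by (simp add: Q_def)
qed

lemma table_rec':
  assumes "0 < m" "m \<le> n" "covers n K L b"
  shows "table K a b m = (\<Sum>d=1..L. \<Sum>j=1..L. term_at K m (table K a b) (table K b b) d j) / real m"
  using table_rec[OF assms, of a] assms(1) by (simp add: field_simps)

lemma sure_fill_table:
  assumes "mem s 0 = real n" "mem s 1 = real K" "mem s 2 = real L" "mem s 3 = a" "mem s 4 = b"
    and "extent s \<le> 5 * n + 42" "0 < L" "covers n K L b"
  shows "sure fill s (\<lambda>s'. (\<forall>i<6. mem s' i = mem s i) \<and> extent s' \<le> 5 * n + 42
    \<and> steps s' \<le> steps s + 200 * (Suc n * (Suc L * Suc L))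
    \<and> (\<forall>i\<le>n. mem s' (3 * n + 40 + i) = table K a b i) \<and> (\<forall>i\<le>n. mem s' (4 * n + 41 + i) = table K b b i))"
  by (rule sure_fill) (use assms table_rec' in \<open>auto simp: table.simps[of _ _ _ 0]\<close>)

text \<open>Filling with the scores 0 and 1 yields both constants at once: the last entry of the
  first table is \<open>e\<close>, that of the second is \<open>y\<close>. As \<open>b\<close> is
  positive here, the loops have to run up to \<open>n\<close>.\<close>

lemma sure_fallback:
  assumes "mem s 0 = real n" "mem s 1 = real K" "extent s \<le> 5 * n + 42" "0 < n"
    and y: "y = real (card (condensates n))" and e: "e = table K 0 1 n"
  shows "sure fallback s (\<lambda>s'. mem s' 0 = real n \<and> mem s' 1 = real K \<and> mem s' 2 = real n \<and>
    mem s' 3 = y / real n ^ 2 - e \<and> mem s' 4 = y - e \<and> extent s' \<le> 5 * n + 42 \<and>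
    steps s' \<le> steps s + 200 * (Suc n * (Suc n * Suc n)) + 50)"
proof -
  define s1 where "s1 = put 4 1 (charge 2 0 (put 3 0 (charge 2 0 (put 2 (real n) (charge 2 1 s)))))"
  have ex1: "exec (Seq (Assign 2 (Cell 0)) (Seq (Assign 3 (Lit 0)) (Assign 4 (Lit 1)))) s = return_spmf s1"
    using assms(1) by (simp add: s1_def)
  have s1: "mem s1 = (mem s)(2 := real n, 3 := 0, 4 := 1)" "extent s1 \<le> 5 * n + 42" "steps s1 = steps s + 6"
    using assms(3) by (simp_all add: s1_def)
  have "sure fill s1 (\<lambda>s'. (\<forall>i<6. mem s' i = mem s1 i) \<and> extent s' \<le> 5 * n + 42
    \<and> steps s' \<le> steps s1 + 200 * (Suc n * (Suc n * Suc n))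
    \<and> (\<forall>i\<le>n. mem s' (3 * n + 40 + i) = table K 0 1 i) \<and> (\<forall>i\<le>n. mem s' (4 * n + 41 + i) = table K 1 1 i))"
    by (rule sure_fill_table) (use assms s1 in \<open>auto simp: covers_def\<close>)
  then have "sure fill s1 (\<lambda>s'. sure (Seq (Assign 11 (Add xbase (Cell 0))) (Seq (Load 9 11)
     (Seq (Assign 11 (Add ybase (Cell 0))) (Seq (Load 10 11)
     (Seq (Assign 3 (Sub (Div (Cell 10) (Mul (Cell 0) (Cell 0))) (Cell 9)))
       (Assign 4 (Sub (Cell 10) (Cell 9)))))))) s' (\<lambda>s'. mem s' 0 = real n \<and> mem s' 1 = real K \<and> mem s' 2 = real n \<and>
    mem s' 3 = y / real n ^ 2 - e \<and> mem s' 4 = y - e \<and> extent s' \<le> 5 * n + 42 \<and>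
    steps s' \<le> steps s + 200 * (Suc n * (Suc n * Suc n)) + 50))"
  proof (rule sure_mono)
    fix s2 :: state
    assume *: "(\<forall>i<6. mem s2 i = mem s1 i) \<and> extent s2 \<le> 5 * n + 42
      \<and> steps s2 \<le> steps s1 + 200 * (Suc n * (Suc n * Suc n))
      \<and> (\<forall>i\<le>n. mem s2 (3 * n + 40 + i) = table K 0 1 i) \<and> (\<forall>i\<le>n. mem s2 (4 * n + 41 + i) = table K 1 1 i)"
    define t where "t = 200 * (Suc n * (Suc n * Suc n))"
    have r: "mem s2 0 = real n" "mem s2 1 = real K" "mem s2 2 = real n" "extent s2 \<le> 5 * n + 42"
        "steps s2 \<le> steps s + 6 + t" "mem s2 (4 * n + 40) = e" "mem s2 (5 * n + 41) = y"
      using * s1 assms *[THEN conjunct2, THEN conjunct2, THEN conjunct2, THEN conjunct1, rule_format, of n]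
        *[THEN conjunct2, THEN conjunct2, THEN conjunct2, THEN conjunct2, rule_format, of n]
      by (auto simp: t_def table_const)
    define s3 where "s3 = put 11 (real (4 * n + 40)) (charge 8 1 s2)"
    define s4 where "s4 = put 9 e (charge 1 (Suc (max 11 (4 * n + 40))) s3)"
    define s5 where "s5 = put 11 (real (5 * n + 41)) (charge 8 1 s4)"
    define s6 where "s6 = put 10 y (charge 1 (Suc (max 11 (5 * n + 41))) s5)"
    have "exec (Seq (Assign 11 (Add xbase (Cell 0))) (Seq (Load 9 11)
     (Seq (Assign 11 (Add ybase (Cell 0))) (Load 10 11)))) s2 = return_spmf s6"
    proof -
      have "exec (Assign 11 (Add xbase (Cell 0))) s2 = return_spmf s3"
        using r by (simp add: s3_def)
      moreover have "exec (Load 9 11) s3 = return_spmf s4"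
        using r by (simp add: s4_def s3_def del: of_nat_add of_nat_mult)
      moreover have "exec (Assign 11 (Add ybase (Cell 0))) s4 = return_spmf s5"
        using r by (simp add: s5_def s4_def s3_def)
      moreover have "exec (Load 10 11) s5 = return_spmf s6"
        using r by (simp add: s6_def s5_def s4_def s3_def del: of_nat_add of_nat_mult)
      ultimately show ?thesis by (simp only: exec.simps(7) return_bind_spmf)
    qed
    then have "sure (Seq (Assign 11 (Add xbase (Cell 0))) (Seq (Load 9 11)
     (Seq (Assign 11 (Add ybase (Cell 0))) (Load 10 11)))) s2 (\<lambda>s'. s' = s6)" unfolding sure_def by simp
    moreover have "sure (Seq (Assign 3 (Sub (Div (Cell 10) (Mul (Cell 0) (Cell 0))) (Cell 9)))
       (Assign 4 (Sub (Cell 10) (Cell 9)))) s6 (\<lambda>s'. mem s' 0 = real n \<and> mem s' 1 = real K \<and> mem s' 2 = real n \<and>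
    mem s' 3 = y / real n ^ 2 - e \<and> mem s' 4 = y - e \<and> extent s' \<le> 5 * n + 42 \<and>
    steps s' \<le> steps s + t + 50)"
      using r assms(4) by (simp add: s6_def s5_def s4_def s3_def power2_eq_square)
    ultimately show "sure (Seq (Assign 11 (Add xbase (Cell 0))) (Seq (Load 9 11)
     (Seq (Assign 11 (Add ybase (Cell 0))) (Seq (Load 10 11)
     (Seq (Assign 3 (Sub (Div (Cell 10) (Mul (Cell 0) (Cell 0))) (Cell 9)))
       (Assign 4 (Sub (Cell 10) (Cell 9)))))))) s2 (\<lambda>s'. mem s' 0 = real n \<and> mem s' 1 = real K \<and> mem s' 2 = real n \<and>
    mem s' 3 = y / real n ^ 2 - e \<and> mem s' 4 = y - e \<and> extent s' \<le> 5 * n + 42 \<and>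
    steps s' \<le> steps s + 200 * (Suc n * (Suc n * Suc n)) + 50)"
      unfolding sure_Seq t_def by (elim sure_mono) auto
  qed
  moreover have "sure (Seq (Assign 2 (Cell 0)) (Seq (Assign 3 (Lit 0)) (Assign 4 (Lit 1)))) s (\<lambda>s'. s' = s1)"
    unfolding sure_def ex1 by simp
  ultimately show ?thesis
    unfolding fallback_def sure_Seq by (elim sure_mono) auto
qed

lemma wp_produce:
  assumes regs: "mem s 0 = real n" "mem s 1 = real K" "mem s 2 = real L" "mem s 3 = a" "mem s 4 = b"
    and ext: "extent s \<le> 5 * n + 42" and L: "0 < L" and cov: "covers n K L b" and ab: "0 \<le> a" "0 \<le> b"
    and pos: "0 < table K a b n" and M: "M \<in> condensates n"
    and T: "steps s + 600 * (Suc n * (Suc L * Suc L)) + 200 \<le> T"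
    and f: "\<And>s'. decode (mem s') = Some M \<Longrightarrow> extent s' \<le> 5 * n + 42 \<Longrightarrow> steps s' \<le> T \<Longrightarrow> 1 \<le> f s'"
  shows "ennreal (share K a b M / table K a b n) \<le> wp produce f s"
  unfolding produce_def
proof (rule wp_Seq_sure[OF sure_fill_table[OF regs ext L cov]])
  fix s1 :: state
  define q where "q = Suc L * Suc L"
  have q: "1 \<le> q" by (simp add: q_def)
  assume s1: "(\<forall>i<6. mem s1 i = mem s i) \<and> extent s1 \<le> 5 * n + 42
    \<and> steps s1 \<le> steps s + 200 * (Suc n * (Suc L * Suc L))
    \<and> (\<forall>i\<le>n. mem s1 (3 * n + 40 + i) = table K a b i) \<and> (\<forall>i\<le>n. mem s1 (4 * n + 41 + i) = table K b b i)"
  define s2 where "s2 = put 6 (real n) (charge 2 1 (put 17 1 (charge 2 0 (put 13 (real (3 * n + 40)) (charge 6 1 s1)))))"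
  have ex: "exec (Seq (Assign 13 xbase) (Seq (Assign 17 (Lit 1)) (Assign 6 (Cell 0)))) s1 = return_spmf s2"
    using s1 regs by (simp add: s2_def)
  have s2: "mem s2 = (mem s1)(13 := real (3 * n + 40), 17 := 1, 6 := real n)" "extent s2 \<le> 5 * n + 42"
    "steps s2 = steps s1 + 10" using s1 by (simp_all add: s2_def)
  have le: "ennreal (share K a b M / table K a b n) \<le> wp generate (wp finish f) s2"
  \<comment> \<open>The last 150 steps before the deadline are set aside for
    \<open>finish\<close>.\<close>
  proof (rule wp_generate[where ps = "[]" and pa = "3 * n + 40" and T = "T - 150"])
    show "steps s2 + 300 * (Suc L * Suc L) * n + 3 \<le> T - 150"
    proof -
      have "steps s2 \<le> steps s + 200 * (Suc n * q) + 10" using s1 s2 by (simp add: q_def)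
      moreover have "steps s + 600 * (Suc n * q) + 200 \<le> T" using T by (simp only: q_def)
      moreover have "300 * q * n \<le> 300 * (Suc n * q)" by simp
      ultimately have "steps s2 + 300 * q * n + 3 \<le> T - 150" by linarith
      then show ?thesis by (simp only: q_def)
    qed
    fix s3 :: state and ps'
    assume s3: "image_mset triple (mset ps') = image_mset triple (mset []) + M" "mem s3 0 = real n"
      "mem s3 17 = real (3 * length ps' + 1)" "length ps' \<le> n" "stored n (mem s3) ps'" "extent s3 \<le> 5 * n + 42"
      "steps s3 \<le> T - 150"
    show "1 \<le> wp finish f s3"
    proof (rule wp_sure[OF sure_finish[OF s3(2,3,5,4,6)]])
      fix s4 :: state
      assume "decode (mem s4) = Some (image_mset triple (mset ps')) \<and> extent s4 \<le> 5 * n + 42 \<and> steps s4 \<le> steps s3 + 150"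
      then show "1 \<le> f s4" using s3 T by (intro f) auto
    qed
  qed (use regs s1 s2 L cov ab pos M in \<open>simp_all add: stored_def\<close>)
  have su: "sure (Seq (Assign 13 xbase) (Seq (Assign 17 (Lit 1)) (Assign 6 (Cell 0)))) s1 (\<lambda>s'. s' = s2)"
    unfolding sure_def ex by simp
  have "ennreal (share K a b M / table K a b n) \<le>
      wp (Seq (Seq (Assign 13 xbase) (Seq (Assign 17 (Lit 1)) (Assign 6 (Cell 0)))) (Seq generate finish)) f s1"
    by (rule wp_Seq_sure[OF su]) (use le in \<open>simp add: wp_Seq\<close>)
  then show "ennreal (share K a b M / table K a b n) \<le>
      wp (Seq (Assign 13 xbase) (Seq (Assign 17 (Lit 1)) (Seq (Assign 6 (Cell 0)) (Seq generate finish)))) f s1"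
    by (simp only: wp_Seq)
qed

section \<open>Size of the cutoff and the two deadlines\<close>

definition cutoff :: "nat \<Rightarrow> nat \<Rightarrow> nat" where
  "cutoff n0 n = (LEAST K. n0 \<le> K \<and> n ^ 5 \<le> K ^ 16)"

lemma cutoff_eqI:
  assumes "n0 \<le> K" "n ^ 5 \<le> K ^ 16" "K = n0 \<or> (K - 1) ^ 16 < n ^ 5"
  shows "cutoff n0 n = K"
  unfolding cutoff_def
proof (rule Least_equality)
  fix K' assume K': "n0 \<le> K' \<and> n ^ 5 \<le> K' ^ 16"
  show "K \<le> K'"
  proof (rule ccontr)
    assume "\<not> K \<le> K'"
    then have "K' \<le> K - 1" by simp
    then have "K' ^ 16 \<le> (K - 1) ^ 16" by (rule power_mono) simp
    with assms(3) K' \<open>\<not> K \<le> K'\<close> show False by auto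
  qed
qed (use assms in auto)

text \<open>An explicit candidate, which shows that the minimum exists and bounds it from
  above.\<close>

lemma cutoff_candidate:
  assumes "0 < n"
  shows "n0 \<le> n0 + nat \<lceil>real n powr (5/16)\<rceil> \<and> n ^ 5 \<le> (n0 + nat \<lceil>real n powr (5/16)\<rceil>) ^ 16"
proof -
  have "real n ^ 5 = (real n powr (5/16)) ^ 16"
    using assms by (simp add: powr_power)
  also have "\<dots> \<le> real (n0 + nat \<lceil>real n powr (5/16)\<rceil>) ^ 16"
    by (intro power_mono) (auto intro: order_trans[OF real_nat_ceiling_ge])
  finally have "real (n ^ 5) \<le> real ((n0 + nat \<lceil>real n powr (5/16)\<rceil>) ^ 16)" by simp
  then show ?thesis unfolding of_nat_le_iff by simp
qed

lemma cutoff: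
  assumes "0 < n"
  shows "n0 \<le> cutoff n0 n" "n ^ 5 \<le> cutoff n0 n ^ 16" "cutoff n0 n \<le> n0 + nat \<lceil>real n powr (5/16)\<rceil>"
proof -
  have "n0 \<le> cutoff n0 n \<and> n ^ 5 \<le> cutoff n0 n ^ 16"
    unfolding cutoff_def
    using LeastI[of "\<lambda>K. n0 \<le> K \<and> n ^ 5 \<le> K ^ 16"] cutoff_candidate[OF assms, of n0] by blast
  then show "n0 \<le> cutoff n0 n" "n ^ 5 \<le> cutoff n0 n ^ 16" by auto
  show "cutoff n0 n \<le> n0 + nat \<lceil>real n powr (5/16)\<rceil>"
    unfolding cutoff_def
    using Least_le[of "\<lambda>K. n0 \<le> K \<and> n ^ 5 \<le> K ^ 16"] cutoff_candidate[OF assms, of n0] by blast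
qed

definition fast_time :: "nat \<Rightarrow> nat \<Rightarrow> nat" where
  "fast_time n0 n = 600 * (Suc n * (Suc (cutoff n0 n) * Suc (cutoff n0 n))) + 50 * cutoff n0 n + 300"

text \<open>Of the coefficient 800, the filling in \<open>fallback\<close> takes 200 and
  \<open>produce\<close> takes 600, both with loop bound \<open>n\<close>.\<close>

definition slow_time :: "nat \<Rightarrow> nat \<Rightarrow> nat" where
  "slow_time n0 n = fast_time n0 n + 800 * (Suc n * (Suc n * Suc n)) + 400"

text \<open>For \<open>v = share K 1 0 M\<close> and \<open>t = table K 1 0 n\<close> the numerator
  is \<open>t - (1 - \<delta>) * y * v\<close> and the denominator \<open>\<delta> * y * t\<close>.
  So the fallback returns \<open>M\<close> with \<open>1 / \<delta>\<close> times the deficit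
  \<open>1 / y - (1 - \<delta>) * (v / t)\<close> left by the truncated sampler.\<close>

lemma fallback_mixture:
  fixes \<delta> e t v y :: real
  assumes "0 < \<delta>" "0 < t" "0 < y" "e = y - t"
  shows "\<delta> * (((\<delta> * y - e) * v + t * (1 - v)) / ((\<delta> * y - e) * t + t * e)) + (1 - \<delta>) * (v / t) = 1 / y"
proof -
  have "(\<delta> * y - e) * t + t * e = \<delta> * (y * t)" by (simp add: algebra_simps)
  moreover have "(\<delta> * y - e) * v + t * (1 - v) = t - (1 - \<delta>) * y * v" by (simp add: assms(4) algebra_simps)
  ultimately have "\<delta> * (((\<delta> * y - e) * v + t * (1 - v)) / ((\<delta> * y - e) * t + t * e))
      = (t - (1 - \<delta>) * y * v) / (y * t)" using assms(1) by simp
  moreover have "(t - (1 - \<delta>) * y * v) / (y * t) + (1 - \<delta>) * (v / t) = 1 / y"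
    using assms(2,3) by (simp add: field_simps)
  ultimately show ?thesis by simp
qed

text \<open>The first bound credits only the truncated branch, against the short deadline, and
  serves the expected time. The second credits both branches, against the long deadline, and serves
  uniformity and the bounds on the support.\<close>

lemma wp_condensate_sampler:
  assumes n0: "0 < n0" and n: "0 < n" and M: "M \<in> condensates n"
    and K: "K = cutoff n0 n" and y: "y = real (card (condensates n))"
    and small: "table K 0 1 n \<le> y / real n ^ 2"
    and T: "fast_time n0 n \<le> T"
    and f: "\<And>s'. decode (mem s') = Some M \<Longrightarrow> extent s' \<le> 5 * n + 42 \<Longrightarrow> steps s' \<le> T \<Longrightarrow> 1 \<le> f s'"
  shows "ennreal ((1 - 1 / real n ^ 2) * (share K 1 0 M / table K 1 0 n))
      \<le> wp (condensate_sampler n0) f (initial n)" (is ?fast)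
    and "slow_time n0 n \<le> T \<Longrightarrow> ennreal (1 / y) \<le> wp (condensate_sampler n0) f (initial n)" (is "_ \<Longrightarrow> ?slow")
proof -
  define \<delta> where "\<delta> = 1 / real n ^ 2"
  define e where "e = table K 0 1 n"
  define t where "t = table K 1 0 n"
  define v where "v = share K 1 0 M"
  have \<delta>: "0 < \<delta>" "\<delta> \<le> 1" using n by (simp_all add: \<delta>_def)
  have K0: "0 < K" "n0 \<le> K" using cutoff(1)[OF n, of n0] n0 K by auto
  have y0: "0 < y" using condensates_nonempty[of n] finite_condensates[of n] by (simp add: y card_gt_0_iff)
  have e: "e = y - t" using table_0_1[of K n] by (simp add: e_def t_def y)
  have e0: "0 \<le> e" by (simp add: e_def table_nonneg)
  have es: "e \<le> \<delta> * y" using small by (simp add: e_def \<delta>_def)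
  \<comment> \<open>For \<open>n = 1\<close> the weight \<open>\<delta>\<close> is 1, so
    \<open>e \<le> \<delta> * y\<close> does not separate \<open>e\<close> from \<open>y\<close>;
    there the cutoff is at least \<open>n\<close> and nothing is lost to it.\<close>
  have t0: "0 < t"
  proof (cases "n = 1")
    case True
    then have "e \<le> 0" using table_0_1_le[of K n] K0 by (simp add: e_def)
    then show ?thesis using e y0 by simp
  next
    case False
    then have "1 < real n ^ 2" using n by (intro one_less_power) auto
    then have "\<delta> * y < 1 * y" using y0 n by (intro mult_strict_right_mono) (auto simp: \<delta>_def)
    then show ?thesis using es e by simp
  qed
  have v: "0 \<le> v" "v \<le> 1" using share_le_1[OF M, of K] by (simp_all add: v_def share_nonneg)
  define a where "a = \<delta> * y - e"
  have a0: "0 \<le> a" using es by (simp add: a_def)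
  have sh: "share K a t M = a * v + t * (1 - v)"
  proof -
    have "share K (a * 1 + t * 0) (a * 0 + t * 1) M = a * share K 1 0 M + t * share K 0 1 M"
      by (rule share_linear)
    moreover have "share K 0 1 M = 1 - share K 1 0 M"
      using share_linear[of K 1 1 "-1" 1 1 0 M] share_eq_1[OF M, of 1 K] by simp
    ultimately show ?thesis by (simp add: v_def)
  qed
  have ta: "table K a t n = a * t + t * e"
    using table_linear[of K a 1 t 0 0 1 n] by (simp add: t_def e_def)
  then have ta': "table K a t n = \<delta> * (y * t)" by (simp add: a_def algebra_simps)
  define rest' where "rest' = Seq (Cond (Equal (Cell 5) (Lit 0))
        (Seq (Assign 2 (Cell 1)) (Seq (Assign 3 (Lit 1)) (Assign 4 (Lit 0)))) fallback) produce"
  \<comment> \<open>\<open>h1\<close> is the probability credited to the fallback: 0 for the first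
    claim, the true value for the second.\<close>
  have tail: "ennreal (\<delta> * h1 + (1 - \<delta>) * (v / t)) \<le> wp (condensate_sampler n0) f (initial n)"
    if h1: "0 \<le> h1" "h1 = 0 \<or> h1 = share K a t M / table K a t n \<and> slow_time n0 n \<le> T" for h1
    unfolding condensate_sampler_def rest'_def[symmetric]
  proof (rule wp_Seq_sure[OF sure_find_cutoff[of _ n]])
    fix s1 :: state
    assume "\<exists>K. mem s1 = (mem (initial n))(1 := real K) \<and> n0 \<le> K \<and> n ^ 5 \<le> K ^ 16 \<and>
      (K = n0 \<or> (K - 1) ^ 16 < n ^ 5) \<and> extent s1 \<le> 5 * n + 42 \<and> steps s1 \<le> steps (initial n) + 50 * K + 50"
    then obtain K' where K': "mem s1 = (mem (initial n))(1 := real K')" "n0 \<le> K'" "n ^ 5 \<le> K' ^ 16"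
        "K' = n0 \<or> (K' - 1) ^ 16 < n ^ 5" "extent s1 \<le> 5 * n + 42" "steps s1 \<le> steps (initial n) + 50 * K' + 50"
      by blast
    have "K' = K" unfolding K by (rule cutoff_eqI[OF K'(2-4), symmetric])
    with K' have s1: "mem s1 = (mem (initial n))(1 := real K)" "extent s1 \<le> 5 * n + 42" "steps s1 \<le> 50 * K + 50"
      by (simp_all add: initial_def)
    have r1: "mem s1 0 = real n" "mem s1 1 = real K" using s1(1) by (simp_all add: initial_def)
    have fast: "ennreal (v / t) \<le> wp rest' f (put 5 0 (charge 6 1 s1))"
      unfolding rest'_def
    proof (rule wp_Seq_sure[where Q = "\<lambda>s'. mem s' 0 = real n \<and> mem s' 1 = real K \<and> mem s' 2 = real K \<and>
          mem s' 3 = 1 \<and> mem s' 4 = 0 \<and> extent s' \<le> 5 * n + 42 \<and> steps s' \<le> 50 * K + 80"])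
      fix s2 :: state
      assume s2: "mem s2 0 = real n \<and> mem s2 1 = real K \<and> mem s2 2 = real K \<and>
          mem s2 3 = 1 \<and> mem s2 4 = 0 \<and> extent s2 \<le> 5 * n + 42 \<and> steps s2 \<le> 50 * K + 80"
      have "steps s2 + 600 * (Suc n * (Suc K * Suc K)) + 200 \<le> fast_time n0 n"
        using s2 by (simp add: fast_time_def K del: mult_Suc mult_Suc_right)
      then show "ennreal (v / t) \<le> wp produce f s2"
        unfolding v_def t_def
        by (intro wp_produce[where L = K and n = n and T = T])
          (use s2 K0 M T t0 f in \<open>auto simp: covers_def t_def simp del: mult_Suc mult_Suc_right\<close>)
    qed (use r1 s1 in auto)
    have slow: "ennreal h1 \<le> wp rest' f (put 5 1 (charge 7 1 s1))"
    proof (cases "h1 = 0")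
      case False
      with h1 have h: "h1 = share K a t M / table K a t n" "slow_time n0 n \<le> T" by auto
      show ?thesis
        unfolding rest'_def
      proof (rule wp_Seq_sure[where Q = "\<lambda>s'. mem s' 0 = real n \<and> mem s' 1 = real K \<and> mem s' 2 = real n \<and>
            mem s' 3 = a \<and> mem s' 4 = t \<and> extent s' \<le> 5 * n + 42 \<and>
            steps s' \<le> 50 * K + 200 * (Suc n * (Suc n * Suc n)) + 120"])
        define s2 where "s2 = charge 3 6 (put 5 1 (charge 7 1 s1))"
        have "sure fallback s2 (\<lambda>s'. mem s' 0 = real n \<and> mem s' 1 = real K \<and> mem s' 2 = real n \<and>
            mem s' 3 = y / real n ^ 2 - e \<and> mem s' 4 = y - e \<and> extent s' \<le> 5 * n + 42 \<and>
            steps s' \<le> steps s2 + 200 * (Suc n * (Suc n * Suc n)) + 50)"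
          by (rule sure_fallback) (use r1 s1 n y in \<open>auto simp: s2_def e_def\<close>)
        then have "sure fallback s2 (\<lambda>s'. mem s' 0 = real n \<and> mem s' 1 = real K \<and> mem s' 2 = real n \<and>
            mem s' 3 = a \<and> mem s' 4 = t \<and> extent s' \<le> 5 * n + 42 \<and>
            steps s' \<le> 50 * K + 200 * (Suc n * (Suc n * Suc n)) + 120)"
          by (rule sure_mono) (use s1(3) e in \<open>auto simp: s2_def a_def \<delta>_def\<close>)
        then show "sure (Cond (Equal (Cell 5) (Lit 0)) (Seq (Assign 2 (Cell 1)) (Seq (Assign 3 (Lit 1)) (Assign 4 (Lit 0))))
            fallback) (put 5 1 (charge 7 1 s1)) (\<lambda>s'. mem s' 0 = real n \<and> mem s' 1 = real K \<and> mem s' 2 = real n \<and>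
            mem s' 3 = a \<and> mem s' 4 = t \<and> extent s' \<le> 5 * n + 42 \<and>
            steps s' \<le> 50 * K + 200 * (Suc n * (Suc n * Suc n)) + 120)"
          by (simp add: s2_def del: mult_Suc mult_Suc_right)
        fix s3 :: state
        assume s3: "mem s3 0 = real n \<and> mem s3 1 = real K \<and> mem s3 2 = real n \<and>
            mem s3 3 = a \<and> mem s3 4 = t \<and> extent s3 \<le> 5 * n + 42 \<and>
            steps s3 \<le> 50 * K + 200 * (Suc n * (Suc n * Suc n)) + 120"
        have "steps s3 + 600 * (Suc n * (Suc n * Suc n)) + 200 \<le> slow_time n0 n"
          using s3 by (simp add: slow_time_def fast_time_def K del: mult_Suc mult_Suc_right)
        then show "ennreal h1 \<le> wp produce f s3"
          unfolding h(1)
          by (intro wp_produce[where L = n and n = n and T = T])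
            (use s3 n M h(2) t0 y0 \<delta> a0 f in \<open>auto simp: covers_def ta' simp del: mult_Suc mult_Suc_right\<close>)
      qed
    qed simp
    have "ennreal (\<delta> * h1 + (1 - \<delta>) * (v / t))
        \<le> wp (Sample 5 (Bernoulli (Div (Lit 1) (Mul (Cell 0) (Cell 0))))) (wp rest' f) s1"
    proof (rule wp_Bernoulli)
      show "ennreal (v / t) \<le> wp rest' f (put 5 0 (charge (1 + expr_cost (Div (Lit 1) (Mul (Cell 0) (Cell 0))))
          (expr_extent (Div (Lit 1) (Mul (Cell 0) (Cell 0)))) s1))"
        using fast by simp
      show "ennreal h1 \<le> wp rest' f (put 5 1 (charge (2 + expr_cost (Div (Lit 1) (Mul (Cell 0) (Cell 0))))
          (expr_extent (Div (Lit 1) (Mul (Cell 0) (Cell 0)))) s1))"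
        using slow by simp
      show "eval (Div (Lit 1) (Mul (Cell 0) (Cell 0))) (mem s1) = Some \<delta>"
        using n r1 by (simp add: \<delta>_def power2_eq_square)
    qed (use \<delta> v t0 h1 in auto)
    then show "ennreal (\<delta> * h1 + (1 - \<delta>) * (v / t))
        \<le> wp (Seq (Sample 5 (Bernoulli (Div (Lit 1) (Mul (Cell 0) (Cell 0))))) rest') f s1"
      by (simp add: wp_Seq)
  qed (use n0 in \<open>simp_all add: initial_def\<close>)
  show ?fast using tail[of 0] by (simp add: \<delta>_def v_def t_def)
  show ?slow if "slow_time n0 n \<le> T"
  proof -
    have "0 \<le> share K a t M / table K a t n"
      using a0 t0 by (intro divide_nonneg_nonneg share_nonneg table_nonneg) auto
    then have "ennreal (\<delta> * (share K a t M / table K a t n) + (1 - \<delta>) * (v / t))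
        \<le> wp (condensate_sampler n0) f (initial n)"
      using that by (intro tail) auto
    moreover have "\<delta> * (share K a t M / table K a t n) + (1 - \<delta>) * (v / t) = 1 / y"
      unfolding sh ta unfolding a_def using \<delta>(1) t0 y0 e by (rule fallback_mixture)
    ultimately show ?thesis by simp
  qed
qed

text \<open>A subdistribution that dominates a distribution of mass 1 has no mass to spare. This
  turns lower bounds on the outcomes into exact uniformity and termination.\<close>

lemma lossless_eqI:
  assumes "lossless_spmf p" "\<And>x. spmf p x \<le> spmf q x"
  shows "q = p"
proof -
  have le: "ord_spmf (=) p q" using assms(2) by (intro ord_pmf_increaseI) auto
  have "pmf q None = pmf p None"
    using ord_spmf_eqD_pmf_None[OF Complete_Partial_Order.chain_empty le] assms(1) pmf_nonneg[of q None] by (simp add: lossless_iff_pmf_None)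
  then show ?thesis using ord_spmf_eq_pmf_None_eq[OF Complete_Partial_Order.chain_empty le] by simp
qed

section \<open>Asymptotics of the deadlines\<close>

lemma fast_time_le:
  assumes "0 < n"
  shows "real (fast_time n0 n) \<le> (1200 * (real n0 + 3) ^ 2 + 50 * (real n0 + 3) + 300) * real n powr 1.625"
proof -
  define r where "r = real n powr (5/16)"
  \<comment> \<open>The cutoff plus 1 is at most \<open>n0 + 2 + r\<close>, and
    \<open>r \<ge> 1\<close> absorbs the constants into a multiple of \<open>r\<close>.\<close>
  define c where "c = real n0 + 3"
  have r1: "1 \<le> r" using assms by (simp add: r_def ge_one_powr_ge_zero)
  have n1: "1 \<le> real n" using assms by simp
  have c1: "1 \<le> c" by (simp add: c_def)
  have "real (cutoff n0 n) \<le> real (n0 + nat \<lceil>r\<rceil>)"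
    using cutoff(3)[OF assms, of n0] unfolding r_def of_nat_le_iff .
  also have "\<dots> \<le> real n0 + (r + 1)"
    using r1 of_int_ceiling_le_add_one[of r] by simp
  finally have "real (cutoff n0 n) + 1 \<le> real n0 * 1 + 2 * 1 + r" by simp
  also have "\<dots> \<le> real n0 * r + 2 * r + r" using r1 by (intro add_mono mult_left_mono) auto
  also have "\<dots> = c * r" by (simp add: c_def algebra_simps)
  finally have K: "real (cutoff n0 n) + 1 \<le> c * r" .
  \<comment> \<open>The exponent is \<open>1 + 2 * (5/16)\<close>: \<open>n\<close> energies times
    \<open>r ^ 2\<close> pairs.\<close>
  have p: "real n * r ^ 2 = real n powr 1.625"
  proof -
    have "r ^ 2 = real n powr (5/8)" using assms by (simp add: r_def powr_power)
    then have "real n * r ^ 2 = real n powr 1 * real n powr (5/8)" using assms by simp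
    also have "\<dots> = real n powr (1 + 5/8)" by (rule powr_add[symmetric])
    finally show ?thesis by simp
  qed
  have r2: "r \<le> real n * r ^ 2"
  proof -
    have "1 * 1 \<le> real n * r" using n1 r1 by (intro mult_mono) auto
    then have "1 * r \<le> (real n * r) * r" using r1 by (intro mult_right_mono) auto
    then show ?thesis by (simp add: power2_eq_square mult.assoc)
  qed
  have "real (fast_time n0 n) = 600 * ((real n + 1) * ((real (cutoff n0 n) + 1) * (real (cutoff n0 n) + 1)))
      + 50 * real (cutoff n0 n) + 300"
    by (simp add: fast_time_def algebra_simps)
  also have "\<dots> \<le> 600 * ((2 * real n) * ((c * r) * (c * r))) + 50 * (c * r) + 300 * r"
    using K n1 r1 c1 by (intro add_mono mult_left_mono mult_mono) auto
  also have "\<dots> = 1200 * c ^ 2 * (real n * r ^ 2) + (50 * c + 300) * r"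
    by (simp add: power2_eq_square algebra_simps)
  also have "\<dots> \<le> 1200 * c ^ 2 * (real n * r ^ 2) + (50 * c + 300) * (real n * r ^ 2)"
    using r2 c1 by (intro add_left_mono mult_left_mono) auto
  also have "\<dots> = (1200 * c ^ 2 + 50 * c + 300) * real n powr 1.625"
    unfolding p by (simp add: algebra_simps)
  finally show ?thesis by (simp only: c_def)
qed

text \<open>Dividing the cubic term by \<open>n ^ 2\<close> leaves a linear one, which
  \<open>n powr 1.625\<close> dominates. The constant 6800 is \<open>800 * 2 ^ 3 + 400\<close>, from
  \<open>n + 1 \<le> 2 * n\<close>.\<close>

lemma slow_time_le:
  assumes "0 < n"
  shows "real (slow_time n0 n) * (1 / real n ^ 2) \<le> real (fast_time n0 n) + 6800 * real n powr 1.625"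
proof -
  have n1: "1 \<le> real n" using assms by simp
  have "real n powr 1 \<le> real n powr 1.625" using n1 by (intro powr_mono) auto
  then have np: "real n \<le> real n powr 1.625" using assms by simp
  have c1: "(real n + 1) * ((real n + 1) * (real n + 1)) \<le> (2 * real n) * ((2 * real n) * (2 * real n))"
    using n1 by (intro mult_mono) auto
  have c2: "1 * (1 * 1) \<le> real n * (real n * real n)"
    using n1 by (intro mult_mono) auto
  have "800 * ((real n + 1) * ((real n + 1) * (real n + 1))) + 400
      \<le> 800 * ((2 * real n) * ((2 * real n) * (2 * real n))) + 400 * (real n * (real n * real n))"
    using c1 c2 by linarith
  also have "\<dots> = 6800 * real n * real n ^ 2" by (simp add: power2_eq_square)
  finally have b: "800 * ((real n + 1) * ((real n + 1) * (real n + 1))) + 400 \<le> 6800 * real n * real n ^ 2" .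
  have "real (slow_time n0 n) * (1 / real n ^ 2)
      = real (fast_time n0 n) * (1 / real n ^ 2) + (800 * ((real n + 1) * ((real n + 1) * (real n + 1))) + 400) * (1 / real n ^ 2)"
    by (simp add: slow_time_def algebra_simps)
  also have "\<dots> \<le> real (fast_time n0 n) * 1 + (6800 * real n * real n ^ 2) * (1 / real n ^ 2)"
  proof (intro add_mono mult_left_mono mult_right_mono b)
    show "1 / real n ^ 2 \<le> 1" using one_le_power[OF n1, of 2] assms
      by (subst pos_divide_le_eq) simp_all
  qed auto
  also have "\<dots> = real (fast_time n0 n) + 6800 * real n" using assms by simp
  also have "\<dots> \<le> real (fast_time n0 n) + 6800 * real n powr 1.625" using np by simp
  finally show ?thesis .
qed

theorem theorem1:
  shows "\<exists>P :: program.
    (\<forall>n>0. lossless_spmf (run P n) \<and>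
       map_spmf (\<lambda>s. decode (mem s)) (run P n) = map_spmf Some (spmf_of_set (condensates n))) \<and>
    (\<forall>n>0. expected_time P n < \<infinity>) \<and>
    (\<lambda>n. enn2real (expected_time P n)) \<in> O(\<lambda>n. real n powr 1.625) \<and>
    (\<exists>S :: nat \<Rightarrow> nat. (\<forall>n>0. \<forall>s \<in> set_spmf (run P n). extent s \<le> S n) \<and>
       (\<lambda>n. real (S n)) \<in> O(\<lambda>n. real n))"
proof -
  obtain n0 :: nat where n0: "0 < n0"
    and small: "\<And>n K. n0 \<le> K \<Longrightarrow> n ^ 5 \<le> K ^ 16 \<Longrightarrow> 0 < n \<Longrightarrow>
       table K 0 1 n \<le> real (card (condensates n)) / real n ^ 2"
    by (rule table_0_1_small) blast
  define P where "P = condensate_sampler n0"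
  \<comment> \<open>Output \<open>M\<close> within a deadline and within the space bound. These
    events are disjoint for different \<open>M\<close>, as \<open>decode\<close> determines
    \<open>M\<close>.\<close>
  define E where "E n T M = {s :: state. decode (mem s) = Some M \<and> extent s \<le> 5 * n + 42 \<and> steps s \<le> T}" for n T M
  have sm: "table (cutoff n0 n) 0 1 n \<le> real (card (condensates n)) / real n ^ 2" if "0 < n" for n
    using small cutoff[OF that] that by blast
  have wpE: "wp P (indicator (E n T M)) (initial n) = emeasure (measure_spmf (run P n)) (E n T M)" for n T M
    by (simp add: wp_def run_def)
  have slow: "1 / real (card (condensates n)) \<le> measure (measure_spmf (run P n)) (E n (slow_time n0 n) M)"
    if "0 < n" "M \<in> condensates n" for n M
  proof -
    have "ennreal (1 / real (card (condensates n))) \<le> wp P (indicator (E n (slow_time n0 n) M)) (initial n)"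
      unfolding P_def
      by (rule wp_condensate_sampler(2)[OF n0 that refl refl sm, of "slow_time n0 n"])
        (use that in \<open>auto simp: E_def slow_time_def\<close>)
    then show ?thesis
      unfolding wpE measure_spmf.emeasure_eq_measure by (simp add: ennreal_le_iff)
  qed
  have fast: "(1 - 1 / real n ^ 2) * (share (cutoff n0 n) 1 0 M / table (cutoff n0 n) 1 0 n)
      \<le> measure (measure_spmf (run P n)) (E n (fast_time n0 n) M)"
    if "0 < n" "M \<in> condensates n" for n M
  proof -
    have "ennreal ((1 - 1 / real n ^ 2) * (share (cutoff n0 n) 1 0 M / table (cutoff n0 n) 1 0 n))
        \<le> wp P (indicator (E n (fast_time n0 n) M)) (initial n)"
      unfolding P_def
      by (rule wp_condensate_sampler(1)[OF n0 that refl refl sm, of "fast_time n0 n"])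
        (use that in \<open>auto simp: E_def\<close>)
    then show ?thesis
      unfolding wpE measure_spmf.emeasure_eq_measure by (simp add: ennreal_le_iff)
  qed
  have uniform: "map_spmf (\<lambda>s. decode (mem s)) (run P n) = map_spmf Some (spmf_of_set (condensates n))"
    if n: "0 < n" for n
  proof (rule lossless_eqI)
    show "lossless_spmf (map_spmf Some (spmf_of_set (condensates n)))"
      by (simp add: finite_condensates condensates_nonempty)
    fix x :: "nat multiset multiset option"
    show "spmf (map_spmf Some (spmf_of_set (condensates n))) x \<le> spmf (map_spmf (\<lambda>s. decode (mem s)) (run P n)) x"
    proof (cases "x \<in> Some ` condensates n")
      case True
      then obtain M where M: "x = Some M" "M \<in> condensates n" by auto
      have "spmf (map_spmf Some (spmf_of_set (condensates n))) x = 1 / real (card (condensates n))"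
        using M by (simp add: spmf_map_inj' spmf_of_set finite_condensates card_image)
      also have "\<dots> \<le> measure (measure_spmf (run P n)) (E n (slow_time n0 n) M)"
        by (rule slow[OF n M(2)])
      also have "\<dots> \<le> measure (measure_spmf (run P n)) ((\<lambda>s. decode (mem s)) -` {x})"
        using M by (intro measure_spmf.finite_measure_mono) (auto simp: E_def)
      finally show ?thesis by (simp add: spmf_map)
    next
      case False
      then have "x \<notin> set_spmf (map_spmf Some (spmf_of_set (condensates n)))"
        by (auto simp: finite_condensates)
      then have "spmf (map_spmf Some (spmf_of_set (condensates n))) x = 0"
        by (simp add: spmf_eq_0_set_spmf)
      then show ?thesis by simp
    qed
  qed
  have lossless: "lossless_spmf (run P n)" if "0 < n" for n
  proof -
    have "lossless_spmf (map_spmf (\<lambda>s. decode (mem s)) (run P n))"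
      unfolding uniform[OF that] by (simp add: finite_condensates condensates_nonempty)
    then show ?thesis by simp
  qed
  have disj: "disjoint_family_on (E n T) A" for n T A by (auto simp: disjoint_family_on_def E_def)
  have Union: "measure (measure_spmf (run P n)) (\<Union>M\<in>condensates n. E n T M)
      = (\<Sum>M\<in>condensates n. measure (measure_spmf (run P n)) (E n T M))" for n T
    by (rule measure_spmf.finite_measure_finite_Union[OF finite_condensates _ disj]) auto
  \<comment> \<open>The disjoint events with the long deadline already have total mass 1, so every
    state in the support lies in one of them, which bounds its time and space.\<close>
  have slow_support: "extent s \<le> 5 * n + 42 \<and> steps s \<le> slow_time n0 n" if n: "0 < n" and s: "s \<in> set_spmf (run P n)" for n s
  proof -
    define U where "U = (\<Union>M\<in>condensates n. E n (slow_time n0 n) M)"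
    have "1 = (\<Sum>M\<in>condensates n. 1 / real (card (condensates n)))"
      using finite_condensates[of n] condensates_nonempty[of n] by simp
    also have "\<dots> \<le> measure (measure_spmf (run P n)) U"
      unfolding U_def Union by (intro sum_mono slow n)
    finally have U: "1 \<le> measure (measure_spmf (run P n)) U" .
    have "s \<in> U"
    proof (rule ccontr)
      assume "s \<notin> U"
      then have "measure (measure_spmf (run P n)) (insert s U) = spmf (run P n) s + measure (measure_spmf (run P n)) U"
        using measure_spmf.finite_measure_Union[of "{s}" "run P n" U] by (simp add: spmf_conv_measure_spmf)
      moreover have "measure (measure_spmf (run P n)) (insert s U) \<le> 1"
        by (rule measure_spmf.subprob_measure_le_1)
      moreover have "0 < spmf (run P n) s" using s by (simp add: in_set_spmf_iff_spmf order_less_le)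
      ultimately show False using U by linarith
    qed
    then show ?thesis by (auto simp: U_def E_def)
  qed
  \<comment> \<open>The output probabilities of the truncated sampler sum to 1 over all
    \<open>M\<close>, so its weight in the mixture is a lower bound for meeting the short
    deadline.\<close>
  have fast_mass: "1 - 1 / real n ^ 2 \<le> measure (measure_spmf (run P n)) {s. steps s \<le> fast_time n0 n}"
    if n: "0 < n" for n
  proof (cases "n = 1")
    case True
    then show ?thesis by simp
  next
    case False
    let ?K = "cutoff n0 n"
    have "1 < real n ^ 2" using n False by (intro one_less_power) auto
    then have "real (card (condensates n)) / real n ^ 2 < real (card (condensates n)) / 1"
      using finite_condensates[of n] condensates_nonempty[of n] by (intro divide_strict_left_mono) (auto simp: card_gt_0_iff)
    then have t0: "0 < table ?K 1 0 n" using sm[OF n] table_0_1[of ?K n] by simp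
    have "1 - 1 / real n ^ 2 = (\<Sum>M\<in>condensates n. (1 - 1 / real n ^ 2) * (share ?K 1 0 M / table ?K 1 0 n))"
      unfolding sum_distrib_left[symmetric] sum_divide_distrib[symmetric] sum_share using t0 by simp
    also have "\<dots> \<le> measure (measure_spmf (run P n)) (\<Union>M\<in>condensates n. E n (fast_time n0 n) M)"
      unfolding Union by (intro sum_mono fast n)
    also have "\<dots> \<le> measure (measure_spmf (run P n)) {s. steps s \<le> fast_time n0 n}"
      by (intro measure_spmf.finite_measure_mono) (auto simp: E_def)
    finally show ?thesis .
  qed
  have time: "expected_time P n \<le> ennreal (real (fast_time n0 n) + real (slow_time n0 n) * (1 / real n ^ 2))"
    if n: "0 < n" for n
  proof -
    let ?p = "measure_spmf (run P n)"
    \<comment> \<open>Runs that miss the short deadline still meet the long one, and their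
      probability is at most \<open>1 / n ^ 2\<close>.\<close>
    define B where "B = {s :: state. \<not> steps s \<le> fast_time n0 n}"
    have "expected_time P n \<le> (\<integral>\<^sup>+ s. ennreal (real (fast_time n0 n)) + ennreal (real (slow_time n0 n)) * indicator B s \<partial>?p)"
      unfolding expected_time_def
    proof (rule nn_integral_mono_AE)
      show "AE s in ?p. of_nat (steps s) \<le> ennreal (real (fast_time n0 n)) + ennreal (real (slow_time n0 n)) * indicator B s"
        unfolding AE_measure_spmf_iff
      proof
        fix s assume "s \<in> set_spmf (run P n)"
        with slow_support[OF n] have "steps s \<le> slow_time n0 n" by blast
        then show "of_nat (steps s) \<le> ennreal (real (fast_time n0 n)) + ennreal (real (slow_time n0 n)) * indicator B s"
          by (cases "s \<in> B") (auto simp: B_def ennreal_of_nat_eq_real_of_nat simp flip: ennreal_plus intro!: ennreal_leI)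
      qed
    qed
    also have "\<dots> = ennreal (real (fast_time n0 n)) * emeasure ?p (space ?p) + ennreal (real (slow_time n0 n)) * emeasure ?p B"
      by (simp add: nn_integral_add nn_integral_cmult)
    also have "\<dots> \<le> ennreal (real (fast_time n0 n)) * 1 + ennreal (real (slow_time n0 n)) * ennreal (1 / real n ^ 2)"
    proof (intro add_mono mult_left_mono)
      show "emeasure ?p (space ?p) \<le> 1" by (rule measure_spmf.emeasure_space_le_1)
      have "measure ?p B = measure ?p (space ?p) - measure ?p {s. steps s \<le> fast_time n0 n}"
        by (subst measure_spmf.finite_measure_compl[symmetric]) (auto simp: B_def space_measure_spmf intro!: arg_cong[where f = "measure ?p"])
      also have "\<dots> \<le> 1 - (1 - 1 / real n ^ 2)"
        using fast_mass[OF n] by (intro diff_mono measure_spmf.subprob_measure_le_1)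
      finally show "emeasure ?p B \<le> ennreal (1 / real n ^ 2)"
        unfolding measure_spmf.emeasure_eq_measure by (intro ennreal_leI) simp
    qed auto
    also have "\<dots> = ennreal (real (fast_time n0 n) + real (slow_time n0 n) * (1 / real n ^ 2))"
      by (simp add: ennreal_plus flip: ennreal_mult)
    finally show ?thesis .
  qed
  define C0 where "C0 = 1200 * (real n0 + 3) ^ 2 + 50 * (real n0 + 3) + 300"
  define C where "C = 2 * C0 + 6800"
  have bigO: "(\<lambda>n. enn2real (expected_time P n)) \<in> O(\<lambda>n. real n powr 1.625)"
  proof (rule bigoI[where c = C])
    show "\<forall>\<^sub>F n in sequentially. norm (enn2real (expected_time P n)) \<le> C * norm (real n powr 1.625)"
      using eventually_gt_at_top[of 0]
    proof eventually_elim
      case (elim n)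
      have "enn2real (expected_time P n) \<le> real (fast_time n0 n) + real (slow_time n0 n) * (1 / real n ^ 2)"
        using time[OF elim] by (intro enn2real_leI) auto
      also have "\<dots> \<le> 2 * real (fast_time n0 n) + 6800 * real n powr 1.625"
        using slow_time_le[OF elim, of n0] by linarith
      also have "\<dots> \<le> C * real n powr 1.625"
        unfolding C_def distrib_right mult.assoc
        using fast_time_le[OF elim, of n0, folded C0_def] by (intro add_right_mono mult_left_mono) auto
      finally show ?case by simp
    qed
  qed
  have space: "(\<lambda>n. real (5 * n + 42)) \<in> O(\<lambda>n. real n)"
    by real_asymp
  show ?thesis
  proof (intro exI[of _ P] conjI allI impI)
    show "\<exists>S :: nat \<Rightarrow> nat. (\<forall>n>0. \<forall>s \<in> set_spmf (run P n). extent s \<le> S n) \<and> (\<lambda>n. real (S n)) \<in> O(\<lambda>n. real n)"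
      using slow_support space by (intro exI[of _ "\<lambda>n. 5 * n + 42"]) auto
    show "expected_time P n < \<infinity>" if "0 < n" for n
      using time[OF that] by (rule le_less_trans) simp
  qed (use lossless uniform bigO in auto)
qed

end
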